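(* Let $d\ge1$ be an integer, and let $\tau_k$, $\epsilon$, $N$ and the coefficients $r_j$ of the polynomial $R_d(z)=\sum_{j=0}^{N+\epsilon}r_jz^{2j}$ be as defined in the context. For $\operatorname{Re}s>0$ put $$\eta_{\tau,d}(s)=\sum_{k=1}^\infty\frac{(-1)^{k-1}}{\tau_k^s}.$$ Then $\eta_{\tau,d}$ extends to an entire function, and for all $0\le j\le N+\epsilon$, $$\eta_{\tau,d}(-d+2j)=r_j.$$ In particular, $\eta_{\tau,d}(-d)=r_0=a_d$.
   Context: Extremal function. Let $\mathrm{PW}_r^p(\mathbb R^d)$ be the Paley--Wiener class of functions of spherical exponential type at most $r$ belonging to $L^p(\mathbb R^d)$. The sharp Nikolskii constant $\mathcal C_d$ is defined by $\mathcal C_d^{-1}=\inf\{\|f\|_1: f\in \mathrm{PW}_1^1(\mathbb R^d),\ f(0)=1\}$. It is known that this problem has a unique radial extremal function $x\mapsto\varphi(|x|)$, where $\varphi=\varphi_d$ is an even entire function of exact exponential type $1$, bounded in modulus by one on $\mathbb R$; its positive zeros are $0<\tau_1<\tau_2<\dots$ ($\tau_k=\tau_{k,d}$), $\tau_k\sim\pi k$ as $k\to\infty$, and $\varphi(z)=\prod_{k\ge1}(1-z^2/\tau_k^2)$. It is also known that the extremality condition $g(0)=\frac{\mathcal C_d\omega_{d-1}}2\int_{\mathbb R}\sigma(x)g(x)|x|^{d-1}\,dx$ holds for every even entire function $g$ of exponential type at most $1$ with $|x|^{d-1}g(x)\in L^1(\mathbb R)$, where $\sigma(x)=\operatorname{sign}\varphi(x)$,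 $v_d$ is the volume of the unit ball of $\mathbb R^d$ and $\omega_{d-1}=dv_d$. Put $a_d=\frac1{2v_d\mathcal C_d}$. Parity notation. $\epsilon=0$ if $d$ is odd, $\epsilon=1$ if $d$ is even; $N=\frac{d-1-\epsilon}2$. Signature and the polynomial $P_d$. $\tilde\sigma(x)=\sigma(x)$ if $d$ is odd, $\tilde\sigma(x)=\operatorname{sign}(x)\sigma(x)$ if $d$ is even. The Fourier transform is $\widehat f(t)=\int_{\mathbb R}f(x)e^{-itx}\,dx$, extended to tempered distributions by duality. The restriction of the distribution $2^{1-\epsilon}i^\epsilon\,\widehat{\tilde\sigma}$ to $(-1,1)$ coincides with a real polynomial $P_d(t)=\sum_{n=0}^Np_nt^{2n+\epsilon}$, with $p_N=(-1)^N2^{1-\epsilon}\frac{4a_d}{d!}$; this defines the $p_n$. Polynomial $R_d$. $$R_d(z)=\frac\epsilon2 z^{2(N+\epsilon)}+2^{\epsilon-3}\sum_{n=0}^N(-1)^n(2n+\epsilon+1)!\,p_nz^{2(N-n)}=\sum_{j=0}^{N+\epsilon}r_jz^{2j},$$ which defines the $r_j$. The series for $\eta_{\tau,d}$ converges conditionally for $0<\operatorname{Re}s\le1$ and absolutely for $\operatorname{Re}s>1$; values at points with $\operatorname{Re}s\le0$ are those of the analytic continuation. *)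

theory Defs
  imports "HOL-Complex_Analysis.Complex_Analysis" "HOL-Library.Landau_Symbols"
    "HOL-Computational_Algebra.Polynomial"
begin

text \<open>On \<open>complex ^ 'n\<close> the norm is the Hermitian norm, so there this is spherical
  exponential type at most \<open>r\<close>; on \<open>complex\<close> it is the usual one.\<close>

definition exp_type_le :: "('v::real_normed_vector \<Rightarrow> complex) \<Rightarrow> real \<Rightarrow> bool" where
  "exp_type_le F r \<longleftrightarrow> (\<forall>e>0. \<exists>C. \<forall>z. norm (F z) \<le> C * exp ((r + e) * norm z))"

definition exact_exp_type :: "(complex \<Rightarrow> complex) \<Rightarrow> real \<Rightarrow> bool" where
  "exact_exp_type F r \<longleftrightarrow> exp_type_le F r \<and> (\<forall>r'<r. \<not> exp_type_le F r')"

text \<open>Entire in several variables: Frechet differentiable with complex-linear derivative.\<close>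

definition entire_several :: "(complex ^ 'n \<Rightarrow> complex) \<Rightarrow> bool" where
  "entire_several F \<longleftrightarrow>
     (\<forall>z. \<exists>D. (F has_derivative D) (at z) \<and> (\<forall>c v. D (c *s v) = c * D v))"

definition paley_wiener :: "real \<Rightarrow> real \<Rightarrow> (real ^ 'n \<Rightarrow> complex) set" where
  "paley_wiener r p =
     {f. (\<exists>F. entire_several F \<and> exp_type_le F r \<and>
              (\<forall>x. f x = F (\<chi> i. complex_of_real (x $ i)))) \<and>
         integrable lborel (\<lambda>x. norm (f x) powr p)}"

definition L1_norm :: "(real ^ 'n \<Rightarrow> complex) \<Rightarrow> real" where
  "L1_norm f = (LINT x|lborel. norm (f x))"

definition nikolskii_const :: "'n::finite itself \<Rightarrow> real" where
  "nikolskii_const _ =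
     inverse (Inf {L1_norm f |f :: real ^ 'n \<Rightarrow> complex. f \<in> paley_wiener 1 1 \<and> f 0 = 1})"

definition nikolskii_extremal :: "(real ^ 'n::finite \<Rightarrow> complex) \<Rightarrow> bool" where
  "nikolskii_extremal f \<longleftrightarrow>
     f \<in> paley_wiener 1 1 \<and> f 0 = 1 \<and> L1_norm f = inverse (nikolskii_const TYPE('n))"

definition vball :: "'n::finite itself \<Rightarrow> real" where
  "vball _ = measure lborel (ball (0 :: real ^ 'n) 1)"

definition nikolskii_a :: "'n::finite itself \<Rightarrow> real" where
  "nikolskii_a T = 1 / (2 * vball T * nikolskii_const T)"

definition par :: "nat \<Rightarrow> nat" where
  "par d = (if odd d then 0 else 1)"

definition NN :: "nat \<Rightarrow> nat" where
  "NN d = (d - 1 - par d) div 2"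

text \<open>The functions \<open>\<phi>\<close> considered are real on the real line, so taking the real part
  only serves to land in type \<open>real\<close>.\<close>

definition signature :: "(complex \<Rightarrow> complex) \<Rightarrow> real \<Rightarrow> real" where
  "signature \<phi> x = sgn (Re (\<phi> (complex_of_real x)))"

definition signature_tilde :: "nat \<Rightarrow> (complex \<Rightarrow> complex) \<Rightarrow> real \<Rightarrow> real" where
  "signature_tilde d \<phi> x = (if odd d then signature \<phi> x else sgn x * signature \<phi> x)"

definition fourier :: "(real \<Rightarrow> complex) \<Rightarrow> real \<Rightarrow> complex" where
  "fourier f t = (LINT x|lborel. f x * exp (- \<i> * of_real t * of_real x))"

text \<open>Distributions are represented as functionals on functions \<open>real \<Rightarrow> complex\<close>. The pairing
  is bilinear (no conjugation), and only the values on test functions and on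
  their Fourier transforms, which are Schwartz functions, are relevant.\<close>

definition regular_dist :: "(real \<Rightarrow> complex) \<Rightarrow> (real \<Rightarrow> complex) \<Rightarrow> complex" where
  "regular_dist u \<psi> = (LINT x|lborel. u x * \<psi> x)"

definition fourier_dist :: "((real \<Rightarrow> complex) \<Rightarrow> complex) \<Rightarrow> (real \<Rightarrow> complex) \<Rightarrow> complex" where
  "fourier_dist T \<psi> = T (fourier \<psi>)"

definition scale_dist :: "complex \<Rightarrow> ((real \<Rightarrow> complex) \<Rightarrow> complex) \<Rightarrow> (real \<Rightarrow> complex) \<Rightarrow> complex" where
  "scale_dist c T \<psi> = c * T \<psi>"

definition smooth_fun :: "(real \<Rightarrow> complex) \<Rightarrow> bool" where
  "smooth_fun \<psi> \<longleftrightarrow>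
     (\<exists>D :: nat \<Rightarrow> real \<Rightarrow> complex.
        D 0 = \<psi> \<and> (\<forall>n x. (D n has_vector_derivative D (Suc n) x) (at x)))"

definition test_functions :: "real set \<Rightarrow> (real \<Rightarrow> complex) set" where
  "test_functions U =
     {\<psi>. smooth_fun \<psi> \<and> (\<exists>K. compact K \<and> K \<subseteq> U \<and> (\<forall>x. x \<notin> K \<longrightarrow> \<psi> x = 0))}"

definition restricts_to ::
  "((real \<Rightarrow> complex) \<Rightarrow> complex) \<Rightarrow> real set \<Rightarrow> (real \<Rightarrow> complex) \<Rightarrow> bool" where
  "restricts_to T U h \<longleftrightarrow> (\<forall>\<psi>\<in>test_functions U. T \<psi> = regular_dist h \<psi>)"

definition P_poly :: "nat \<Rightarrow> (nat \<Rightarrow> real) \<Rightarrow> real poly" where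
  "P_poly d p = (\<Sum>n\<le>NN d. monom (p n) (2 * n + par d))"

definition R_poly :: "nat \<Rightarrow> (nat \<Rightarrow> real) \<Rightarrow> real poly" where
  "R_poly d p =
     monom (real (par d) / 2) (2 * (NN d + par d)) +
     smult (2 powi (int (par d) - 3))
       (\<Sum>n\<le>NN d. monom ((-1) ^ n * fact (2 * n + par d + 1) * p n) (2 * (NN d - n)))"

definition r_coeff :: "nat \<Rightarrow> (nat \<Rightarrow> real) \<Rightarrow> nat \<Rightarrow> real" where
  "r_coeff d p j = coeff (R_poly d p) (2 * j)"

end

theory Submission
  imports Defs "HOL-Probability.Probability" "HOL-Real_Asymp.Real_Asymp"
begin

text \<open>The signature \<open>\<sigma>\<close> is a step function with jumps at the zeros, so the alternating sum over the zeros of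
  a Schwartz function is an integral of \<open>\<sigma>\<close> against its derivative. Write \<open>\<epsilon>\<close> for the parity of \<open>d + 1\<close>,
  let \<open>A\<close> be the function that is \<open>1\<close> between \<open>\<tau>\<^sub>2\<^sub>k\<^sub>-\<^sub>1\<close> and \<open>\<tau>\<^sub>2\<^sub>k\<close> and \<open>0\<close> on the other gaps, and let
  \<open>D(w) = \<Sum>\<^sub>k (-1)\<^sup>k\<^sup>-\<^sup>1 \<tau>\<^sub>k\<^sup>1\<^sup>-\<^sup>\<epsilon> exp (- w \<tau>\<^sub>k\<^sup>2)\<close> be the theta function of the zeros. To avoid convergence questions \<open>D\<close> only
  ever occurs as minus the integral of \<open>A\<close> against the kernel \<open>d/dx (x\<^sup>1\<^sup>-\<^sup>\<epsilon> exp (- w x\<^sup>2))\<close>.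

  The proof follows Riemann's continuation of the zeta function. For \<open>Re s > 0\<close> and \<open>z = (s + 1 - \<epsilon>)/2\<close> the
  series is \<open>s \<integral> A(x) x\<^sup>-\<^sup>s\<^sup>-\<^sup>1 dx\<close> (\<open>eta_sums\<close>) and Fubini turns this into
  \<open>\<Gamma>(z) \<eta>(s) = \<integral> w\<^sup>z\<^sup>-\<^sup>1 D(w) dw\<close> (\<open>theta_mellin\<close>). At infinity \<open>D\<close> decays faster than any power (\<open>theta_large\<close>).
  At zero it agrees with a polynomial \<open>\<Sum>\<^sub>m b\<^sub>m w\<^sup>m\<close> up to every power of \<open>w\<close> (\<open>theta_small\<close>); this is where the hypothesis on
  the Fourier transform of the signature enters. As \<open>w\<close> tends to \<open>0\<close> the Fourier transform of the kernel concentrates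
  at the origin, inside the interval where the transform of the signature is the polynomial \<open>P\<close>. The
  \<open>b\<^sub>m\<close> are therefore Gaussian moments of \<open>P\<close>, and what leaks out of the interval is negligible
  (\<open>signature_gaussian_asymptotics\<close>).

  Hence the Mellin integral is an entire function plus \<open>\<Sum>\<^sub>m b\<^sub>m / (z + m)\<close> (\<open>mellin_split\<close>). Multiplication
  by \<open>1 / \<Gamma>(z)\<close> removes the poles and leaves the value \<open>(-1)\<^sup>m m! b\<^sub>m\<close> at \<open>z = -m\<close>
  (\<open>rGamma_continuation\<close>). These values are the coefficients of \<open>R_poly\<close>, read backwards (\<open>r_coeff_theta_coeff\<close>).

  The identity \<open>r\<^sub>0 = a\<^sub>d\<close> is a statement about the leading coefficient of \<open>P\<close>. It follows by inserting
  the Fourier transform of one cutoff function into the extremality condition (\<open>leading_coefficient\<close>).\<close>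

section \<open>Smooth functions and cutoffs\<close>


text \<open>The chain of all derivatives never has to be written down: it is enough that each member of
  some class of functions has a derivative in the same class.\<close>

lemma smooth_funI:
  assumes "f \<in> S" and "\<And>g. g \<in> S \<Longrightarrow> \<exists>g'\<in>S. \<forall>x. (g has_vector_derivative g' x) (at x)"
  shows "smooth_fun f"
proof -
  obtain D where D: "\<And>g. g \<in> S \<Longrightarrow> D g \<in> S"
      "\<And>g x. g \<in> S \<Longrightarrow> (g has_vector_derivative D g x) (at x)"
    using assms(2) by metis
  have "(D ^^ n) f \<in> S" for n
    by (induction n) (use assms(1) D in auto)
  then show ?thesis
    unfolding smooth_fun_def using D by (intro exI[of _ "\<lambda>n. (D ^^ n) f"]) auto
qed

lemma smooth_fun_deriv:
  assumes "smooth_fun f"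
  obtains f' where "smooth_fun f'" "\<And>x. (f has_vector_derivative f' x) (at x)"
proof -
  obtain D where "D 0 = f" "\<And>n x. (D n has_vector_derivative D (Suc n) x) (at x)"
    using assms unfolding smooth_fun_def by blast
  then show ?thesis
    by (intro that[of "D (Suc 0)"]) (auto simp: smooth_fun_def intro!: exI[of _ "\<lambda>n. D (Suc n)"])
qed

lemma smooth_fun_continuous: "smooth_fun f \<Longrightarrow> continuous_on A f"
  by (meson smooth_fun_deriv has_vector_derivative_continuous continuous_at_imp_continuous_on)

text \<open>Finite sums of products of smooth functions are closed under differentiation, which
  replaces the Leibniz formula for higher derivatives.\<close>

lemma smooth_fun_mult:
  assumes "smooth_fun f" "smooth_fun g"
  shows "smooth_fun (\<lambda>x. f x * g x)"
proof -
  define S where "S = {\<lambda>x. \<Sum>(a, b)\<leftarrow>l. a x * b x |l. \<forall>(a, b)\<in>set l. smooth_fun a \<and> smooth_fun b}"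
  have "(\<lambda>x. f x * g x) \<in> S"
    unfolding S_def using assms by (intro CollectI exI[of _ "[(f, g)]"]) auto
  then show ?thesis
  proof (rule smooth_funI)
    fix h assume "h \<in> S"
    then obtain l where h: "h = (\<lambda>x. \<Sum>(a, b)\<leftarrow>l. a x * b x)"
      and l: "\<forall>(a, b)\<in>set l. smooth_fun a \<and> smooth_fun b"
      unfolding S_def by blast
    have "\<exists>l'. (\<forall>(a, b)\<in>set l'. smooth_fun a \<and> smooth_fun b) \<and>
       (\<forall>x. ((\<lambda>x. \<Sum>(a, b)\<leftarrow>l. a x * b x) has_vector_derivative (\<Sum>(a, b)\<leftarrow>l'. a x * b x)) (at x))"
      using l
    proof (induction l)
      case Nil
      show ?case by (intro exI[of _ "[]"]) auto
    next
      case (Cons p l)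
      obtain a b where p: "p = (a, b)" by force
      obtain l' where l': "\<forall>(a, b)\<in>set l'. smooth_fun a \<and> smooth_fun b"
         "\<And>x. ((\<lambda>x. \<Sum>(a, b)\<leftarrow>l. a x * b x) has_vector_derivative (\<Sum>(a, b)\<leftarrow>l'. a x * b x)) (at x)"
        using Cons by auto
      have ab: "smooth_fun a" "smooth_fun b" using Cons.prems p by auto
      obtain a' where a': "smooth_fun a'" "\<And>x. (a has_vector_derivative a' x) (at x)"
        using smooth_fun_deriv[OF ab(1)] by blast
      obtain b' where b': "smooth_fun b'" "\<And>x. (b has_vector_derivative b' x) (at x)"
        using smooth_fun_deriv[OF ab(2)] by blast
      show ?case
      proof (intro exI[of _ "(a, b') # (a', b) # l'"] conjI allI)
        fix x
        have "((\<lambda>x. a x * b x + (\<Sum>(a, b)\<leftarrow>l. a x * b x)) has_vector_derivative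
            (a x * b' x + a' x * b x) + (\<Sum>(a, b)\<leftarrow>l'. a x * b x)) (at x)"
          by (intro has_vector_derivative_add has_vector_derivative_mult a' b' l')
        then show "((\<lambda>x. \<Sum>(a, b)\<leftarrow>p # l. a x * b x) has_vector_derivative
            (\<Sum>(a, b)\<leftarrow>(a, b') # (a', b) # l'. a x * b x)) (at x)"
          by (simp add: p algebra_simps)
      qed (use ab a' b' l' in auto)
    qed
    then obtain l' where "\<forall>(a, b)\<in>set l'. smooth_fun a \<and> smooth_fun b"
      and "\<forall>x. (h has_vector_derivative (\<Sum>(a, b)\<leftarrow>l'. a x * b x)) (at x)"
      unfolding h by blast
    then show "\<exists>g'\<in>S. \<forall>x. (h has_vector_derivative g' x) (at x)"
      by (intro bexI[of _ "\<lambda>x. \<Sum>(a, b)\<leftarrow>l'. a x * b x"]) (auto simp: S_def)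
  qed
qed

lemma smooth_fun_affine:
  assumes "smooth_fun f"
  shows "smooth_fun (\<lambda>x. f (a * x + b))"
proof -
  obtain D where D: "D 0 = f" "\<And>n x. (D n has_vector_derivative D (Suc n) x) (at x)"
    using assms unfolding smooth_fun_def by blast
  have *: "((\<lambda>x. D n (a * x + b)) has_vector_derivative (a *\<^sub>R D (Suc n) (a * x + b))) (at x)" for n x
  proof -
    have "((\<lambda>x. a * x + b) has_vector_derivative a) (at x)"
      by (auto intro!: derivative_eq_intros simp flip: has_real_derivative_iff_has_vector_derivative)
    from vector_diff_chain_at[OF this D(2)] show ?thesis by (simp add: o_def)
  qed
  show ?thesis
    unfolding smooth_fun_def
  proof (intro exI[of _ "\<lambda>n x. a ^ n *\<^sub>R D n (a * x + b)"] conjI allI)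
    fix n x
    show "((\<lambda>x. a ^ n *\<^sub>R D n (a * x + b)) has_vector_derivative a ^ Suc n *\<^sub>R D (Suc n) (a * x + b)) (at x)"
      using bounded_linear.has_vector_derivative[OF bounded_linear_scaleR_right *, of "a ^ n" n x]
      by (simp add: mult.commute)
  qed (use D in auto)
qed

text \<open>All derivatives are polynomials in \<open>1/x\<close> times \<open>exp (-1/x)\<close>, and these vanish faster than
  \<open>x\<close> at the origin, so the two halves fit together.\<close>

lemma smooth_fun_flat:
  "smooth_fun (\<lambda>x. complex_of_real (if x > 0 then exp (- 1 / x) else 0))"
proof -
  define F :: "real poly \<Rightarrow> real \<Rightarrow> real"
    where "F q x = (if x > 0 then poly q (1 / x) * exp (- 1 / x) else 0)" for q x
  have lim: "((\<lambda>y. poly q y * exp (- y)) \<longlongrightarrow> 0) at_top" for q :: "real poly"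
  proof -
    have "((\<lambda>y. \<Sum>i\<le>degree q. coeff q i * (y ^ i / exp y)) \<longlongrightarrow> (\<Sum>i\<le>degree q. coeff q i * 0)) at_top"
      by (intro tendsto_intros tendsto_power_div_exp_0)
    then show ?thesis
      by (simp add: poly_altdef sum_distrib_right sum_divide_distrib exp_minus field_simps)
  qed
  have der: "(F q has_real_derivative F ([:0, 0, 1:] * (q - pderiv q)) x) (at x)" for q x
  proof -
    consider "x > 0" | "x < 0" | "x = 0" by linarith
    then show ?thesis
    proof cases
      case 1
      have "((\<lambda>x. poly q (1 / x) * exp (- 1 / x)) has_real_derivative
            F ([:0, 0, 1:] * (q - pderiv q)) x) (at x)"
        using 1 unfolding F_def
        by (auto intro!: derivative_eq_intros DERIV_chain2[OF poly_DERIV] simp: field_simps)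
      then show ?thesis
        by (rule DERIV_cong_ev[OF refl _ refl, THEN iffD2, rotated])
           (use eventually_nhds_in_open[of "{0<..}" x] 1 in \<open>auto elim!: eventually_mono simp: F_def\<close>)
    next
      case 2
      have "((\<lambda>x. 0) has_real_derivative F ([:0, 0, 1:] * (q - pderiv q)) x) (at x)"
        using 2 by (simp add: F_def)
      then show ?thesis
        by (rule DERIV_cong_ev[OF refl _ refl, THEN iffD2, rotated])
           (use eventually_nhds_in_open[of "{..<0}" x] 2 in \<open>auto elim!: eventually_mono simp: F_def\<close>)
    next
      case 3
      have r: "((\<lambda>h. F q h / h) \<longlongrightarrow> 0) (at_right 0)"
      proof -
        have "((\<lambda>h. poly ([:0, 1:] * q) (inverse h) * exp (- inverse h)) \<longlongrightarrow> 0) (at_right 0)"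
          using lim[of "[:0, 1:] * q"] filterlim_inverse_at_top_right by (rule filterlim_compose)
        moreover have "\<forall>\<^sub>F h in at_right 0. poly ([:0, 1:] * q) (inverse h) * exp (- inverse h) = F q h / h"
          using eventually_at_right_less[of "0::real"]
          by eventually_elim (auto simp: F_def field_simps)
        ultimately show ?thesis by (rule Lim_transform_eventually)
      qed
      have l: "((\<lambda>h. F q h / h) \<longlongrightarrow> 0) (at_left 0)"
        by (rule tendsto_eventually)
           (auto simp: F_def eventually_at_filter)
      have "((\<lambda>h. (F q (0 + h) - F q 0) / h) \<longlongrightarrow> 0) (at 0)"
        using filterlim_split_at[OF l r] by (simp add: F_def)
      then show ?thesis
        unfolding DERIV_def using 3 by (simp add: F_def)
    qed
  qed
  have "(\<lambda>x. complex_of_real (if x > 0 then exp (- 1 / x) else 0)) = (\<lambda>x. complex_of_real (F 1 x))"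
    by (auto simp: F_def)
  then have "(\<lambda>x. complex_of_real (if x > 0 then exp (- 1 / x) else 0)) \<in> range (\<lambda>q x. complex_of_real (F q x))"
    by auto
  then show ?thesis
  proof (rule smooth_funI)
    fix g assume "g \<in> range (\<lambda>q x. complex_of_real (F q x))"
    then obtain q where "g = (\<lambda>x. complex_of_real (F q x))" by blast
    then show "\<exists>g'\<in>range (\<lambda>q x. complex_of_real (F q x)). \<forall>x. (g has_vector_derivative g' x) (at x)"
      using der by (auto simp: has_real_derivative_iff_has_vector_derivative
         intro!: bounded_linear.has_vector_derivative[OF bounded_linear_of_real])
  qed
qed

text \<open>The normalised primitive of a bump function supported in the unit interval.\<close>

lemma smooth_step:
  obtains S :: "real \<Rightarrow> real" where "smooth_fun (\<lambda>x. complex_of_real (S x))"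
    "\<And>x. x \<le> 0 \<Longrightarrow> S x = 0" "\<And>x. 1 \<le> x \<Longrightarrow> S x = 1" "\<And>x. 0 \<le> S x"
proof -
  define f :: "real \<Rightarrow> real" where "f x = (if x > 0 then exp (- 1 / x) else 0)" for x
  define b where "b x = f x * f (1 - x)" for x
  have f: "smooth_fun (\<lambda>x. complex_of_real (f x))"
    unfolding f_def by (rule smooth_fun_flat)
  have b: "smooth_fun (\<lambda>x. complex_of_real (b x))"
    using smooth_fun_mult[OF f smooth_fun_affine[OF f, of "-1" 1]]
    by (simp add: b_def)
  have b_cont: "continuous_on A b" for A
  proof -
    have "continuous_on A (\<lambda>x. Re (complex_of_real (b x)))"
      by (intro continuous_intros smooth_fun_continuous[OF b])
    then show ?thesis by simp
  qed
  have b0: "b x \<ge> 0" for x by (auto simp: b_def f_def)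
  define B where "B x = integral {-1..x} b" for x
  have B_der: "(B has_real_derivative b x) (at x)" if "x > -1" for x
  proof -
    have "(B has_real_derivative b x) (at x within {-1..x+1})"
      unfolding B_def using that by (intro integral_has_real_derivative b_cont) auto
    moreover have "at x within {-1..x+1} = at x"
      using that by (intro at_within_interior) auto
    ultimately show ?thesis by simp
  qed
  have bz: "b x = 0" if "x \<le> 0 \<or> x \<ge> 1" for x using that by (auto simp: b_def f_def)
  have B0: "B x = 0" if "x \<le> 0" for x
    unfolding B_def using that by (subst integral_cong[where g = "\<lambda>_. 0"]) (auto simp: bz)
  have B1: "B x = B 1" if "1 \<le> x" for x
  proof -
    have "integral {-1..1} b + integral {1..x} b = B x"
      unfolding B_def using that
      by (intro Henstock_Kurzweil_Integration.integral_combine integrable_continuous_real b_cont) auto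
    moreover have "integral {1..x} b = 0"
      by (subst integral_cong[where g = "\<lambda>_. 0"]) (auto simp: bz)
    ultimately show ?thesis by (simp add: B_def)
  qed
  have "B 1 > 0"
  proof -
    have "B 0 < B 1"
    proof (rule DERIV_pos_imp_increasing_open[of 0 1 B])
      fix x :: real assume "0 < x" "x < 1"
      then show "\<exists>y. (B has_real_derivative y) (at x) \<and> y > 0"
        by (intro exI[of _ "b x"] conjI B_der) (auto simp: b_def f_def)
    next
      show "continuous_on {0..1} B"
        by (rule DERIV_continuous_on[where D = b]) (rule has_field_derivative_at_within, rule B_der, simp)
    qed simp
    then show ?thesis using B0 by auto
  qed
  have Bnn: "B x \<ge> 0" for x
    unfolding B_def by (intro integral_nonneg integrable_continuous_real b_cont) (auto simp: b0)
  have B_der': "(B has_real_derivative b x) (at x)" for x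
  proof (cases "x > -1")
    case False
    then have "((\<lambda>x. 0) has_real_derivative b x) (at x)" by (simp add: bz)
    then show ?thesis
      by (rule DERIV_cong_ev[OF refl _ refl, THEN iffD2, rotated])
         (use eventually_nhds_in_open[of "{..<0}" x] False in \<open>auto elim!: eventually_mono simp: B0\<close>)
  qed (rule B_der)
  define S where "S x = B x / B 1" for x
  obtain D where D: "D 0 = (\<lambda>x. complex_of_real (b x))"
      "\<And>n x. (D n has_vector_derivative D (Suc n) x) (at x)"
    using b unfolding smooth_fun_def by blast
  have "smooth_fun (\<lambda>x. complex_of_real (S x))"
    unfolding smooth_fun_def
  proof (intro exI[of _ "\<lambda>n x. case n of 0 \<Rightarrow> complex_of_real (S x) | Suc m \<Rightarrow> (1 / B 1) *\<^sub>R D m x"] conjI allI)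
    fix n x
    show "((\<lambda>x. case n of 0 \<Rightarrow> complex_of_real (S x) | Suc m \<Rightarrow> (1 / B 1) *\<^sub>R D m x) has_vector_derivative
         (case Suc n of 0 \<Rightarrow> complex_of_real (S x) | Suc m \<Rightarrow> (1 / B 1) *\<^sub>R D m x)) (at x)"
    proof (cases n)
      case 0
      have "((\<lambda>x. complex_of_real (S x)) has_vector_derivative complex_of_real (b x / B 1)) (at x)"
        unfolding S_def
        by (intro bounded_linear.has_vector_derivative[OF bounded_linear_of_real])
           (auto simp flip: has_real_derivative_iff_has_vector_derivative intro!: DERIV_cdivide B_der')
      then show ?thesis using 0 by (simp add: D scaleR_conv_of_real)
    next
      case (Suc m)
      show ?thesis
        using bounded_linear.has_vector_derivative[OF bounded_linear_scaleR_right D(2)[of m x], of "1 / B 1"] Suc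
        by simp
    qed
  qed auto
  moreover have "S x = 0" if "x \<le> 0" for x
    using B0[OF that] by (simp add: S_def)
  moreover have "S x = 1" if "1 \<le> x" for x
    using B1[OF that] \<open>B 1 > 0\<close> by (simp add: S_def)
  moreover have "S x \<ge> 0" for x
    using Bnn \<open>B 1 > 0\<close> by (simp add: S_def)
  ultimately show ?thesis
    by (rule that)
qed

lemma smooth_cutoff:
  obtains \<kappa> :: "real \<Rightarrow> real" where "smooth_fun (\<lambda>x. complex_of_real (\<kappa> x))"
    "\<And>x. \<kappa> (- x) = \<kappa> x" "\<And>x. 0 \<le> \<kappa> x" "\<And>x. \<bar>x\<bar> \<le> 1/2 \<Longrightarrow> \<kappa> x = 1" "\<And>x. 3/4 \<le> \<bar>x\<bar> \<Longrightarrow> \<kappa> x = 0"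
proof -
  obtain S :: "real \<Rightarrow> real" where S: "smooth_fun (\<lambda>x. complex_of_real (S x))"
    "\<And>x. x \<le> 0 \<Longrightarrow> S x = 0" "\<And>x. 1 \<le> x \<Longrightarrow> S x = 1" "\<And>x. 0 \<le> S x"
    using smooth_step by blast
  show ?thesis
  proof
    show "smooth_fun (\<lambda>x. complex_of_real (S (4 * x + 3) * S (-4 * x + 3)))"
      using smooth_fun_mult[OF smooth_fun_affine[OF S(1), of 4 3] smooth_fun_affine[OF S(1), of "-4" 3]] by simp
  next
    fix x :: real
    show "S (4 * x + 3) * S (-4 * x + 3) = 0" if "3/4 \<le> \<bar>x\<bar>"
    proof (cases "x \<ge> 0")
      case True
      then have "S (-4 * x + 3) = 0" using that by (intro S) auto
      then show ?thesis by simp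
    next
      case False
      then have "S (4 * x + 3) = 0" using that by (intro S) auto
      then show ?thesis by simp
    qed
  qed (use S in \<open>auto simp: mult.commute\<close>)
qed


section \<open>Fourier transforms and test functions\<close>

lemma integral_vector_derivative_UNIV:
  fixes F f :: "real \<Rightarrow> complex"
  assumes "\<And>x. (F has_vector_derivative f x) (at x)" "continuous_on UNIV f" "integrable lborel f"
    and "(F \<longlongrightarrow> 0) at_top" "(F \<longlongrightarrow> 0) at_bot"
  shows "(LINT x|lborel. f x) = 0"
proof -
  have "(LBINT x=-\<infinity>..\<infinity>. f x) = 0 - 0"
    by (rule interval_integral_FTC_integrable)
       (use assms in \<open>auto simp: ereal_tendsto_simps set_integrable_def continuous_on_eq_continuous_at\<close>)
  then show ?thesis
    by (simp add: interval_lebesgue_integral_def set_lebesgue_integral_def)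
qed

lemma norm_exp_fourier [simp]: "norm (exp (- (\<i> * complex_of_real t * complex_of_real x))) = 1"
  using norm_exp_i_times[of "- (t * x)"] by (simp add: mult.assoc)

lemma fourier_integrable:
  assumes "integrable lborel f"
  shows "integrable lborel (\<lambda>x. f x * exp (- \<i> * of_real t * of_real x))"
  by (rule Bochner_Integration.integrable_bound[OF assms])
     (use borel_measurable_integrable[OF assms] in \<open>auto simp: norm_mult\<close>)

lemma fourier_diff:
  assumes "integrable lborel f" "integrable lborel g"
  shows "fourier (\<lambda>x. f x - g x) t = fourier f t - fourier g t"
  unfolding fourier_def left_diff_distrib
  by (intro Bochner_Integration.integral_diff fourier_integrable assms)

lemma fourier_bound:
  assumes "integrable lborel f"
  shows "norm (fourier f t) \<le> (LINT x|lborel. norm (f x))"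
proof -
  have "norm (fourier f t) \<le> (LINT x|lborel. norm (f x * exp (- \<i> * of_real t * of_real x)))"
    unfolding fourier_def by (rule integral_norm_bound)
  then show ?thesis by (simp add: norm_mult)
qed

lemma fourier_measurable:
  assumes [measurable]: "f \<in> borel_measurable borel"
  shows "fourier f \<in> borel_measurable borel"
  unfolding fourier_def by measurable

lemma fourier_deriv:
  fixes f f' :: "real \<Rightarrow> complex"
  assumes "\<And>x. (f has_vector_derivative f' x) (at x)" "continuous_on UNIV f'"
    and int: "integrable lborel f" "integrable lborel f'"
    and "(f \<longlongrightarrow> 0) at_top" "(f \<longlongrightarrow> 0) at_bot"
  shows "fourier f' t = \<i> * of_real t * fourier f t"
proof -
  let ?e = "\<lambda>x. exp (- \<i> * of_real t * of_real x)"
  have e: "(?e has_vector_derivative - \<i> * of_real t * ?e x) (at x)" for x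
  proof -
    have "((\<lambda>z. exp (- \<i> * of_real t * z)) has_field_derivative - \<i> * of_real t * ?e x) (at (of_real x))"
      by (auto intro!: derivative_eq_intros)
    from has_vector_derivative_real_field[OF this] show ?thesis .
  qed
  have cf: "continuous_on UNIV f"
    using assms(1) by (meson has_vector_derivative_continuous continuous_at_imp_continuous_on)
  have "(LINT x|lborel. f x * (- \<i> * of_real t * ?e x) + f' x * ?e x) = 0"
  proof (rule integral_vector_derivative_UNIV)
    show "((\<lambda>x. f x * ?e x) has_vector_derivative f x * (- \<i> * of_real t * ?e x) + f' x * ?e x) (at x)" for x
      by (intro has_vector_derivative_mult assms e)
    have "integrable lborel (\<lambda>x. (- \<i> * of_real t) * (f x * ?e x) + f' x * ?e x)"
      by (intro Bochner_Integration.integrable_add integrable_mult_right fourier_integrable int)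
    then show "integrable lborel (\<lambda>x. f x * (- \<i> * of_real t * ?e x) + f' x * ?e x)"
      by (simp add: algebra_simps)
    show "continuous_on UNIV (\<lambda>x. f x * (- \<i> * of_real t * ?e x) + f' x * ?e x)"
      by (intro continuous_intros cf assms)
    have "((\<lambda>x. f x * ?e x) \<longlongrightarrow> 0) F" if "(f \<longlongrightarrow> 0) F" for F
      by (rule tendsto_norm_zero_cancel) (use tendsto_norm_zero[OF that] in \<open>simp add: norm_mult\<close>)
    then show "((\<lambda>x. f x * ?e x) \<longlongrightarrow> 0) at_top" "((\<lambda>x. f x * ?e x) \<longlongrightarrow> 0) at_bot"
      using assms by blast+
  qed
  moreover have "(LINT x|lborel. f x * (- \<i> * of_real t * ?e x) + f' x * ?e x)
     = (LINT x|lborel. (- \<i> * of_real t) * (f x * ?e x) + f' x * ?e x)"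
    by (intro Bochner_Integration.integral_cong) (auto simp: algebra_simps)
  moreover have "\<dots> = (- \<i> * of_real t) * fourier f t + fourier f' t"
    unfolding fourier_def
    by (subst Bochner_Integration.integral_add)
       (intro integrable_mult_right fourier_integrable int | simp)+
  ultimately show ?thesis by (simp add: algebra_simps add_eq_0_iff)
qed

lemma integrable_inverse_1_plus_square_UNIV: "integrable lborel (\<lambda>x::real. inverse (1 + x\<^sup>2))"
  using integrable_inverse_1_plus_square by (simp add: set_integrable_def)

lemma integral_inverse_1_plus_square_UNIV: "(LINT x|lborel. inverse (1 + (x::real)\<^sup>2)) = pi"
  using LBINT_inverse_1_plus_square
  by (simp add: interval_lebesgue_integral_def set_lebesgue_integral_def)

text \<open>Two derivatives in \<open>L\<^sup>1\<close> make the Fourier transform integrable, with a bound by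
  their norms.\<close>

lemma fourier_decay:
  fixes h h' h'' :: "real \<Rightarrow> complex"
  assumes "\<And>x. (h has_vector_derivative h' x) (at x)" "\<And>x. (h' has_vector_derivative h'' x) (at x)"
    and "continuous_on UNIV h''"
    and int: "integrable lborel h" "integrable lborel h'" "integrable lborel h''"
    and "(h \<longlongrightarrow> 0) at_top" "(h \<longlongrightarrow> 0) at_bot" "(h' \<longlongrightarrow> 0) at_top" "(h' \<longlongrightarrow> 0) at_bot"
  shows "norm (fourier h t) \<le> ((LINT x|lborel. norm (h x)) + (LINT x|lborel. norm (h'' x))) * inverse (1 + t\<^sup>2)"
proof -
  have ch: "continuous_on UNIV h'"
    using assms(2) by (meson has_vector_derivative_continuous continuous_at_imp_continuous_on)
  have "fourier h'' t = (\<i> * of_real t) * ((\<i> * of_real t) * fourier h t)"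
    using fourier_deriv[of h' h'' t] fourier_deriv[of h h' t] assms ch by simp
  then have "norm (fourier h'' t) = t\<^sup>2 * norm (fourier h t)"
    by (simp add: norm_mult power2_eq_square)
  then have "norm (fourier h t) * (1 + t\<^sup>2) \<le> (LINT x|lborel. norm (h x)) + (LINT x|lborel. norm (h'' x))"
    using fourier_bound[OF int(1), of t] fourier_bound[OF int(3), of t] by (simp add: algebra_simps)
  then show ?thesis
    by (simp add: field_simps add_pos_nonneg)
qed

text \<open>The test functions that matter are supported in \<open>{-1<..<1}\<close>, the interval on which the Fourier
  transform of the signature is known.\<close>

lemma test_functions_deriv:
  assumes "\<psi> \<in> test_functions {-1<..<1}"
  obtains \<psi>' where "\<psi>' \<in> test_functions {-1<..<1}" "\<And>x. (\<psi> has_vector_derivative \<psi>' x) (at x)"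
proof -
  obtain K where K: "smooth_fun \<psi>" "compact K" "K \<subseteq> {-1<..<1}" "\<And>x. x \<notin> K \<Longrightarrow> \<psi> x = 0"
    using assms by (auto simp: test_functions_def)
  obtain \<psi>' where \<psi>': "smooth_fun \<psi>'" "\<And>x. (\<psi> has_vector_derivative \<psi>' x) (at x)"
    using smooth_fun_deriv[OF K(1)] by blast
  have "\<psi>' x = 0" if "x \<notin> K" for x
  proof -
    have "open (- K)" using K(2) by (simp add: compact_imp_closed open_Compl)
    then have "((\<lambda>_. 0) has_vector_derivative \<psi>' x) (at x)"
      by (rule has_vector_derivative_transform_within_open[OF \<psi>'(2)]) (use that K(4) in auto)
    then show ?thesis
      using vector_derivative_unique_at[OF _ has_vector_derivative_const] by blast
  qed
  then have "\<psi>' \<in> test_functions {-1<..<1}"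
    using \<psi>' K by (auto simp: test_functions_def)
  then show ?thesis using that \<psi>' by blast
qed

lemma test_functions_zero:
  assumes "\<psi> \<in> test_functions {-1<..<1}" "\<bar>x\<bar> \<ge> 1"
  shows "\<psi> x = 0"
  using assms by (auto simp: test_functions_def subset_iff)

lemma integrable_compact_support:
  fixes f :: "real \<Rightarrow> complex"
  assumes "continuous_on UNIV f" "\<And>x. \<bar>x\<bar> \<ge> 1 \<Longrightarrow> f x = 0"
  shows "integrable lborel f"
proof -
  have "set_integrable lborel {-1..1} f"
    by (rule borel_integrable_atLeastAtMost') (use assms continuous_on_subset in blast)
  moreover have "(\<lambda>x. indicator {-1..1} x *\<^sub>R f x) = f"
    using assms(2) by (force simp: fun_eq_iff indicator_def)
  ultimately show ?thesis by (simp add: set_integrable_def)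
qed

lemma test_functions_continuous: "\<psi> \<in> test_functions U \<Longrightarrow> continuous_on A \<psi>"
  by (auto simp: test_functions_def intro: smooth_fun_continuous)

lemma test_functions_integrable:
  "\<psi> \<in> test_functions {-1<..<1} \<Longrightarrow> integrable lborel \<psi>"
  by (intro integrable_compact_support test_functions_continuous test_functions_zero)

lemma test_functions_tendsto:
  assumes "\<psi> \<in> test_functions {-1<..<1}"
  shows "(\<psi> \<longlongrightarrow> 0) at_top" "(\<psi> \<longlongrightarrow> 0) at_bot"
proof -
  have "\<forall>\<^sub>F x in at_top. \<psi> x = 0"
    using eventually_ge_at_top[of "1::real"]
    by (rule eventually_mono) (rule test_functions_zero[OF assms], simp)
  moreover have "\<forall>\<^sub>F x in at_bot. \<psi> x = 0"
    using eventually_le_at_bot[of "-1::real"]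
    by (rule eventually_mono) (rule test_functions_zero[OF assms], simp)
  ultimately show "(\<psi> \<longlongrightarrow> 0) at_top" "(\<psi> \<longlongrightarrow> 0) at_bot"
    by (auto intro: tendsto_eventually)
qed

lemma test_functions_fourier_bound:
  assumes "\<psi> \<in> test_functions {-1<..<1}"
  obtains C where "\<And>t. norm (fourier \<psi> t) \<le> C * inverse (1 + t\<^sup>2)"
proof -
  obtain \<psi>' where 1: "\<psi>' \<in> test_functions {-1<..<1}" "\<And>x. (\<psi> has_vector_derivative \<psi>' x) (at x)"
    using test_functions_deriv[OF assms] by blast
  obtain \<psi>'' where 2: "\<psi>'' \<in> test_functions {-1<..<1}" "\<And>x. (\<psi>' has_vector_derivative \<psi>'' x) (at x)"
    using test_functions_deriv[OF 1(1)] by blast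
  show ?thesis
    by (rule that, rule fourier_decay[OF 1(2) 2(2)])
       (use assms 1 2 in \<open>auto intro: test_functions_tendsto test_functions_integrable test_functions_continuous\<close>)
qed

lemma integrable_bound_inverse_square:
  fixes f :: "real \<Rightarrow> complex"
  assumes "f \<in> borel_measurable borel" "\<And>t. norm (f t) \<le> C * inverse (1 + t\<^sup>2)"
  shows "integrable lborel f"
  by (rule Bochner_Integration.integrable_bound
        [OF integrable_mult_right[OF integrable_inverse_1_plus_square_UNIV, of C]])
     (use assms in \<open>auto intro: order_trans[OF _ abs_ge_self]\<close>)

lemma test_functions_fourier_integrable:
  assumes "\<psi> \<in> test_functions {-1<..<1}"
  shows "integrable lborel (fourier \<psi>)"
proof -
  obtain C where "\<And>t. norm (fourier \<psi> t) \<le> C * inverse (1 + t\<^sup>2)"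
    using test_functions_fourier_bound[OF assms] by blast
  moreover have "fourier \<psi> \<in> borel_measurable borel"
    using borel_measurable_integrable[OF test_functions_integrable[OF assms]]
    by (intro fourier_measurable) simp
  ultimately show ?thesis by (rule integrable_bound_inverse_square[rotated])
qed

text \<open>Derivatives of a test function become powers of the variable after a Fourier transform, and
  they can be moved to a polynomial by partial integration. The two facts together translate
  \<open>\<bar>x\<bar> ^ (d - 1)\<close> in the extremality condition into \<open>d - 1\<close> derivatives of \<open>P_poly\<close>.\<close>

lemma test_functions_higher_deriv:
  assumes "\<psi> \<in> test_functions {-1<..<1}"
  obtains \<theta> where "\<theta> \<in> test_functions {-1<..<1}"
    "\<And>t. fourier \<theta> t = (\<i> * of_real t) ^ n * fourier \<psi> t"
    "\<And>q. (LINT t|lborel. complex_of_real (poly q t) * \<theta> t)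
        = (- 1) ^ n * (LINT t|lborel. complex_of_real (poly ((pderiv ^^ n) q) t) * \<psi> t)"
proof -
  have "\<exists>\<theta>. \<theta> \<in> test_functions {-1<..<1} \<and>
    (\<forall>t. fourier \<theta> t = (\<i> * of_real t) ^ n * fourier \<psi> t) \<and>
    (\<forall>q. (LINT t|lborel. complex_of_real (poly q t) * \<theta> t)
        = (- 1) ^ n * (LINT t|lborel. complex_of_real (poly ((pderiv ^^ n) q) t) * \<psi> t))"
  proof (induction n)
    case 0
    then show ?case using assms by (intro exI[of _ \<psi>]) auto
  next
    case (Suc n)
    then obtain \<theta> where \<theta>: "\<theta> \<in> test_functions {-1<..<1}"
      "\<And>t. fourier \<theta> t = (\<i> * of_real t) ^ n * fourier \<psi> t"
      "\<And>q. (LINT t|lborel. complex_of_real (poly q t) * \<theta> t)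
        = (- 1) ^ n * (LINT t|lborel. complex_of_real (poly ((pderiv ^^ n) q) t) * \<psi> t)" by blast
    obtain \<theta>' where \<theta>': "\<theta>' \<in> test_functions {-1<..<1}" "\<And>x. (\<theta> has_vector_derivative \<theta>' x) (at x)"
      using test_functions_deriv[OF \<theta>(1)] by blast
    have c: "continuous_on UNIV \<theta>" "continuous_on UNIV \<theta>'"
      using test_functions_continuous \<theta> \<theta>' by auto
    have z: "\<theta> x = 0" "\<theta>' x = 0" if "\<bar>x\<bar> \<ge> 1" for x
      using test_functions_zero that \<theta> \<theta>' by auto
    show ?case
    proof (intro exI[of _ \<theta>'] conjI allI)
      show "fourier \<theta>' t = (\<i> * of_real t) ^ Suc n * fourier \<psi> t" for t
        using fourier_deriv[OF \<theta>'(2), of t] c \<theta> test_functions_integrable test_functions_tendsto \<theta>'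
        by simp
      fix q :: "real poly"
      have i: "integrable lborel (\<lambda>t. complex_of_real (poly q t) * \<theta>' t)"
           "integrable lborel (\<lambda>t. complex_of_real (poly (pderiv q) t) * \<theta> t)"
        by (intro integrable_compact_support continuous_intros c; use z in simp)+
      have pd: "((\<lambda>t. complex_of_real (poly q t)) has_vector_derivative complex_of_real (poly (pderiv q) t)) (at t)" for t
        by (intro bounded_linear.has_vector_derivative[OF bounded_linear_of_real])
           (simp flip: has_real_derivative_iff_has_vector_derivative add: poly_DERIV)
      have ev: "\<forall>\<^sub>F x in at_top. complex_of_real (poly q x) * \<theta> x = 0"
        using eventually_ge_at_top[of "1::real"] by (rule eventually_mono) (simp add: z)
      have ev': "\<forall>\<^sub>F x in at_bot. complex_of_real (poly q x) * \<theta> x = 0"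
        using eventually_le_at_bot[of "-1::real"] by (rule eventually_mono) (simp add: z)
      have "(LINT t|lborel. complex_of_real (poly q t) * \<theta>' t + complex_of_real (poly (pderiv q) t) * \<theta> t) = 0"
        by (rule integral_vector_derivative_UNIV[where F = "\<lambda>t. complex_of_real (poly q t) * \<theta> t"])
           (intro has_vector_derivative_mult pd \<theta>' Bochner_Integration.integrable_add i continuous_intros c
             tendsto_eventually ev ev')+
      then have "(LINT t|lborel. complex_of_real (poly q t) * \<theta>' t) = - (LINT t|lborel. complex_of_real (poly (pderiv q) t) * \<theta> t)"
        by (subst (asm) Bochner_Integration.integral_add[OF i]) (simp add: add_eq_0_iff2)
      then show "(LINT t|lborel. complex_of_real (poly q t) * \<theta>' t) =
         (- 1) ^ Suc n * (LINT t|lborel. complex_of_real (poly ((pderiv ^^ Suc n) q) t) * \<psi> t)"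
        by (simp add: \<theta>(3) funpow_swap1)
    qed (rule \<theta>'(1))
  qed
  then show ?thesis using that by blast
qed

text \<open>Expanding the exponential in powers of \<open>z\<close> exhibits the integral as an everywhere convergent
  power series. The lemma serves twice: for \<open>l t = - \<i> t\<close> it extends a Fourier transform, for
  \<open>l w = ln w\<close> it shows that a Mellin transform is entire.\<close>

lemma entire_exp_integral:
  fixes H :: "real \<Rightarrow> complex" and l :: "real \<Rightarrow> complex"
  assumes [measurable]: "H \<in> borel_measurable borel" "l \<in> borel_measurable borel"
    and int: "\<And>r. r \<ge> 0 \<Longrightarrow> integrable lborel (\<lambda>x. exp (r * norm (l x)) * norm (H x))"
  shows "(\<lambda>z. LINT x|lborel. exp (z * l x) * H x) holomorphic_on UNIV"
proof -
  define a where "a n = (LINT x|lborel. l x ^ n / fact n * H x)" for n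
  have s: "(\<lambda>n. a n * z ^ n) sums (LINT x|lborel. exp (z * l x) * H x)" for z
  proof -
    let ?f = "\<lambda>n x. (z * l x) ^ n / fact n * H x"
    have e: "(\<lambda>n. (z * l x) ^ n / fact n) sums exp (z * l x)" for x
      using exp_converges[of "z * l x"] by (simp add: scaleR_conv_of_real field_simps)
    have en: "(\<lambda>n. (norm z * norm (l x)) ^ n / fact n) sums exp (norm z * norm (l x))" for x
      using exp_converges[of "norm z * norm (l x)"] by (simp add: field_simps)
    have fn: "norm (?f n x) = (norm z * norm (l x)) ^ n / fact n * norm (H x)" for n x
      by (simp add: norm_mult norm_divide norm_power)
    have fle: "norm (?f n x) \<le> exp (norm z * norm (l x)) * norm (H x)" for n x
      unfolding fn using en[of x] sum_le_suminf[of "\<lambda>n. (norm z * norm (l x)) ^ n / fact n" "{n}"]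
      by (intro mult_right_mono) (auto simp: sums_iff)
    have i: "integrable lborel (?f n)" for n
      by (rule Bochner_Integration.integrable_bound[OF int[of "norm z"]]) (use fle in auto)
    have nsum: "(\<lambda>n. norm (?f n x)) sums (exp (norm z * norm (l x)) * norm (H x))" for x
      unfolding fn by (intro sums_mult2 en)
    have "summable (\<lambda>n. LINT x|lborel. norm (?f n x))"
    proof (rule bounded_imp_summable)
      fix n
      have "(\<Sum>k\<le>n. LINT x|lborel. norm (?f k x)) = (LINT x|lborel. (\<Sum>k\<le>n. norm (?f k x)))"
        by (subst Bochner_Integration.integral_sum) (use i in auto)
      also have "\<dots> \<le> (LINT x|lborel. exp (norm z * norm (l x)) * norm (H x))"
      proof (intro integral_mono int)
        fix x
        show "(\<Sum>k\<le>n. norm (?f k x)) \<le> exp (norm z * norm (l x)) * norm (H x)"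
          using nsum[of x] sum_le_suminf[of "\<lambda>n. norm (?f n x)" "{..n}"] by (auto simp: sums_iff)
      qed (use i in auto)
      finally show "(\<Sum>k\<le>n. LINT x|lborel. norm (?f k x)) \<le>
          (LINT x|lborel. exp (norm z * norm (l x)) * norm (H x))" .
    qed auto
    then have "(\<lambda>n. integral\<^sup>L lborel (?f n)) sums (LINT x|lborel. (\<Sum>n. ?f n x))"
      using nsum by (intro sums_integral i) (auto simp: sums_iff)
    moreover have "(\<Sum>n. ?f n x) = exp (z * l x) * H x" for x
      using sums_mult2[OF e] by (simp add: sums_iff)
    moreover have "integral\<^sup>L lborel (?f n) = a n * z ^ n" for n
      unfolding a_def by (simp add: power_mult_distrib mult.assoc mult.commute mult.left_commute flip: integral_mult_right_zero)
    ultimately show ?thesis by simp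
  qed
  have "(\<lambda>z. LINT x|lborel. exp (z * l x) * H x) holomorphic_on ball 0 r" for r
    by (rule power_series_holomorphic[of 0 r a]) (use s in simp)
  then have "(\<lambda>z. LINT x|lborel. exp (z * l x) * H x) holomorphic_on (\<Union>r. ball 0 r)"
    by (intro holomorphic_on_UN_open) auto
  moreover have "x \<in> (\<Union>r. ball (0::complex) r)" for x
    by (rule UN_I[of "norm x + 1"]) auto
  then have "(\<Union>r. ball (0::complex) r) = UNIV" by blast
  ultimately show ?thesis by simp
qed


section \<open>Polynomials times the Gaussian\<close>

definition gaussian_poly :: "real poly \<Rightarrow> real \<Rightarrow> real" where
  "gaussian_poly q t = poly q t * std_normal_density t"

lemma gaussian_poly_deriv:
  "(gaussian_poly q has_real_derivative gaussian_poly (pderiv q - [:0, 1:] * q) t) (at t)"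
proof -
  have "((\<lambda>t. poly q t * ((1 / sqrt (2 * pi)) * exp (- t\<^sup>2 / 2))) has_real_derivative
      gaussian_poly (pderiv q - [:0, 1:] * q) t) (at t)"
    unfolding gaussian_poly_def std_normal_density_def
    by (rule derivative_eq_intros poly_DERIV refl | simp)+ (simp add: algebra_simps diff_divide_distrib)
  then show ?thesis unfolding gaussian_poly_def std_normal_density_def .
qed

lemma gaussian_poly_continuous: "continuous_on A (gaussian_poly q)"
  by (rule DERIV_continuous_on) (rule has_field_derivative_at_within, rule gaussian_poly_deriv)

lemma gaussian_poly_measurable [measurable]: "gaussian_poly q \<in> borel_measurable borel"
  by (rule borel_measurable_continuous_onI) (rule gaussian_poly_continuous)

lemma gaussian_poly_bound: "\<exists>K\<ge>0. \<forall>t. \<bar>t\<bar> ^ L * \<bar>gaussian_poly q t\<bar> \<le> K"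
proof -
  have mono: "\<bar>t\<bar> ^ k * std_normal_density t \<le> 1 + 2 ^ k * fact k" for k and t :: real
  proof -
    have e: "(t\<^sup>2 / 2) ^ k \<le> fact k * exp (t\<^sup>2 / 2)"
    proof -
      have s: "(\<lambda>n. (t\<^sup>2 / 2) ^ n / fact n) sums exp (t\<^sup>2 / 2)"
        using exp_converges[of "t\<^sup>2 / 2"] by (simp add: field_simps)
      have "(t\<^sup>2 / 2) ^ k / fact k \<le> exp (t\<^sup>2 / 2)"
        using sum_le_suminf[of "\<lambda>n. (t\<^sup>2 / 2) ^ n / fact n" "{k}"] s by (auto simp: sums_iff)
      then show ?thesis by (simp add: field_simps)
    qed
    have "\<bar>t\<bar> ^ k \<le> 1 + \<bar>t\<bar> ^ (2 * k)"
    proof (cases "\<bar>t\<bar> \<le> 1")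
      case True
      then show ?thesis using power_le_one[of "\<bar>t\<bar>" k] by (simp add: add_increasing2)
    next
      case False
      then have "\<bar>t\<bar> ^ k \<le> \<bar>t\<bar> ^ (2 * k)" by (intro power_increasing) auto
      then show ?thesis by linarith
    qed
    also have "\<bar>t\<bar> ^ (2 * k) = 2 ^ k * (t\<^sup>2 / 2) ^ k"
      by (simp add: power_mult power_divide)
    also have "1 + \<dots> \<le> exp (t\<^sup>2 / 2) + 2 ^ k * (fact k * exp (t\<^sup>2 / 2))"
      by (intro add_mono mult_left_mono e) auto
    finally have "\<bar>t\<bar> ^ k \<le> (1 + 2 ^ k * fact k) * exp (t\<^sup>2 / 2)" by (simp add: algebra_simps)
    then have "\<bar>t\<bar> ^ k * exp (- (t\<^sup>2 / 2)) \<le> 1 + 2 ^ k * fact k"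
      by (simp add: exp_minus field_simps)
    moreover have "std_normal_density t \<le> exp (- (t\<^sup>2 / 2))"
    proof -
      have "1 / sqrt (2 * pi) \<le> 1" using pi_ge_two by simp
      then have "1 / sqrt (2 * pi) * exp (- t\<^sup>2 / 2) \<le> 1 * exp (- t\<^sup>2 / 2)"
        by (rule mult_right_mono) simp
      then show ?thesis
        unfolding std_normal_density_def by simp
    qed
    ultimately show ?thesis
      by (meson mult_left_mono order_trans zero_le_power abs_ge_zero)
  qed
  show ?thesis
  proof (intro exI[of _ "\<Sum>i\<le>degree q. \<bar>coeff q i\<bar> * (1 + 2 ^ (i + L) * fact (i + L))"] conjI allI)
    fix t
    have "\<bar>gaussian_poly q t\<bar> \<le> (\<Sum>i\<le>degree q. \<bar>coeff q i\<bar> * \<bar>t\<bar> ^ i) * std_normal_density t"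
      unfolding gaussian_poly_def abs_mult poly_altdef
      by (rule mult_mono) (auto intro!: order_trans[OF sum_abs] sum_nonneg simp: abs_mult power_abs)
    then have "\<bar>t\<bar> ^ L * \<bar>gaussian_poly q t\<bar> \<le> \<bar>t\<bar> ^ L * ((\<Sum>i\<le>degree q. \<bar>coeff q i\<bar> * \<bar>t\<bar> ^ i) * std_normal_density t)"
      by (rule mult_left_mono) simp
    also have "\<dots> = (\<Sum>i\<le>degree q. \<bar>coeff q i\<bar> * (\<bar>t\<bar> ^ (i + L) * std_normal_density t))"
      by (simp add: sum_distrib_left sum_distrib_right power_add mult_ac)
    also have "\<dots> \<le> (\<Sum>i\<le>degree q. \<bar>coeff q i\<bar> * (1 + 2 ^ (i + L) * fact (i + L)))"
      by (intro sum_mono mult_left_mono mono) auto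
    finally show "\<bar>t\<bar> ^ L * \<bar>gaussian_poly q t\<bar> \<le> (\<Sum>i\<le>degree q. \<bar>coeff q i\<bar> * (1 + 2 ^ (i + L) * fact (i + L)))" .
  qed (auto intro!: sum_nonneg)
qed

lemma gaussian_poly_bound_inverse_square:
  "\<exists>K. \<forall>t. \<bar>gaussian_poly q t\<bar> \<le> K * inverse (1 + t\<^sup>2)"
proof -
  obtain K0 where K0: "\<bar>t\<bar> ^ 0 * \<bar>gaussian_poly q t\<bar> \<le> K0" for t using gaussian_poly_bound by blast
  obtain K2 where K2: "\<bar>t\<bar> ^ 2 * \<bar>gaussian_poly q t\<bar> \<le> K2" for t using gaussian_poly_bound by blast
  have "\<bar>gaussian_poly q t\<bar> * (1 + t\<^sup>2) \<le> K0 + K2" for t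
    using K0[of t] K2[of t] by (simp add: algebra_simps)
  then show ?thesis
    by (intro exI[of _ "K0 + K2"]) (simp add: field_simps add_pos_nonneg)
qed

lemma tendsto_bound_inverse_square:
  fixes f :: "real \<Rightarrow> complex"
  assumes "\<And>t. norm (f t) \<le> K * inverse (1 + t\<^sup>2)"
  shows "(f \<longlongrightarrow> 0) at_top" "(f \<longlongrightarrow> 0) at_bot"
proof -
  have "((\<lambda>t::real. K * inverse (1 + t\<^sup>2)) \<longlongrightarrow> 0) at_top"
    by real_asymp
  then show "(f \<longlongrightarrow> 0) at_top"
    by (rule Lim_null_comparison[rotated]) (use assms in auto)
  have "((\<lambda>t::real. K * inverse (1 + t\<^sup>2)) \<longlongrightarrow> 0) at_bot"
    by real_asymp
  then show "(f \<longlongrightarrow> 0) at_bot"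
    by (rule Lim_null_comparison[rotated]) (use assms in auto)
qed

lemma gaussian_poly_has_vector_derivative:
  "((\<lambda>t. complex_of_real (gaussian_poly q t)) has_vector_derivative
     complex_of_real (gaussian_poly (pderiv q - [:0, 1:] * q) t)) (at t)"
  by (intro bounded_linear.has_vector_derivative[OF bounded_linear_of_real])
     (simp flip: has_real_derivative_iff_has_vector_derivative add: gaussian_poly_deriv del: mult_pCons_left)

lemma gaussian_poly_integrable: "integrable lborel (\<lambda>t. complex_of_real (gaussian_poly q t))"
proof -
  obtain K where "\<And>t. \<bar>gaussian_poly q t\<bar> \<le> K * inverse (1 + t\<^sup>2)"
    using gaussian_poly_bound_inverse_square by blast
  then show ?thesis by (intro integrable_bound_inverse_square[where C = K]) auto
qed

lemma gaussian_poly_tendsto: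
  "((\<lambda>t. complex_of_real (gaussian_poly q t)) \<longlongrightarrow> 0) at_top"
  "((\<lambda>t. complex_of_real (gaussian_poly q t)) \<longlongrightarrow> 0) at_bot"
proof -
  obtain K where "\<And>t. \<bar>gaussian_poly q t\<bar> \<le> K * inverse (1 + t\<^sup>2)"
    using gaussian_poly_bound_inverse_square by blast
  then have K: "norm (complex_of_real (gaussian_poly q t)) \<le> K * inverse (1 + t\<^sup>2)" for t by simp
  show "((\<lambda>t. complex_of_real (gaussian_poly q t)) \<longlongrightarrow> 0) at_top"
    "((\<lambda>t. complex_of_real (gaussian_poly q t)) \<longlongrightarrow> 0) at_bot"
    using tendsto_bound_inverse_square[OF K] by auto
qed

lemma gaussian_poly_fourier_deriv:
  "fourier (\<lambda>t. complex_of_real (gaussian_poly (pderiv q - [:0, 1:] * q) t)) x =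
     \<i> * of_real x * fourier (\<lambda>t. complex_of_real (gaussian_poly q t)) x"
  by (rule fourier_deriv)
     (intro gaussian_poly_has_vector_derivative gaussian_poly_integrable gaussian_poly_tendsto
       continuous_intros gaussian_poly_continuous)+

lemma gaussian_poly_fourier_decay:
  "\<exists>C. \<forall>x. norm (fourier (\<lambda>t. complex_of_real (gaussian_poly q t)) x) \<le> C * inverse (1 + x\<^sup>2)"
  by (rule exI, rule allI, rule fourier_decay)
     (rule gaussian_poly_has_vector_derivative gaussian_poly_integrable gaussian_poly_tendsto
       continuous_intros gaussian_poly_continuous)+

lemma fourier_gaussian_0:
  "fourier (\<lambda>t. complex_of_real (gaussian_poly 1 t)) x = exp (- (of_real x)\<^sup>2 / 2)"
proof -
  have "fourier (\<lambda>t. complex_of_real (gaussian_poly 1 t)) x = char std_normal_distribution (- x)"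
    unfolding fourier_def char_def
    by (subst integral_density) (auto simp: normal_density_nonneg gaussian_poly_def scaleR_conv_of_real mult_ac)
  then show ?thesis by (simp add: char_std_normal_distribution flip: exp_of_real)
qed

text \<open>The two functions \<open>t\<close> and \<open>t\<^sup>2\<close> times the Gaussian have, up to a constant and a rescaling, the theta
  kernels of the two parities as Fourier transforms.\<close>

lemma fourier_gaussian_1:
  "fourier (\<lambda>t. complex_of_real (gaussian_poly [:0, 1:] t)) x =
     - \<i> * of_real x * exp (- (of_real x)\<^sup>2 / 2)"
proof -
  have "fourier (\<lambda>t. complex_of_real (gaussian_poly (- [:0, 1:]) t)) x =
      - fourier (\<lambda>t. complex_of_real (gaussian_poly [:0, 1:] t)) x"
    unfolding fourier_def gaussian_poly_def by (simp flip: integral_minus)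
  then show ?thesis
    using gaussian_poly_fourier_deriv[of 1 x] fourier_gaussian_0[of x]
    by (simp add: pderiv_1 neg_eq_iff_add_eq_0 eq_neg_iff_add_eq_0 add.commute)
qed

lemma fourier_gaussian_2:
  "fourier (\<lambda>t. complex_of_real (gaussian_poly [:0, 0, 1:] t)) x =
     (1 - (of_real x)\<^sup>2) * exp (- (of_real x)\<^sup>2 / 2)"
proof -
  let ?F = "\<lambda>q. fourier (\<lambda>t. complex_of_real (gaussian_poly q t)) x"
  have "(\<lambda>t. complex_of_real (gaussian_poly [:0, 0, 1:] t)) =
      (\<lambda>t. complex_of_real (gaussian_poly 1 t) -
        complex_of_real (gaussian_poly (pderiv [:0, 1:] - [:0, 1:] * [:0, 1:]) t))"
    by (auto simp: gaussian_poly_def algebra_simps pderiv_pCons)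
  then have "?F [:0, 0, 1:] = ?F 1 - ?F (pderiv [:0, 1:] - [:0, 1:] * [:0, 1:])"
    using fourier_diff[OF gaussian_poly_integrable gaussian_poly_integrable] by metis
  also have "\<dots> = (1 - (of_real x)\<^sup>2) * exp (- (of_real x)\<^sup>2 / 2)"
    unfolding gaussian_poly_fourier_deriv fourier_gaussian_0 fourier_gaussian_1
    by (simp add: algebra_simps power2_eq_square)
  finally show ?thesis .
qed

lemma fourier_scale:
  assumes "u > 0"
  shows "fourier (\<lambda>t. f (t / u) / of_real u) x = fourier f (u * x)"
proof -
  have "fourier (\<lambda>t. f (t / u) / of_real u) x =
     \<bar>u\<bar> *\<^sub>R (LINT t|lborel. f ((0 + u * t) / u) / of_real u * exp (- \<i> * of_real x * of_real (0 + u * t)))"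
    unfolding fourier_def by (rule lborel_integral_real_affine) (use assms in auto)
  also have "\<dots> = (LINT t|lborel. of_real u * (f ((0 + u * t) / u) / of_real u * exp (- \<i> * of_real x * of_real (0 + u * t))))"
    using assms by (simp add: scaleR_conv_of_real)
  also have "\<dots> = fourier f (u * x)"
    unfolding fourier_def using assms
    by (intro Bochner_Integration.integral_cong) (auto simp: mult_ac)
  finally show ?thesis .
qed

text \<open>Rapid decay turns the region \<open>\<bar>t\<bar> \<ge> 1/2\<close> into an arbitrarily high power of the scale.\<close>

lemma gaussian_poly_tail:
  "\<exists>K\<ge>0. \<forall>u t. 0 < u \<longrightarrow> u \<le> 2 \<longrightarrow> 1/2 \<le> \<bar>t\<bar> \<longrightarrow>
     \<bar>gaussian_poly q (t / u)\<bar> \<le> K * u ^ M * inverse (1 + t\<^sup>2) ^ R"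
proof -
  obtain K where K: "K \<ge> 0" "\<And>t. \<bar>t\<bar> ^ (M + 2 * R) * \<bar>gaussian_poly q t\<bar> \<le> K"
    using gaussian_poly_bound by blast
  have "\<bar>gaussian_poly q (t / u)\<bar> \<le> (K * 2 ^ M * 20 ^ R) * u ^ M * inverse (1 + t\<^sup>2) ^ R"
    if u: "0 < u" "u \<le> 2" and t: "1/2 \<le> \<bar>t\<bar>" for u t :: real
  proof -
    have t0: "t \<noteq> 0" using t by auto
    have 1: "(u / \<bar>t\<bar>) ^ M \<le> (2 * u) ^ M"
    proof (rule power_mono)
      have "u * 1 \<le> u * (2 * \<bar>t\<bar>)" using t u by (intro mult_left_mono) auto
      then show "u / \<bar>t\<bar> \<le> 2 * u" using t0 by (simp add: field_simps)
    qed (use u in auto)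
    have 2: "((u / \<bar>t\<bar>)\<^sup>2) ^ R \<le> (20 * inverse (1 + t\<^sup>2)) ^ R"
    proof (rule power_mono)
      have t2: "t\<^sup>2 \<ge> 1/4" using power_mono[of "1/2" "\<bar>t\<bar>" 2] t by (simp add: power2_eq_square)
      have u2: "u\<^sup>2 \<le> 4" using power_mono[of u 2 2] u by simp
      have "u\<^sup>2 * (1 + t\<^sup>2) \<le> 4 * (5 * t\<^sup>2)" using t2 by (intro mult_mono u2) auto
      then have "u\<^sup>2 / t\<^sup>2 \<le> 20 / (1 + t\<^sup>2)"
        using t0 by (simp add: divide_simps add_pos_nonneg mult_ac)
      then show "(u / \<bar>t\<bar>)\<^sup>2 \<le> 20 * inverse (1 + t\<^sup>2)"
        by (simp add: power_divide flip: divide_inverse)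
    qed auto
    have "\<bar>t / u\<bar> ^ (M + 2 * R) * \<bar>gaussian_poly q (t / u)\<bar> \<le> K" by (rule K)
    then have "\<bar>gaussian_poly q (t / u)\<bar> \<le> K * (u / \<bar>t\<bar>) ^ (M + 2 * R)"
      using u t0 by (simp add: field_simps)
    also have "\<dots> = K * ((u / \<bar>t\<bar>) ^ M * ((u / \<bar>t\<bar>)\<^sup>2) ^ R)"
      by (simp add: power_add power_mult)
    also have "\<dots> \<le> K * ((2 * u) ^ M * (20 * inverse (1 + t\<^sup>2)) ^ R)"
      using u by (intro mult_left_mono mult_mono 1 2 K) auto
    finally show ?thesis by (simp add: power_mult_distrib mult_ac)
  qed
  then show ?thesis using K(1) by (intro exI[of _ "K * 2 ^ M * 20 ^ R"]) auto
qed

lemma test_functions_bounded: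
  assumes "\<psi> \<in> test_functions {-1<..<1}"
  obtains B where "B \<ge> 0" "\<And>x. norm (\<psi> x) \<le> B"
proof -
  have "compact (\<psi> ` {-1..1})"
    by (intro compact_continuous_image test_functions_continuous[OF assms]) auto
  then obtain B where B: "\<And>x. x \<in> {-1..1} \<Longrightarrow> norm (\<psi> x) \<le> B"
    by (meson bounded_iff compact_imp_bounded imageI)
  then have "B \<ge> 0" using norm_ge_zero[of "\<psi> 0"] order_trans by (metis atLeastAtMost_iff zero_le_one neg_le_0_iff_le)
  moreover have "norm (\<psi> x) \<le> B" for x
    using B[of x] test_functions_zero[OF assms, of x] \<open>B \<ge> 0\<close> by (cases "x \<in> {-1..1}") auto
  ultimately show ?thesis using that by blast
qed

lemma deriv_zero_near_origin:
  fixes \<psi> :: "real \<Rightarrow> complex"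
  assumes "\<And>x. (\<psi> has_vector_derivative \<psi>' x) (at x)" "\<And>x. \<bar>x\<bar> < 1/2 \<Longrightarrow> \<psi> x = c" "\<bar>x\<bar> < 1/2"
  shows "\<psi>' x = 0"
proof -
  have "((\<lambda>_. c) has_vector_derivative \<psi>' x) (at x)"
    by (rule has_vector_derivative_transform_within_open[OF assms(1) open_greaterThanLessThan[of "-1/2" "1/2"]])
       (use assms(2, 3) in \<open>auto simp: abs_less_iff\<close>)
  then show ?thesis
    using vector_derivative_unique_at[OF _ has_vector_derivative_const] by blast
qed

lemma poly_bound_inverse_square:
  "\<exists>C\<ge>0. \<exists>R. \<forall>t. \<bar>poly (P :: real poly) t\<bar> * inverse (1 + t\<^sup>2) ^ R \<le> C"
proof (intro exI[of _ "\<Sum>i\<le>degree P. \<bar>coeff P i\<bar>"] conjI exI[of _ "degree P"] allI)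
  fix t :: real
  have p: "1 + t\<^sup>2 > 0" by (simp add: add_pos_nonneg)
  have "\<bar>t\<bar> ^ i \<le> (1 + t\<^sup>2) ^ degree P" if "i \<le> degree P" for i
  proof -
    have "\<bar>t\<bar> \<le> 1 + t\<^sup>2" using zero_le_power2[of "\<bar>t\<bar> - 1"] zero_le_power2[of t]
      by (simp add: power2_eq_square algebra_simps)
    then have "\<bar>t\<bar> ^ i \<le> (1 + t\<^sup>2) ^ i" by (rule power_mono) auto
    also have "\<dots> \<le> (1 + t\<^sup>2) ^ degree P" using that by (intro power_increasing) auto
    finally show ?thesis .
  qed
  then have "\<bar>poly P t\<bar> \<le> (\<Sum>i\<le>degree P. \<bar>coeff P i\<bar> * (1 + t\<^sup>2) ^ degree P)"
    unfolding poly_altdef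
    by (intro order_trans[OF sum_abs] sum_mono) (auto simp: abs_mult power_abs intro!: mult_left_mono)
  then show "\<bar>poly P t\<bar> * inverse (1 + t\<^sup>2) ^ degree P \<le> (\<Sum>i\<le>degree P. \<bar>coeff P i\<bar>)"
    using p by (simp add: field_simps flip: sum_distrib_right)
qed (auto intro!: sum_nonneg)


section \<open>Testing the signature against concentrated Gaussians\<close>

lemma integral_norm_bound_inverse_square:
  fixes f :: "real \<Rightarrow> complex"
  assumes "f \<in> borel_measurable borel" "\<And>t. norm (f t) \<le> C * inverse (1 + t\<^sup>2)"
  shows "(LINT t|lborel. norm (f t)) \<le> C * pi"
proof -
  have "(LINT t|lborel. norm (f t)) \<le> (LINT t|lborel. C * inverse (1 + (t::real)\<^sup>2))"
    by (intro integral_mono integrable_norm integrable_bound_inverse_square[OF assms]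
          integrable_mult_right integrable_inverse_1_plus_square_UNIV assms(2))
  then show ?thesis by (simp only: integral_mult_right_zero integral_inverse_1_plus_square_UNIV)
qed

lemma integrable_sign_mult:
  fixes \<sigma> :: "real \<Rightarrow> real"
  assumes [measurable]: "\<sigma> \<in> borel_measurable borel" and \<sigma>: "\<And>x. \<bar>\<sigma> x\<bar> \<le> 1"
    and "f \<in> borel_measurable borel" "\<And>t. norm (f t) \<le> C * inverse (1 + t\<^sup>2)"
  shows "integrable lborel (\<lambda>x. complex_of_real (\<sigma> x) * f x)"
    and "norm (LINT x|lborel. complex_of_real (\<sigma> x) * f x) \<le> C * pi"
proof -
  note [measurable] = assms(3)
  have le: "norm (complex_of_real (\<sigma> x) * f x) \<le> C * inverse (1 + x\<^sup>2)" for x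
    using \<sigma>[of x] assms(4)[of x] mult_left_le_one_le[of "norm (f x)" "\<bar>\<sigma> x\<bar>"]
    by (simp add: norm_mult)
  show "integrable lborel (\<lambda>x. complex_of_real (\<sigma> x) * f x)"
    by (rule integrable_bound_inverse_square[OF _ le]) measurable
  have "norm (LINT x|lborel. complex_of_real (\<sigma> x) * f x) \<le> (LINT x|lborel. norm (complex_of_real (\<sigma> x) * f x))"
    by (rule integral_norm_bound)
  also have "\<dots> \<le> C * pi"
    by (rule integral_norm_bound_inverse_square[OF _ le]) measurable
  finally show "norm (LINT x|lborel. complex_of_real (\<sigma> x) * f x) \<le> C * pi" .
qed

text \<open>A Gaussian of width \<open>u\<close> is smaller than any power of \<open>u\<close> away from the origin, together with its
  first two derivatives. Cutting it off near the origin leaves a tail \<open>h\<close> that inherits these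
  bounds, and by \<open>fourier_decay\<close> so does the Fourier transform of \<open>h\<close>.\<close>

lemma gaussian_tail_cutoff:
  fixes \<kappa> :: "real \<Rightarrow> real" and q :: "real poly"
  assumes \<kappa>: "(\<lambda>x. complex_of_real (\<kappa> x)) \<in> test_functions {-1<..<1}"
    "\<And>x. \<bar>x\<bar> \<le> 1/2 \<Longrightarrow> \<kappa> x = 1"
  defines "h \<equiv> \<lambda>u t. (1 - complex_of_real (\<kappa> t)) * (complex_of_real (gaussian_poly q (t / u)) / of_real u)"
  shows "\<exists>K\<ge>0. \<forall>u t. 0 < u \<longrightarrow> u \<le> 2 \<longrightarrow>
    norm (h u t) \<le> K * u ^ M * inverse (1 + t\<^sup>2) ^ R \<and>
    norm (fourier (h u) t) \<le> K * u ^ M * inverse (1 + t\<^sup>2)"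
proof -
  let ?D = "\<lambda>q. pderiv q - [:0, 1:] * q"
  let ?k = "\<lambda>x. complex_of_real (\<kappa> x)"
  obtain \<kappa>1 where \<kappa>1: "\<kappa>1 \<in> test_functions {-1<..<1}" "\<And>x. (?k has_vector_derivative \<kappa>1 x) (at x)"
    using test_functions_deriv[OF \<kappa>(1)] by blast
  obtain \<kappa>2 where \<kappa>2: "\<kappa>2 \<in> test_functions {-1<..<1}" "\<And>x. (\<kappa>1 has_vector_derivative \<kappa>2 x) (at x)"
    using test_functions_deriv[OF \<kappa>1(1)] by blast
  have z1: "\<kappa>1 x = 0" if "\<bar>x\<bar> < 1/2" for x
    by (rule deriv_zero_near_origin[OF \<kappa>1(2), where c = 1]) (use that \<kappa>(2) in auto)
  have z2: "\<kappa>2 x = 0" if "\<bar>x\<bar> < 1/2" for x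
    by (rule deriv_zero_near_origin[OF \<kappa>2(2), where c = 0]) (use that z1 in auto)
  obtain B0 where B0: "B0 \<ge> 0" "\<And>x. norm (?k x) \<le> B0" using test_functions_bounded[OF \<kappa>(1)] by blast
  obtain B1 where B1: "B1 \<ge> 0" "\<And>x. norm (\<kappa>1 x) \<le> B1" using test_functions_bounded[OF \<kappa>1(1)] by blast
  obtain B2 where B2: "B2 \<ge> 0" "\<And>x. norm (\<kappa>2 x) \<le> B2" using test_functions_bounded[OF \<kappa>2(1)] by blast
  define B where "B = 1 + B0 + 2 * B1 + B2"
  have B: "norm (1 - ?k x) \<le> B" "norm (\<kappa>1 x) \<le> B" "norm (\<kappa>2 x) \<le> B" "norm (2 * \<kappa>1 x) \<le> B" "B \<ge> 0" for x
    using B0(1) B0(2)[of x] B1(1) B1(2)[of x] B2(1) B2(2)[of x] norm_triangle_ineq4[of 1 "?k x"]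
    by (simp_all add: B_def norm_mult)
  define g where "g q j u t = complex_of_real (gaussian_poly q (t / u)) / of_real u ^ Suc j" for q j u t
  have g_der: "(g q j u has_vector_derivative g (?D q) (Suc j) u t) (at t)" if "u > 0" for q j u t
  proof -
    have "((\<lambda>t. t / u) has_vector_derivative (1 / u)) (at t)"
      using that by (auto intro!: derivative_eq_intros simp flip: has_real_derivative_iff_has_vector_derivative)
    from vector_diff_chain_at[OF this gaussian_poly_has_vector_derivative[of q]]
    have "((\<lambda>t. complex_of_real (gaussian_poly q (t / u))) has_vector_derivative
       (1 / u) *\<^sub>R complex_of_real (gaussian_poly (?D q) (t / u))) (at t)"
      by (simp add: o_def del: mult_pCons_left)
    from has_vector_derivative_divide[OF this, of "of_real u ^ Suc j"]
    show ?thesis unfolding g_def by (simp add: scaleR_conv_of_real mult_ac del: mult_pCons_left)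
  qed
  have g_cont: "continuous_on A (g q j u)" if "u > 0" for q j u A
    using g_der[OF that] by (meson has_vector_derivative_continuous continuous_at_imp_continuous_on)
  have "\<exists>K\<ge>0. \<forall>u t. 0 < u \<longrightarrow> u \<le> 2 \<longrightarrow> 1/2 \<le> \<bar>t\<bar> \<longrightarrow>
      norm (g q j u t) \<le> K * u ^ M * inverse (1 + t\<^sup>2) ^ Suc R" if "j \<le> 2" for q j
  proof -
    obtain K where K: "K \<ge> 0" "\<And>u t. 0 < u \<Longrightarrow> u \<le> 2 \<Longrightarrow> 1/2 \<le> \<bar>t\<bar> \<Longrightarrow>
       \<bar>gaussian_poly q (t / u)\<bar> \<le> K * u ^ (M + Suc j) * inverse (1 + t\<^sup>2) ^ Suc R"
      using gaussian_poly_tail[of q "M + Suc j" "Suc R"] by blast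
    have "norm (g q j u t) \<le> K * u ^ M * inverse (1 + t\<^sup>2) ^ Suc R"
      if u: "0 < u" "u \<le> 2" "1/2 \<le> \<bar>t\<bar>" for u t
    proof -
      have "norm (g q j u t) = \<bar>gaussian_poly q (t / u)\<bar> / u ^ Suc j"
        using u by (simp add: g_def norm_divide norm_mult norm_power)
      also have "\<dots> \<le> (K * u ^ (M + Suc j) * inverse (1 + t\<^sup>2) ^ Suc R) / u ^ Suc j"
        using u by (intro divide_right_mono K) auto
      also have "\<dots> = K * u ^ M * inverse (1 + t\<^sup>2) ^ Suc R"
        using u by (simp add: power_add)
      finally show ?thesis .
    qed
    then show ?thesis using K(1) by blast
  qed
  note g_bound = this
  obtain K0 where K0: "K0 \<ge> 0" "\<And>u t. 0 < u \<Longrightarrow> u \<le> 2 \<Longrightarrow> 1/2 \<le> \<bar>t\<bar> \<Longrightarrow>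
      norm (g q 0 u t) \<le> K0 * u ^ M * inverse (1 + t\<^sup>2) ^ Suc R"
    using g_bound[of 0 q] by auto
  obtain K1 where K1: "K1 \<ge> 0" "\<And>u t. 0 < u \<Longrightarrow> u \<le> 2 \<Longrightarrow> 1/2 \<le> \<bar>t\<bar> \<Longrightarrow>
      norm (g (?D q) 1 u t) \<le> K1 * u ^ M * inverse (1 + t\<^sup>2) ^ Suc R"
    using g_bound[of 1 "?D q"] by auto
  obtain K2 where K2: "K2 \<ge> 0" "\<And>u t. 0 < u \<Longrightarrow> u \<le> 2 \<Longrightarrow> 1/2 \<le> \<bar>t\<bar> \<Longrightarrow>
      norm (g (?D (?D q)) 2 u t) \<le> K2 * u ^ M * inverse (1 + t\<^sup>2) ^ Suc R"
    using g_bound[of 2 "?D (?D q)"] by auto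
  define h1 where "h1 u t = (1 - ?k t) * g (?D q) 1 u t + (- \<kappa>1 t) * g q 0 u t" for u t
  define h2 where "h2 u t = (1 - ?k t) * g (?D (?D q)) 2 u t + (- (2 * \<kappa>1 t)) * g (?D q) 1 u t + (- \<kappa>2 t) * g q 0 u t" for u t
  have h: "h u t = (1 - ?k t) * g q 0 u t" for u t by (simp add: h_def g_def)
  have k: "((\<lambda>t. 1 - ?k t) has_vector_derivative - \<kappa>1 t) (at t)" for t
    using has_vector_derivative_diff[OF has_vector_derivative_const \<kappa>1(2)] by simp
  define C where "C = B * (K0 + K1 + K2)"
  have C: "C \<ge> 0" using B K0 K1 K2 by (simp add: C_def)
  have bounds: "norm (h u t) \<le> C * u ^ M * inverse (1 + t\<^sup>2) ^ Suc R"
      "norm (h1 u t) \<le> C * u ^ M * inverse (1 + t\<^sup>2) ^ Suc R"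
      "norm (h2 u t) \<le> C * u ^ M * inverse (1 + t\<^sup>2) ^ Suc R" if u: "0 < u" "u \<le> 2" for u t
  proof -
    let ?E = "u ^ M * inverse (1 + t\<^sup>2) ^ Suc R"
    have E: "?E \<ge> 0" using u by simp
    have "norm (h u t) \<le> C * ?E \<and> norm (h1 u t) \<le> C * ?E \<and> norm (h2 u t) \<le> C * ?E"
    proof (cases "\<bar>t\<bar> < 1/2")
      case True
      then show ?thesis using z1[of t] z2[of t] \<kappa>(2)[of t] C E by (simp add: h h1_def h2_def)
    next
      case False
      then have G: "norm (g q 0 u t) \<le> K0 * ?E" "norm (g (?D q) 1 u t) \<le> K1 * ?E"
          "norm (g (?D (?D q)) 2 u t) \<le> K2 * ?E"
        using K0(2)[of u t] K1(2)[of u t] K2(2)[of u t] u by (simp_all add: mult_ac)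
      have P: "norm (a * b) \<le> B * (L * ?E)" if "norm a \<le> B" "norm b \<le> L * ?E" for a b :: complex and L
        unfolding norm_mult using that B(5) by (intro mult_mono) auto
      have "norm (h u t) \<le> B * (K0 * ?E)" unfolding h by (intro P B G)
      moreover have "norm (h1 u t) \<le> B * (K1 * ?E) + B * (K0 * ?E)"
        unfolding h1_def by (intro norm_triangle_mono P G) (use B in auto)
      moreover have "norm (h2 u t) \<le> B * (K2 * ?E) + B * (K1 * ?E) + B * (K0 * ?E)"
        unfolding h2_def by (intro norm_triangle_mono P G) (use B in auto)
      moreover have "C * ?E = B * (K2 * ?E) + B * (K1 * ?E) + B * (K0 * ?E)"
        by (simp add: C_def algebra_simps)
      moreover have "0 \<le> B * (K0 * ?E)" "0 \<le> B * (K1 * ?E)" "0 \<le> B * (K2 * ?E)"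
        using B K0 K1 K2 E by (meson mult_nonneg_nonneg)+
      ultimately show ?thesis by linarith
    qed
    then show "norm (h u t) \<le> C * u ^ M * inverse (1 + t\<^sup>2) ^ Suc R"
      "norm (h1 u t) \<le> C * u ^ M * inverse (1 + t\<^sup>2) ^ Suc R"
      "norm (h2 u t) \<le> C * u ^ M * inverse (1 + t\<^sup>2) ^ Suc R" by (simp_all add: mult_ac)
  qed
  have i1: "inverse (1 + t\<^sup>2) \<le> 1" "inverse (1 + t\<^sup>2) \<ge> 0" for t :: real
    by (auto intro!: le_imp_inverse_le[of 1, simplified])
  have weaken: "C * u ^ M * inverse (1 + t\<^sup>2) ^ Suc R \<le> C * u ^ M * inverse (1 + t\<^sup>2)"
      "C * u ^ M * inverse (1 + t\<^sup>2) ^ Suc R \<le> C * u ^ M * inverse (1 + t\<^sup>2) ^ R" if "0 < u" for u t :: real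
    using power_decreasing[of 1 "Suc R" "inverse (1 + t\<^sup>2)"] power_decreasing[of R "Suc R" "inverse (1 + t\<^sup>2)"] i1[of t] that C
    by (auto intro!: mult_left_mono)
  have four: "norm (fourier (h u) x) \<le> C * (2 * pi + 1) * u ^ M * inverse (1 + x\<^sup>2)" if u: "0 < u" "u \<le> 2" for u x
  proof -
    have b: "norm (h u t) \<le> C * u ^ M * inverse (1 + t\<^sup>2)"
        "norm (h1 u t) \<le> C * u ^ M * inverse (1 + t\<^sup>2)"
        "norm (h2 u t) \<le> C * u ^ M * inverse (1 + t\<^sup>2)" for t
      using bounds[OF u, of t] weaken[OF u(1), of t] by linarith+
    have d: "(h u has_vector_derivative h1 u t) (at t)" for t
    proof -
      have "h u = (\<lambda>t. (1 - ?k t) * g q 0 u t)" by (simp add: h fun_eq_iff)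
      then show ?thesis
        using has_vector_derivative_mult[OF k g_der[OF u(1), of q 0], of t]
        by (simp add: h1_def del: mult_pCons_left)
    qed
    have d1: "(h1 u has_vector_derivative h2 u t) (at t)" for t
    proof -
      have nk: "((\<lambda>t. - \<kappa>1 t) has_vector_derivative - \<kappa>2 t) (at t)"
        using has_vector_derivative_minus[OF \<kappa>2(2)] .
      have "((\<lambda>t. (1 - ?k t) * g (?D q) 1 u t + (- \<kappa>1 t) * g q 0 u t) has_vector_derivative
          ((1 - ?k t) * g (?D (?D q)) (Suc 1) u t + (- \<kappa>1 t) * g (?D q) 1 u t)
          + ((- \<kappa>1 t) * g (?D q) (Suc 0) u t + (- \<kappa>2 t) * g q 0 u t)) (at t)"
        by (intro has_vector_derivative_add has_vector_derivative_mult k nk g_der u)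
      moreover have "((1 - ?k t) * g (?D (?D q)) (Suc 1) u t + (- \<kappa>1 t) * g (?D q) 1 u t)
          + ((- \<kappa>1 t) * g (?D q) (Suc 0) u t + (- \<kappa>2 t) * g q 0 u t) = h2 u t"
        by (simp add: h2_def algebra_simps numeral_2_eq_2 del: mult_pCons_left)
      ultimately show ?thesis unfolding h1_def by simp
    qed
    have c2: "continuous_on UNIV (h2 u)"
      unfolding h2_def
      by (intro continuous_intros g_cont u test_functions_continuous[OF \<kappa>(1)]
           test_functions_continuous[OF \<kappa>1(1)] test_functions_continuous[OF \<kappa>2(1)])
    have c1: "continuous_on UNIV (h1 u)" and c0: "continuous_on UNIV (h u)"
      using d d1 by (meson has_vector_derivative_continuous continuous_at_imp_continuous_on)+
    note m = borel_measurable_continuous_onI[OF c0] borel_measurable_continuous_onI[OF c1]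
       borel_measurable_continuous_onI[OF c2]
    have "norm (fourier (h u) x) \<le> ((LINT x|lborel. norm (h u x)) + (LINT x|lborel. norm (h2 u x))) * inverse (1 + x\<^sup>2)"
      by (rule fourier_decay[OF d d1 c2 integrable_bound_inverse_square[OF m(1) b(1)]
            integrable_bound_inverse_square[OF m(2) b(2)] integrable_bound_inverse_square[OF m(3) b(3)]
            tendsto_bound_inverse_square[OF b(1)] tendsto_bound_inverse_square[OF b(2)]])
    also have "\<dots> \<le> (C * u ^ M * pi + C * u ^ M * pi) * inverse (1 + x\<^sup>2)"
      by (intro mult_right_mono add_mono integral_norm_bound_inverse_square m b i1)
    also have "\<dots> \<le> C * (2 * pi + 1) * u ^ M * inverse (1 + x\<^sup>2)"
      using C u i1[of x] by (intro mult_right_mono) (auto simp: algebra_simps)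
    finally show ?thesis .
  qed
  show ?thesis
  proof (intro exI[of _ "C * (2 * pi + 1)"] conjI allI impI)
    show "0 \<le> C * (2 * pi + 1)" using C by simp
    fix u t :: real assume u: "0 < u" "u \<le> 2"
    show "norm (fourier (h u) t) \<le> C * (2 * pi + 1) * u ^ M * inverse (1 + t\<^sup>2)" by (rule four[OF u])
    have "norm (h u t) \<le> C * u ^ M * inverse (1 + t\<^sup>2) ^ R"
      using bounds(1)[OF u, of t] weaken(2)[OF u(1), of t] by linarith
    also have "\<dots> \<le> C * (2 * pi + 1) * u ^ M * inverse (1 + t\<^sup>2) ^ R"
      using C u i1[of t] by (intro mult_right_mono) (auto simp: algebra_simps)
    finally show "norm (h u t) \<le> C * (2 * pi + 1) * u ^ M * inverse (1 + t\<^sup>2) ^ R" .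
  qed
qed

text \<open>Hypothesis \<open>T\<close> only speaks of test functions supported in \<open>{-1<..<1}\<close>. A Gaussian of width \<open>u\<close> times a
  cutoff is such a function, and the remaining tail contributes less than any power of \<open>u\<close>
  on both sides.\<close>

lemma signature_gaussian_asymptotics:
  fixes \<sigma> :: "real \<Rightarrow> real" and c :: complex and P q :: "real poly"
  assumes [measurable]: "\<sigma> \<in> borel_measurable borel" and \<sigma>: "\<And>x. \<bar>\<sigma> x\<bar> \<le> 1"
    and T: "\<And>\<psi>. \<psi> \<in> test_functions {-1<..<1} \<Longrightarrow>
      c * (LINT x|lborel. complex_of_real (\<sigma> x) * fourier \<psi> x) = (LINT t|lborel. complex_of_real (poly P t) * \<psi> t)"
  shows "\<exists>K. \<forall>u. 0 < u \<longrightarrow> u \<le> 2 \<longrightarrow>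
    norm (c * (LINT x|lborel. complex_of_real (\<sigma> x) * fourier (\<lambda>t. complex_of_real (gaussian_poly q t)) (u * x))
      - (LINT t|lborel. complex_of_real (poly P t) * (complex_of_real (gaussian_poly q (t / u)) / of_real u))) \<le> K * u ^ M"
proof -
  obtain \<kappa> :: "real \<Rightarrow> real" where \<kappa>: "smooth_fun (\<lambda>x. complex_of_real (\<kappa> x))"
    "\<And>x. \<bar>x\<bar> \<le> 1/2 \<Longrightarrow> \<kappa> x = 1" "\<And>x. 3/4 \<le> \<bar>x\<bar> \<Longrightarrow> \<kappa> x = 0"
    using smooth_cutoff by metis
  let ?k = "\<lambda>x. complex_of_real (\<kappa> x)"
  define \<psi> where "\<psi> u t = complex_of_real (gaussian_poly q (t / u)) / of_real u" for u t
  define h where "h u t = (1 - ?k t) * \<psi> u t" for u t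
  have k: "?k \<in> test_functions {-1<..<1}"
    unfolding test_functions_def
    by (intro CollectI conjI \<kappa>(1) exI[of _ "{-3/4..3/4}"]) (use \<kappa>(3) in \<open>auto simp: abs_le_iff not_le\<close>)
  obtain C R where CR: "C \<ge> 0" "\<And>t. \<bar>poly P t\<bar> * inverse (1 + t\<^sup>2) ^ R \<le> C"
    using poly_bound_inverse_square[of P] by blast
  obtain K where K: "K \<ge> 0" "\<And>u t. 0 < u \<Longrightarrow> u \<le> 2 \<Longrightarrow> norm (h u t) \<le> K * u ^ M * inverse (1 + t\<^sup>2) ^ Suc R"
    "\<And>u t. 0 < u \<Longrightarrow> u \<le> 2 \<Longrightarrow> norm (fourier (h u) t) \<le> K * u ^ M * inverse (1 + t\<^sup>2)"
    using gaussian_tail_cutoff[OF k \<kappa>(2), of q M "Suc R"] unfolding h_def \<psi>_def by blast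
  show ?thesis
  proof (intro exI[of _ "norm c * (K * pi) + C * K * pi"] allI impI)
    fix u :: real assume u: "0 < u" "u \<le> 2"
    have \<psi>_smooth: "smooth_fun (\<psi> u)"
    proof -
      have "smooth_fun (\<lambda>t. complex_of_real (gaussian_poly q t))"
        by (rule smooth_funI[of _ "range (\<lambda>q t. complex_of_real (gaussian_poly q t))"])
           (use gaussian_poly_has_vector_derivative in \<open>auto simp del: mult_pCons_left\<close>)
      from smooth_fun_affine[OF this, of "1 / u" 0]
      have 1: "smooth_fun (\<lambda>t. complex_of_real (gaussian_poly q (t / u)))" by simp
      have 2: "smooth_fun (\<lambda>t. 1 / complex_of_real u)"
        by (rule smooth_funI[of _ "range (\<lambda>c t. c)"]) (auto intro!: bexI[of _ "\<lambda>_. 0"] derivative_eq_intros)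
      show ?thesis using smooth_fun_mult[OF 1 2] by (simp add: \<psi>_def[abs_def])
    qed
    have k\<psi>: "(\<lambda>t. ?k t * \<psi> u t) \<in> test_functions {-1<..<1}"
      unfolding test_functions_def
      by (intro CollectI conjI smooth_fun_mult \<kappa>(1) \<psi>_smooth exI[of _ "{-3/4..3/4}"])
         (use \<kappa>(3) in \<open>auto simp: abs_le_iff not_le\<close>)
    note [measurable] = borel_measurable_continuous_onI[OF smooth_fun_continuous[OF \<psi>_smooth]]
      borel_measurable_continuous_onI[OF smooth_fun_continuous[OF \<kappa>(1)]]
    have hm [measurable]: "h u \<in> borel_measurable borel" unfolding h_def by measurable
    have \<psi>i: "integrable lborel (\<psi> u)"
      using lborel_integrable_real_affine[OF gaussian_poly_integrable[of q], of "1 / u" 0] u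
      by (simp add: \<psi>_def[abs_def])
    note k\<psi>i = test_functions_integrable[OF k\<psi>]
    have hd: "h u = (\<lambda>t. \<psi> u t - ?k t * \<psi> u t)" by (auto simp: h_def algebra_simps)
    have f\<psi>: "fourier (\<psi> u) x = fourier (\<lambda>t. complex_of_real (gaussian_poly q t)) (u * x)" for x
      unfolding \<psi>_def using u by (rule_tac fourier_scale) auto
    have fk: "fourier (\<lambda>t. ?k t * \<psi> u t) x = fourier (\<psi> u) x - fourier (h u) x" for x
      unfolding hd by (subst fourier_diff[OF \<psi>i k\<psi>i]) simp
    obtain G where G: "\<And>x. norm (fourier (\<lambda>t. ?k t * \<psi> u t) x) \<le> G * inverse (1 + x\<^sup>2)"
      using test_functions_fourier_bound[OF k\<psi>] by blast
    have mk: "fourier (\<lambda>t. ?k t * \<psi> u t) \<in> borel_measurable borel" and mh: "fourier (h u) \<in> borel_measurable borel"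
      by (intro fourier_measurable; measurable)+
    have i1: "integrable lborel (\<lambda>x. complex_of_real (\<sigma> x) * fourier (\<lambda>t. ?k t * \<psi> u t) x)"
      by (rule integrable_sign_mult[OF _ \<sigma> mk G]) measurable
    have i2: "integrable lborel (\<lambda>x. complex_of_real (\<sigma> x) * fourier (h u) x)"
      and n2: "norm (LINT x|lborel. complex_of_real (\<sigma> x) * fourier (h u) x) \<le> K * u ^ M * pi"
      by (rule integrable_sign_mult[OF _ \<sigma> mh K(3)[OF u]]; measurable)+
    have "(LINT x|lborel. complex_of_real (\<sigma> x) * fourier (\<psi> u) x)
        = (LINT x|lborel. complex_of_real (\<sigma> x) * fourier (\<lambda>t. ?k t * \<psi> u t) x)
          + (LINT x|lborel. complex_of_real (\<sigma> x) * fourier (h u) x)"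
      by (subst Bochner_Integration.integral_add[OF i1 i2, symmetric])
         (simp add: fk algebra_simps)
    then have e1: "c * (LINT x|lborel. complex_of_real (\<sigma> x) * fourier (\<psi> u) x)
        = (LINT t|lborel. complex_of_real (poly P t) * (?k t * \<psi> u t))
          + c * (LINT x|lborel. complex_of_real (\<sigma> x) * fourier (h u) x)"
      using T[OF k\<psi>] by (simp add: algebra_simps)
    have Pm [measurable]: "(\<lambda>t. complex_of_real (poly P t)) \<in> borel_measurable borel"
      by (intro borel_measurable_continuous_onI continuous_intros)
    have Pb: "norm (complex_of_real (poly P t) * h u t) \<le> (C * K * u ^ M) * inverse (1 + t\<^sup>2)" for t
    proof -
      have "norm (complex_of_real (poly P t) * h u t) \<le> \<bar>poly P t\<bar> * (K * u ^ M * inverse (1 + t\<^sup>2) ^ Suc R)"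
        unfolding norm_mult using K(2)[OF u, of t] by (intro mult_mono) auto
      also have "\<dots> = (\<bar>poly P t\<bar> * inverse (1 + t\<^sup>2) ^ R) * (K * u ^ M * inverse (1 + t\<^sup>2))"
        by simp
      also have "\<dots> \<le> C * (K * u ^ M * inverse (1 + t\<^sup>2))"
        using K(1) u by (intro mult_right_mono CR) auto
      finally show ?thesis by (simp add: mult_ac)
    qed
    have iP: "integrable lborel (\<lambda>t. complex_of_real (poly P t) * h u t)"
      by (rule integrable_bound_inverse_square[OF _ Pb]) measurable
    have nP: "norm (LINT t|lborel. complex_of_real (poly P t) * h u t) \<le> (C * K * u ^ M) * pi"
      by (rule order_trans[OF integral_norm_bound integral_norm_bound_inverse_square[OF _ Pb]]) measurable
    have kc: "continuous_on UNIV (\<lambda>t. complex_of_real (poly P t) * (?k t * \<psi> u t))"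
      by (intro continuous_intros test_functions_continuous[OF k\<psi>])
    have iPk: "integrable lborel (\<lambda>t. complex_of_real (poly P t) * (?k t * \<psi> u t))"
      by (rule integrable_compact_support[OF kc]) (use test_functions_zero[OF k] in auto)
    have e2: "(LINT t|lborel. complex_of_real (poly P t) * \<psi> u t)
        = (LINT t|lborel. complex_of_real (poly P t) * (?k t * \<psi> u t))
         + (LINT t|lborel. complex_of_real (poly P t) * h u t)"
      by (subst Bochner_Integration.integral_add[OF iPk iP, symmetric])
         (simp add: h_def algebra_simps)
    have "c * (LINT x|lborel. complex_of_real (\<sigma> x) * fourier (\<psi> u) x)
       - (LINT t|lborel. complex_of_real (poly P t) * \<psi> u t)
       = c * (LINT x|lborel. complex_of_real (\<sigma> x) * fourier (h u) x)
         - (LINT t|lborel. complex_of_real (poly P t) * h u t)"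
      unfolding e1 e2 by simp
    also have "norm \<dots> \<le> norm c * (K * u ^ M * pi) + (C * K * u ^ M) * pi"
      by (intro order_trans[OF norm_triangle_ineq4] add_mono nP)
         (auto simp: norm_mult intro!: mult_left_mono n2)
    also have "\<dots> = (norm c * (K * pi) + C * K * pi) * u ^ M" by (simp add: algebra_simps)
    finally show "norm (c * (LINT x|lborel. complex_of_real (\<sigma> x) * fourier (\<lambda>t. complex_of_real (gaussian_poly q t)) (u * x))
      - (LINT t|lborel. complex_of_real (poly P t) * (complex_of_real (gaussian_poly q (t / u)) / of_real u)))
       \<le> (norm c * (K * pi) + C * K * pi) * u ^ M"
      unfolding f\<psi> by (simp add: \<psi>_def)
  qed
qed


section \<open>The signature and the alternating series\<close>

text \<open>For positive \<open>x\<close> this is \<open>of_real x powr z\<close>. The junk values at other \<open>x\<close> are harmless, and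
  the explicit exponential makes measurability and the functional equations immediate.\<close>

definition cpow :: "real \<Rightarrow> complex \<Rightarrow> complex" where
  "cpow x z = exp (z * of_real (ln x))"

lemma powr_eq_cpow: "x > 0 \<Longrightarrow> of_real x powr z = cpow x z"
  by (simp add: cpow_def powr_def Ln_of_real)

lemma norm_cpow: "x > 0 \<Longrightarrow> norm (cpow x z) = x powr Re z"
  by (simp add: cpow_def powr_def)

lemma cpow_measurable [measurable]: "(\<lambda>x. cpow x z) \<in> borel_measurable borel"
  unfolding cpow_def by measurable

lemma cpow_add: "cpow x (a + b) = cpow x a * cpow x b"
  by (simp add: cpow_def distrib_right exp_add)

lemma cpow_minus: "cpow x (- a) = inverse (cpow x a)"
  by (simp add: cpow_def exp_minus)

lemma cpow_1: "x > 0 \<Longrightarrow> cpow x 1 = of_real x"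
  by (simp add: cpow_def exp_of_real)

lemma cpow_of_nat: "x > 0 \<Longrightarrow> cpow x (of_nat n) = of_real x ^ n"
  by (simp add: cpow_def exp_of_nat_mult exp_of_real)

lemma cpow_mult: "x > 0 \<Longrightarrow> y > 0 \<Longrightarrow> cpow (x * y) z = cpow x z * cpow y z"
  by (simp add: cpow_def ln_mult algebra_simps exp_add)

lemma cpow_power: "x > 0 \<Longrightarrow> cpow (x ^ n) z = cpow x (of_nat n * z)"
  by (simp add: cpow_def ln_realpow mult_ac)

lemma cpow_has_vector_derivative:
  assumes "x > 0"
  shows "((\<lambda>x. cpow x z) has_vector_derivative z * cpow x (z - 1)) (at x)"
proof -
  have "((\<lambda>x. z * complex_of_real (ln x)) has_vector_derivative z * of_real (1 / x)) (at x)"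
    using assms
    by (intro has_vector_derivative_mult_right bounded_linear.has_vector_derivative[OF bounded_linear_of_real])
       (auto simp flip: has_real_derivative_iff_has_vector_derivative intro!: derivative_eq_intros)
  from field_vector_diff_chain_at[OF this DERIV_exp]
  have "((\<lambda>x. cpow x z) has_vector_derivative z * of_real (1 / x) * cpow x z) (at x)"
    by (simp add: o_def cpow_def)
  moreover have "cpow x (z - 1) = cpow x z * of_real (1 / x)"
    using assms cpow_add[of x z "-1"] by (simp add: cpow_minus cpow_1 field_simps)
  ultimately show ?thesis by (simp add: mult_ac)
qed

text \<open>All factors of the product are real, the first \<open>k\<close> are not positive and the others not negative. The limit
  of the partial products inherits the sign since it is not zero.\<close>

lemma signature_eq:
  fixes \<phi> :: "complex \<Rightarrow> complex" and \<tau> :: "nat \<Rightarrow> real"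
  assumes product: "\<And>z. (\<lambda>k. 1 - z ^ 2 / complex_of_real (\<tau> (Suc k)) ^ 2) has_prod \<phi> z"
    and nz: "\<phi> (of_real x) \<noteq> 0"
    and below: "\<And>i. i < k \<Longrightarrow> \<tau> (Suc i) \<noteq> 0 \<and> (\<tau> (Suc i))\<^sup>2 \<le> x\<^sup>2"
    and above: "\<And>i. k \<le> i \<Longrightarrow> x\<^sup>2 \<le> (\<tau> (Suc i))\<^sup>2"
  shows "signature \<phi> x = (-1) ^ k"
proof -
  define f where "f i = 1 - x\<^sup>2 / (\<tau> (Suc i))\<^sup>2" for i
  have lim: "(\<lambda>n. complex_of_real (\<Prod>i\<le>n. f i)) \<longlonglongrightarrow> \<phi> (of_real x)"
    using product[of "of_real x"] nz by (auto simp: has_prod_def raw_has_prod_def f_def)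
  have fs: "f i = (if i < k then - 1 else 1) * \<bar>f i\<bar>" for i
  proof (cases "i < k")
    case True
    then have "f i \<le> 0" using below[OF True] by (simp add: f_def)
    then show ?thesis using True by simp
  next
    case False
    then have "f i \<ge> 0" using above[of i] by (cases "\<tau> (Suc i) = 0") (auto simp: f_def)
    then show ?thesis using False by simp
  qed
  have pos: "(- 1) ^ k * (\<Prod>i\<le>n. f i) \<ge> 0" if "k \<le> n" for n
  proof -
    have "(\<Prod>i\<le>n. f i) = (\<Prod>i\<le>n. (if i < k then - 1 else 1)) * (\<Prod>i\<le>n. \<bar>f i\<bar>)"
      using fs by (simp flip: prod.distrib)
    also have "(\<Prod>i\<le>n. (if i < k then - 1 else 1 :: real)) = (\<Prod>i<k. - 1)"
      by (rule prod.mono_neutral_cong_right) (use that in auto)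
    finally have "(- 1) ^ k * (\<Prod>i\<le>n. f i) = (- 1) ^ (k + k) * (\<Prod>i\<le>n. \<bar>f i\<bar>)"
      by (simp add: power_add)
    then show ?thesis by (simp add: prod_nonneg flip: mult_2)
  qed
  have Re: "(\<lambda>n. (- 1) ^ k * (\<Prod>i\<le>n. f i)) \<longlonglongrightarrow> (- 1) ^ k * Re (\<phi> (of_real x))"
    using tendsto_Re[OF lim] by (intro tendsto_mult tendsto_const) (simp flip: of_real_prod)
  have "(- 1) ^ k * Re (\<phi> (of_real x)) \<ge> 0"
    by (rule tendsto_lowerbound[OF Re]) (use pos in \<open>auto simp: eventually_at_top_linorder\<close>)
  moreover have "Im (\<phi> (of_real x)) = 0"
    using tendsto_Im[OF lim] by (simp add: LIMSEQ_const_iff flip: of_real_prod)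
  then have "Re (\<phi> (of_real x)) \<noteq> 0" using nz by (simp add: complex_eq_iff)
  ultimately show ?thesis
    by (cases "even k") (auto simp: signature_def sgn_if zero_le_mult_iff)
qed

lemma signature_between_zeros:
  fixes \<phi> :: "complex \<Rightarrow> complex" and \<tau> :: "nat \<Rightarrow> real"
  assumes product: "\<And>z. (\<lambda>k. 1 - z ^ 2 / complex_of_real (\<tau> (Suc k)) ^ 2) has_prod \<phi> z"
    and incr: "strict_mono_on {1..} \<tau>"
    and zeros: "\<tau> ` {1..} = {x. x > 0 \<and> \<phi> (complex_of_real x) = 0}"
  shows "0 \<le> x \<Longrightarrow> x < \<tau> 1 \<Longrightarrow> signature \<phi> x = 1"
    and "\<tau> (Suc n) < x \<Longrightarrow> x < \<tau> (Suc (Suc n)) \<Longrightarrow> signature \<phi> x = - ((-1) ^ n)"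
proof -
  have pos: "\<tau> (Suc i) > 0" for i using zeros by force
  have less: "\<tau> (Suc i) < \<tau> (Suc j)" if "i < j" for i j
    using strict_mono_onD[OF incr, of "Suc i" "Suc j"] that by simp
  have le: "\<tau> (Suc i) \<le> \<tau> (Suc j)" if "i \<le> j" for i j
    using less[of i j] that by (cases "i = j") auto
  have nz: "\<phi> (of_real x) \<noteq> 0" if "x > 0" "\<And>i. x \<noteq> \<tau> (Suc i)" for x
  proof
    assume "\<phi> (of_real x) = 0"
    then have "x \<in> \<tau> ` {1..}" using zeros that(1) by auto
    then obtain j where "j \<ge> 1" "x = \<tau> j" by auto
    then show False using that(2)[of "j - 1"] by simp
  qed
  show "signature \<phi> x = 1" if x: "0 \<le> x" "x < \<tau> 1"
  proof -
    have lt: "x < \<tau> (Suc i)" for i using le[of 0 i] x by simp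
    have nz0: "\<phi> (of_real x) \<noteq> 0"
    proof (cases "x = 0")
      case True
      have "(\<lambda>k. 1) has_prod \<phi> 0" using product[of 0] by simp
      then have "\<phi> 0 = 1" using has_prod_unique2[of "\<lambda>k. 1::complex" "\<phi> 0" 1] by simp
      then show ?thesis using True by simp
    next
      case False
      then show ?thesis using x lt by (intro nz) (auto simp: less_le)
    qed
    have "signature \<phi> x = (-1) ^ 0"
      by (rule signature_eq[OF product nz0]) (use x lt in \<open>auto intro!: power_mono simp: less_imp_le\<close>)
    then show ?thesis by simp
  qed
  show "signature \<phi> x = - ((-1) ^ n)" if x: "\<tau> (Suc n) < x" "x < \<tau> (Suc (Suc n))"
  proof -
    have gt: "\<tau> (Suc i) < x" if "i \<le> n" for i using le[OF that] x by simp
    have lt: "x < \<tau> (Suc i)" if "n < i" for i using le[of "Suc n" i] that x by simp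
    have xpos: "x > 0" using pos[of n] x by simp
    have ne: "x \<noteq> \<tau> (Suc i)" for i using gt[of i] lt[of i] by (cases "i \<le> n") auto
    have "signature \<phi> x = (-1) ^ Suc n"
    proof (rule signature_eq[OF product nz[OF xpos ne]])
      fix i assume "i < Suc n"
      then show "\<tau> (Suc i) \<noteq> 0 \<and> (\<tau> (Suc i))\<^sup>2 \<le> x\<^sup>2"
        using gt[of i] pos[of i] by (auto intro!: power_mono)
    next
      fix i assume "Suc n \<le> i"
      then show "x\<^sup>2 \<le> (\<tau> (Suc i))\<^sup>2"
        using lt[of i] xpos by (auto intro!: power_mono)
    qed
    then show ?thesis by simp
  qed
qed

lemma integrable_powr_at_top:
  fixes c e :: real
  assumes "c > 0" "e < -1"
  shows "integrable lborel (\<lambda>x. indicator {c..} x * x powr e)"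
proof -
  have "((\<lambda>x. x powr e) has_integral -(c powr (e+1)) / (e+1)) {c..}"
    using assms by (intro has_integral_powr_to_inf) auto
  then have "(\<lambda>x. x powr e) absolutely_integrable_on {c..}"
    by (intro nonnegative_absolutely_integrable_1) (auto simp: integrable_on_def)
  then have "integrable lebesgue (\<lambda>x. indicator {c..} x * x powr e)"
    by (simp add: set_integrable_def)
  then show ?thesis
    by (subst (asm) integrable_completion) auto
qed

text \<open>Summation by parts. Here \<open>A\<close> is the partial sum function of the alternating signs; because it is
  bounded, the integral converges absolutely in the whole half plane \<open>Re s > 0\<close>, although the series
  does so only for \<open>Re s > 1\<close>.\<close>

lemma eta_sums:
  fixes A :: "real \<Rightarrow> real" and \<tau> :: "nat \<Rightarrow> real" and s :: complex
  assumes sgn1: "\<And>n x. \<tau> (Suc n) < x \<Longrightarrow> x < \<tau> (Suc (Suc n)) \<Longrightarrow> A x = (1 + (-1) ^ n) / 2"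
    and A [measurable]: "A \<in> borel_measurable borel" "\<And>x. 0 \<le> A x \<and> A x \<le> 1"
    and incr: "\<And>n. \<tau> (Suc n) < \<tau> (Suc (Suc n))" and pos: "\<tau> 1 > 0"
    and lim: "filterlim \<tau> at_top sequentially"
    and s: "Re s > 0"
  shows "integrable lborel (\<lambda>x. indicator {\<tau> 1..} x *\<^sub>R (complex_of_real (A x) * cpow x (- s - 1)))"
    and "(\<lambda>k. (-1) ^ k * cpow (\<tau> (Suc k)) (- s)) sums
      (s * (LINT x|lborel. indicator {\<tau> 1..} x *\<^sub>R (complex_of_real (A x) * cpow x (- s - 1))))"
proof -
  let ?F = "\<lambda>x. complex_of_real (A x) * cpow x (- s - 1)"
  let ?a = "\<lambda>k. cpow (\<tau> (Suc k)) (- s)"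
  have \<tau>1: "\<tau> 1 \<le> \<tau> (Suc n)" for n
    by (induction n) (use incr in \<open>auto intro: order_trans less_imp_le\<close>)
  have \<tau>pos: "\<tau> (Suc n) > 0" for n using \<tau>1[of n] pos by linarith
  have s0: "s \<noteq> 0" using s by auto
  show int: "integrable lborel (\<lambda>x. indicator {\<tau> 1..} x *\<^sub>R ?F x)"
  proof (rule Bochner_Integration.integrable_bound[OF integrable_powr_at_top[OF pos, of "- Re s - 1"]])
    show "AE x in lborel. norm (indicator {\<tau> 1..} x *\<^sub>R ?F x) \<le> norm (indicator {\<tau> 1..} x * x powr (- Re s - 1))"
    proof (intro AE_I2)
      fix x
      show "norm (indicator {\<tau> 1..} x *\<^sub>R ?F x) \<le> norm (indicator {\<tau> 1..} x * x powr (- Re s - 1))"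
        using A(2)[of x] pos
        by (auto simp: indicator_def norm_mult norm_cpow intro!: mult_left_le_one_le)
    qed
  qed (use s in auto)
  have pieces: "(?F has_integral (1 + (-1) ^ n) / 2 * ((?a n - ?a (Suc n)) / s)) {\<tau> (Suc n)..\<tau> (Suc (Suc n))}" for n
  proof -
    have "((\<lambda>x. - s * cpow x (- s - 1)) has_integral (?a (Suc n) - ?a n)) {\<tau> (Suc n)..\<tau> (Suc (Suc n))}"
    proof (rule fundamental_theorem_of_calculus)
      fix x assume "x \<in> {\<tau> (Suc n)..\<tau> (Suc (Suc n))}"
      then have "x > 0" using \<tau>pos[of n] by simp
      then show "((\<lambda>x. cpow x (- s)) has_vector_derivative - s * cpow x (- s - 1)) (at x within {\<tau> (Suc n)..\<tau> (Suc (Suc n))})"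
        by (rule has_vector_derivative_at_within[OF cpow_has_vector_derivative])
    qed (use incr[of n] in simp)
    note 1 = this
    have e1: "- (1 + (-1) ^ n) / (2 * s) * (- s * c) = (1 + (-1) ^ n) / 2 * c" for c
      using s0 by (simp add: field_simps)
    have e2: "- (1 + (-1) ^ n) / (2 * s) * (b - a) = (1 + (-1) ^ n) / 2 * ((a - b) / s)" for a b
      using s0 by (simp add: field_simps)
    from has_integral_mult_right[OF 1, of "- (1 + (-1) ^ n) / (2 * s)"]
    have "((\<lambda>x. (1 + (-1) ^ n) / 2 * cpow x (- s - 1)) has_integral (1 + (-1) ^ n) / 2 * ((?a n - ?a (Suc n)) / s)) (cbox (\<tau> (Suc n)) (\<tau> (Suc (Suc n))))"
      unfolding e1 e2 by simp
    then have "(?F has_integral (1 + (-1) ^ n) / 2 * ((?a n - ?a (Suc n)) / s)) (cbox (\<tau> (Suc n)) (\<tau> (Suc (Suc n))))"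
      by (rule has_integral_spike_interior) (auto simp: sgn1)
    then show ?thesis by simp
  qed
  \<comment> \<open>The last zero is counted only if it ends an interval on which \<open>A\<close> is \<open>1\<close>; hence the correction
    for odd \<open>n\<close>, which disappears in the limit.\<close>
  have S: "(?F has_integral ((\<Sum>k<n. (-1) ^ k * ?a k) - (1 - (-1) ^ n) / 2 * ?a n) / s) {\<tau> 1..\<tau> (Suc n)}" for n
  proof (induction n)
    case 0
    show ?case using has_integral_refl(2)[of ?F "\<tau> 1"] by simp
  next
    case (Suc n)
    have "(?F has_integral (((\<Sum>k<n. (-1) ^ k * ?a k) - (1 - (-1) ^ n) / 2 * ?a n) / s
         + (1 + (-1) ^ n) / 2 * ((?a n - ?a (Suc n)) / s))) {\<tau> 1..\<tau> (Suc (Suc n))}"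
      by (rule has_integral_combine[OF _ _ Suc.IH pieces]) (use \<tau>1[of n] incr[of n] in auto)
    moreover have "((\<Sum>k<n. (-1) ^ k * ?a k) - (1 - (-1) ^ n) / 2 * ?a n) / s
         + (1 + (-1) ^ n) / 2 * ((?a n - ?a (Suc n)) / s)
         = ((\<Sum>k<Suc n. (-1) ^ k * ?a k) - (1 - (-1) ^ Suc n) / 2 * ?a (Suc n)) / s"
      using s0 by (cases "even n") (simp_all add: field_simps)
    ultimately show ?case by simp
  qed
  have I: "((\<Sum>k<n. (-1) ^ k * ?a k) - (1 - (-1) ^ n) / 2 * ?a n) / s = (LINT x:{\<tau> 1..\<tau> (Suc n)}|lborel. ?F x)" for n
  proof -
    have "set_integrable lborel {\<tau> 1..\<tau> (Suc n)} ?F"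
      by (rule set_integrable_subset[of _ "{\<tau> 1..}"]) (use int in \<open>auto simp: set_integrable_def\<close>)
    from set_borel_integral_eq_integral(2)[OF this] show ?thesis
      using integral_unique[OF S] by simp
  qed
  have L: "(\<lambda>n. LINT x:{\<tau> 1..\<tau> (Suc n)}|lborel. ?F x) \<longlonglongrightarrow> (LINT x:{\<tau> 1..}|lborel. ?F x)"
  proof (rule filterlim_compose[OF tendsto_set_lebesgue_integral_at_top])
    show "filterlim (\<lambda>n. \<tau> (Suc n)) at_top sequentially"
      using lim by (simp add: filterlim_sequentially_Suc)
  qed (use int in \<open>auto simp: set_integrable_def\<close>)
  have a0: "?a \<longlonglongrightarrow> 0"
  proof (rule tendsto_norm_zero_cancel)
    have "(\<lambda>n. \<tau> (Suc n) powr (- Re s)) \<longlonglongrightarrow> 0"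
      using lim s by (intro tendsto_neg_powr) (auto simp: filterlim_sequentially_Suc)
    then show "(\<lambda>n. norm (?a n)) \<longlonglongrightarrow> 0" using \<tau>pos by (simp add: norm_cpow)
  qed
  have b0: "(\<lambda>n. (1 - (-1) ^ n) / 2 * ?a n) \<longlonglongrightarrow> 0"
  proof (rule Lim_null_comparison[OF _ tendsto_norm_zero[OF a0]])
    show "\<forall>\<^sub>F n in sequentially. norm ((1 - (-1) ^ n) / 2 * ?a n) \<le> norm (?a n)"
    proof (intro always_eventually allI)
      fix n
      show "norm ((1 - (-1) ^ n) / 2 * ?a n) \<le> norm (?a n)"
        by (cases "even n") (auto simp: norm_mult)
    qed
  qed
  have "(\<lambda>n. s * (LINT x:{\<tau> 1..\<tau> (Suc n)}|lborel. ?F x) + (1 - (-1) ^ n) / 2 * ?a n) \<longlonglongrightarrow>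
      s * (LINT x:{\<tau> 1..}|lborel. ?F x) + 0"
    by (intro tendsto_add tendsto_mult L b0 tendsto_const)
  moreover have "s * (LINT x:{\<tau> 1..\<tau> (Suc n)}|lborel. ?F x) + (1 - (-1) ^ n) / 2 * ?a n = (\<Sum>k<n. (-1) ^ k * ?a k)" for n
    using s0 unfolding I[symmetric] by simp
  ultimately show "(\<lambda>k. (-1) ^ k * ?a k) sums (s * (LINT x|lborel. indicator {\<tau> 1..} x *\<^sub>R ?F x))"
    by (simp add: sums_def set_lebesgue_integral_def)
qed


section \<open>Mellin transform of the theta function\<close>

lemma gamma_integral_scaled:
  assumes z: "Re z > 0" and a: "a > 0"
  shows "has_bochner_integral lborel
    (\<lambda>w. indicator {0<..} w *\<^sub>R (cpow w (z - 1) * of_real (exp (- (a * w))))) (Gamma z * cpow a (- z))"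
proof -
  let ?f = "\<lambda>t. indicator {0<..} t *\<^sub>R (cpow t (z - 1) * of_real (exp (- t)))"
  have eq: "indicator {0<..} t *\<^sub>R (complex_of_real t powr (z - 1) / of_real (exp t)) = ?f t" for t
    by (cases "t > 0") (simp_all add: powr_eq_cpow exp_minus divide_inverse)
  have "integrable lebesgue ?f"
    using absolutely_integrable_Gamma_integral'[OF z] unfolding set_integrable_def eq .
  moreover have "integral\<^sup>L lebesgue ?f = Gamma z"
    using set_lebesgue_integral_eq_integral(2)[OF absolutely_integrable_Gamma_integral'[OF z]]
      integral_unique[OF Gamma_integral_complex'[OF z]]
    unfolding set_lebesgue_integral_def eq by simp
  ultimately have "has_bochner_integral lborel ?f (Gamma z)"
    by (simp add: has_bochner_integral_iff integrable_completion integral_completion)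
  then have "has_bochner_integral lborel (\<lambda>w. ?f (0 + a * w)) (Gamma z /\<^sub>R \<bar>a\<bar>)"
    by (subst (asm) lborel_has_bochner_integral_real_affine_iff[of a _ _ 0]) (use a in auto)
  then have "has_bochner_integral lborel (\<lambda>w. cpow a (1 - z) * ?f (0 + a * w)) (cpow a (1 - z) * (Gamma z /\<^sub>R \<bar>a\<bar>))"
    by (intro has_bochner_integral_mult_right) auto
  moreover have "cpow a (1 - z) * ?f (0 + a * w) =
      indicator {0<..} w *\<^sub>R (cpow w (z - 1) * of_real (exp (- (a * w))))" for w
  proof (cases "w > 0")
    case True
    have "cpow a (1 - z) * cpow a (z - 1) = 1"
      by (simp add: cpow_def flip: cpow_add exp_add) (simp add: algebra_simps)
    then show ?thesis using True a by (simp add: cpow_mult mult_ac)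
  next
    case False
    then show ?thesis using a by (simp add: zero_less_mult_iff)
  qed
  moreover have "cpow a (1 - z) * (Gamma z /\<^sub>R \<bar>a\<bar>) = Gamma z * cpow a (- z)"
    using a cpow_add[of a 1 "- z"] by (simp add: cpow_1 scaleR_conv_of_real field_simps)
  ultimately show ?thesis by simp
qed

lemma gamma_integral_scaled_real:
  fixes r a :: real
  assumes r: "r > 0" and a: "a > 0"
  shows "has_bochner_integral lborel
    (\<lambda>w. indicator {0<..} w * (w powr (r - 1) * exp (- (a * w)))) (Gamma r * a powr (- r))"
proof -
  have c: "cpow x (of_real y) = of_real (x powr y)" if "x > 0" for x y
    using that by (simp add: cpow_def powr_def exp_of_real mult.commute flip: of_real_mult)
  have "has_bochner_integral lborel
     (\<lambda>w. Re (indicator {0<..} w *\<^sub>R (cpow w (of_real r - 1) * of_real (exp (- (a * w))))))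
     (Re (Gamma (of_real r) * cpow a (- of_real r)))"
    using gamma_integral_scaled[of "of_real r" a] assms
    by (intro has_bochner_integral_bounded_linear[OF bounded_linear_Re]) simp
  moreover have "Re (indicator {0<..} w *\<^sub>R (cpow w (of_real r - 1) * of_real (exp (- (a * w)))))
      = indicator {0<..} w * (w powr (r - 1) * exp (- (a * w)))" for w
    using c[of w "r - 1"] by (simp add: indicator_def)
  moreover have "Re (Gamma (of_real r) * cpow a (- of_real r)) = Gamma r * a powr (- r)"
    using c[OF a, of "- r"] by (simp add: Gamma_complex_of_real)
  ultimately show ?thesis by (simp only:)
qed

text \<open>The derivative with respect to \<open>x\<close> of \<open>x ^ (1 - e) * exp (- (w * x\<^sup>2))\<close>, where \<open>e\<close> will be the
  parity \<open>par d\<close>. The extra factor \<open>x\<close> for odd dimension adapts the parity of the kernel to that of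
  the signature.\<close>

definition theta_kernel :: "nat \<Rightarrow> real \<Rightarrow> real \<Rightarrow> real" where
  "theta_kernel e w x = ((if e = 0 then 1 else 0) - 2 * w * x ^ (2 - e)) * exp (- (w * x\<^sup>2))"

lemma theta_kernel_measurable [measurable]: "(\<lambda>x. theta_kernel e w x) \<in> borel_measurable borel"
  unfolding theta_kernel_def by measurable

lemma theta_kernel_deriv:
  assumes "e = 0 \<or> e = 1"
  shows "((\<lambda>x. x ^ (1 - e) * exp (- (w * x\<^sup>2))) has_real_derivative theta_kernel e w x) (at x)"
  using assms by (auto simp: theta_kernel_def algebra_simps power2_eq_square intro!: derivative_eq_intros)

text \<open>The factor \<open>s\<close> and the power of \<open>x\<close> are those of the integral in \<open>eta_sums\<close>. For \<open>e = 0\<close> the two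
  Gamma integrals combine by the functional equation \<open>\<Gamma>(z + 1) = z \<Gamma>(z)\<close>.\<close>

lemma theta_kernel_mellin:
  assumes e: "e = 0 \<or> e = 1" and z: "Re z > 0" and x: "x > 0"
  defines "s \<equiv> 2 * z - 1 + of_nat e"
  shows "has_bochner_integral lborel
    (\<lambda>w. indicator {0<..} w *\<^sub>R (cpow w (z - 1) * of_real (theta_kernel e w x)))
    (- s * Gamma z * cpow x (- s - 1))"
proof -
  let ?d = "if e = 0 then 1 else 0 :: complex"
  let ?g = "\<lambda>z w. indicator {0<..} w *\<^sub>R (cpow w (z - 1) * of_real (exp (- (x\<^sup>2 * w))))"
  have "has_bochner_integral lborel (\<lambda>w. ?d * ?g z w - (2 * of_real x ^ (2 - e)) * ?g (z + 1) w)
     (?d * (Gamma z * cpow (x\<^sup>2) (- z)) - (2 * of_real x ^ (2 - e)) * (Gamma (z + 1) * cpow (x\<^sup>2) (- (z + 1))))"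
    using z x by (intro has_bochner_integral_diff has_bochner_integral_mult_right gamma_integral_scaled) auto
  moreover have "?d * ?g z w - (2 * of_real x ^ (2 - e)) * ?g (z + 1) w =
     indicator {0<..} w *\<^sub>R (cpow w (z - 1) * of_real (theta_kernel e w x))" for w
    using cpow_add[of w "z - 1" 1] cpow_1[of w]
    by (auto simp: indicator_def theta_kernel_def algebra_simps)
  moreover have "?d * (Gamma z * cpow (x\<^sup>2) (- z)) - (2 * of_real x ^ (2 - e)) * (Gamma (z + 1) * cpow (x\<^sup>2) (- (z + 1)))
      = - s * Gamma z * cpow x (- s - 1)"
  proof -
    have "z \<notin> \<int>\<^sub>\<le>\<^sub>0" using z by (auto elim!: nonpos_Ints_cases)
    then have G: "Gamma (z + 1) = z * Gamma z" by (rule Gamma_plus1)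
    have c: "cpow (x\<^sup>2) y = cpow x (2 * y)" for y using cpow_power[OF x, of 2 y] by simp
    have p: "of_real x ^ n * cpow x y = cpow x (of_nat n + y)" for n y
      using cpow_add[of x "of_nat n" y] cpow_of_nat[OF x, of n] by simp
    show ?thesis
      using e p[of "2 - e" "2 * (- (z + 1))"] unfolding G c s_def by (auto simp: algebra_simps)
  qed
  ultimately show ?thesis by simp
qed

lemma theta_kernel_mellin_norm:
  assumes e: "e = 0 \<or> e = 1" and z: "Re z > 0"
  shows "\<exists>C\<ge>0. \<forall>x>0. (LINT w|lborel. norm (indicator {0<..} w *\<^sub>R (cpow w (z - 1) * of_real (theta_kernel e w x))))
     \<le> C * x powr (- (2 * Re z + e))"
proof (intro exI[of _ "Gamma (Re z) + 2 * Gamma (Re z + 1)"] conjI allI impI)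
  show "0 \<le> Gamma (Re z) + 2 * Gamma (Re z + 1)"
    using z by (auto intro!: add_nonneg_nonneg Gamma_real_nonneg)
  fix x :: real assume x: "x > 0"
  let ?d = "if e = 0 then 1 else 0 :: real"
  let ?g = "\<lambda>r w. indicator {0<..} w * (w powr (r - 1) * exp (- (x\<^sup>2 * w)))"
  have hb: "has_bochner_integral lborel (\<lambda>w. ?d * ?g (Re z) w + (2 * x ^ (2 - e)) * ?g (Re z + 1) w)
     (?d * (Gamma (Re z) * (x\<^sup>2) powr (- Re z)) + (2 * x ^ (2 - e)) * (Gamma (Re z + 1) * (x\<^sup>2) powr (- (Re z + 1))))"
    using z x by (intro has_bochner_integral_add has_bochner_integral_mult_right gamma_integral_scaled_real) auto
  have "(LINT w|lborel. norm (indicator {0<..} w *\<^sub>R (cpow w (z - 1) * of_real (theta_kernel e w x))))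
     \<le> (LINT w|lborel. ?d * ?g (Re z) w + (2 * x ^ (2 - e)) * ?g (Re z + 1) w)"
  proof (rule integral_mono)
    show "integrable lborel (\<lambda>w. norm (indicator {0<..} w *\<^sub>R (cpow w (z - 1) * of_real (theta_kernel e w x))))"
      using theta_kernel_mellin[OF e z x] by (intro integrable_norm) (simp add: has_bochner_integral_iff)
    show "integrable lborel (\<lambda>w. ?d * ?g (Re z) w + (2 * x ^ (2 - e)) * ?g (Re z + 1) w)"
      using hb by (simp add: has_bochner_integral_iff)
    fix w :: real
    show "norm (indicator {0<..} w *\<^sub>R (cpow w (z - 1) * of_real (theta_kernel e w x)))
      \<le> ?d * ?g (Re z) w + (2 * x ^ (2 - e)) * ?g (Re z + 1) w"
    proof (cases "w > 0")
      case True
      have "\<bar>theta_kernel e w x\<bar> \<le> (?d + 2 * w * x ^ (2 - e)) * exp (- (w * x\<^sup>2))"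
        unfolding theta_kernel_def abs_mult using True x
        by (intro mult_mono order_trans[OF abs_triangle_ineq4]) auto
      then have "w powr (Re z - 1) * \<bar>theta_kernel e w x\<bar> \<le> w powr (Re z - 1) * ((?d + 2 * w * x ^ (2 - e)) * exp (- (w * x\<^sup>2)))"
        by (rule mult_left_mono) simp
      also have "\<dots> = ?d * ?g (Re z) w + (2 * x ^ (2 - e)) * ?g (Re z + 1) w"
        using True powr_add[of w "Re z - 1" 1] by (simp add: algebra_simps)
      finally show ?thesis using True by (simp add: norm_mult norm_cpow)
    qed simp
  qed
  also have "\<dots> = ?d * (Gamma (Re z) * (x\<^sup>2) powr (- Re z)) + (2 * x ^ (2 - e)) * (Gamma (Re z + 1) * (x\<^sup>2) powr (- (Re z + 1)))"
    using hb by (rule has_bochner_integral_integral_eq)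
  also have "\<dots> \<le> (Gamma (Re z) + 2 * Gamma (Re z + 1)) * x powr (- (2 * Re z + e))"
  proof -
    have p: "(x\<^sup>2) powr y = x powr (2 * y)" for y
    proof -
      have "x\<^sup>2 = x powr 2" using x by simp
      then show ?thesis by (simp only: powr_powr)
    qed
    have q: "x ^ (2 - e) * x powr (2 * (- (Re z + 1))) = x powr (- (2 * Re z + e))"
    proof -
      have "x ^ (2 - e) * x powr (2 * (- (Re z + 1))) = x powr (real (2 - e) + 2 * (- (Re z + 1)))"
        unfolding powr_add powr_realpow[OF x] ..
      also have "real (2 - e) + 2 * (- (Re z + 1)) = - (2 * Re z + e)" using e by auto
      finally show ?thesis .
    qed
    have "?d * (Gamma (Re z) * (x\<^sup>2) powr (- Re z)) \<le> Gamma (Re z) * x powr (- (2 * Re z + e))"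
      using e z by (auto simp: p intro!: Gamma_real_nonneg)
    moreover have "(2 * x ^ (2 - e)) * (Gamma (Re z + 1) * (x\<^sup>2) powr (- (Re z + 1))) = 2 * Gamma (Re z + 1) * x powr (- (2 * Re z + e))"
      unfolding p q[symmetric] by (simp add: mult_ac)
    ultimately show ?thesis unfolding distrib_right by linarith
  qed
  finally show "(LINT w|lborel. norm (indicator {0<..} w *\<^sub>R (cpow w (z - 1) * of_real (theta_kernel e w x))))
     \<le> (Gamma (Re z) + 2 * Gamma (Re z + 1)) * x powr (- (2 * Re z + e))" .
qed

text \<open>Fubini. Since \<open>A\<close> vanishes near the origin and is bounded, absolute convergence holds for
  \<open>Re s > 0\<close>, so that no separate identity theorem is needed to reach the strip of conditional
  convergence.\<close>

lemma theta_mellin: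
  fixes A :: "real \<Rightarrow> real" and c :: real and s z :: complex
  assumes e: "e = 0 \<or> e = 1"
    and A [measurable]: "A \<in> borel_measurable borel" and A01: "\<And>x. 0 \<le> A x \<and> A x \<le> 1" and A0: "\<And>x. x < c \<Longrightarrow> A x = 0"
    and c: "c > 0" and s: "Re s > 0" "s = 2 * z - 1 + of_nat e"
  shows "(LINT w|lborel. indicator {0<..} w *\<^sub>R (cpow w (z - 1) * of_real (- (LINT x|lborel. A x * theta_kernel e w x))))
    = Gamma z * (s * (LINT x|lborel. indicator {c..} x *\<^sub>R (complex_of_real (A x) * cpow x (- s - 1))))"
proof -
  have Res: "Re s = 2 * Re z - 1 + e" using s(2) by simp
  have z: "Re z > 0" using Res s(1) e by auto
  have ex: "- (2 * Re z + e) = - Re s - 1" using Res by simp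
  define f where "f x w = complex_of_real (A x) * (indicator {0<..} w *\<^sub>R (cpow w (z - 1) * of_real (theta_kernel e w x)))" for x w
  have Ac: "A x = indicator {c..} x * A x" for x using A0[of x] by (auto simp: indicator_def)
  have [measurable]: "(\<lambda>(x, w). theta_kernel e w x) \<in> borel_measurable (lborel \<Otimes>\<^sub>M lborel)"
    unfolding theta_kernel_def by measurable
  have fm [measurable]: "(\<lambda>(x, w). f x w) \<in> borel_measurable (lborel \<Otimes>\<^sub>M lborel)"
    unfolding f_def by measurable
  obtain C where C: "C \<ge> 0" "\<And>x. x > 0 \<Longrightarrow> (LINT w|lborel. norm (indicator {0<..} w *\<^sub>R (cpow w (z - 1) * of_real (theta_kernel e w x))))
     \<le> C * x powr (- Re s - 1)"
    using theta_kernel_mellin_norm[OF e z] ex by auto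
  have int: "integrable (lborel \<Otimes>\<^sub>M lborel) (\<lambda>(x, w). f x w)"
  proof (rule lborel_pair.Fubini_integrable)
    have "integrable lborel (\<lambda>x. C * (indicator {c..} x * x powr (- Re s - 1)))"
      using integrable_powr_at_top[OF c, of "- Re s - 1"] s by (intro integrable_mult_right) auto
    then show "integrable lborel (\<lambda>x. LINT w|lborel. norm ((\<lambda>(x, w). f x w) (x, w)))"
    proof (rule Bochner_Integration.integrable_bound)
      show "(\<lambda>x. LINT w|lborel. norm ((\<lambda>(x, w). f x w) (x, w))) \<in> borel_measurable lborel"
        by measurable
      show "AE x in lborel. norm (LINT w|lborel. norm ((\<lambda>(x, w). f x w) (x, w)))
         \<le> norm (C * (indicator {c..} x * x powr (- Re s - 1)))"
      proof (intro AE_I2)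
        fix x :: real
        have "(LINT w|lborel. norm (f x w)) = A x * (LINT w|lborel. norm (indicator {0<..} w *\<^sub>R (cpow w (z - 1) * of_real (theta_kernel e w x))))"
          unfolding f_def norm_mult using A01[of x] by simp
        also have "\<dots> \<le> C * (indicator {c..} x * x powr (- Re s - 1))"
        proof (cases "c \<le> x")
          case True
          then have "A x * (LINT w|lborel. norm (indicator {0<..} w *\<^sub>R (cpow w (z - 1) * of_real (theta_kernel e w x))))
             \<le> 1 * (C * x powr (- Re s - 1))"
            using A01[of x] C(2)[of x] c by (intro mult_mono) auto
          then show ?thesis using True by simp
        qed (use A0 in auto)
        finally show "norm (LINT w|lborel. norm ((\<lambda>(x, w). f x w) (x, w))) \<le> norm (C * (indicator {c..} x * x powr (- Re s - 1)))"
          using C(1) by simp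
      qed
    qed
    show "AE x in lborel. integrable lborel (\<lambda>w. (\<lambda>(x, w). f x w) (x, w))"
    proof (intro AE_I2)
      fix x :: real
      show "integrable lborel (\<lambda>w. (\<lambda>(x, w). f x w) (x, w))"
      proof (cases "c \<le> x")
        case True
        then have "integrable lborel (\<lambda>w. indicator {0<..} w *\<^sub>R (cpow w (z - 1) * of_real (theta_kernel e w x)))"
          using theta_kernel_mellin[OF e z, of x] c unfolding has_bochner_integral_iff by simp
        from integrable_mult_right[OF this, of "complex_of_real (A x)"] show ?thesis
          by (simp only: f_def prod.case)
      qed (use A0 in \<open>auto simp: f_def\<close>)
    qed
  qed (rule fm)
  have F: "(LINT w|lborel. (LINT x|lborel. f x w)) = (LINT x|lborel. (LINT w|lborel. f x w))"
    using lborel_pair.Fubini_integral[OF int] .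
  have fx: "(LINT x|lborel. f x w) = - (indicator {0<..} w *\<^sub>R (cpow w (z - 1) * of_real (- (LINT x|lborel. A x * theta_kernel e w x))))" for w
  proof -
    have "(LINT x|lborel. f x w) = (LINT x|lborel. (indicator {0<..} w *\<^sub>R cpow w (z - 1)) * of_real (A x * theta_kernel e w x))"
      unfolding f_def by (intro Bochner_Integration.integral_cong) (auto simp: scaleR_conv_of_real mult_ac)
    also have "\<dots> = (indicator {0<..} w *\<^sub>R cpow w (z - 1)) * of_real (LINT x|lborel. A x * theta_kernel e w x)"
      by (simp only: integral_mult_right_zero integral_complex_of_real)
    finally show ?thesis by simp
  qed
  have fw: "(LINT w|lborel. f x w) = - (Gamma z * s) * (indicator {c..} x *\<^sub>R (complex_of_real (A x) * cpow x (- s - 1)))" for x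
  proof (cases "c \<le> x")
    case True
    have "(LINT w|lborel. f x w) = complex_of_real (A x) * (- s * Gamma z * cpow x (- s - 1))"
      unfolding f_def integral_mult_right_zero s(2) using c True
      by (subst has_bochner_integral_integral_eq[OF theta_kernel_mellin[OF e z]]) auto
    then show ?thesis using True by simp
  qed (use A0 in \<open>auto simp: f_def\<close>)
  show ?thesis
    using F unfolding fx fw
    by (simp only: integral_minus integral_mult_right_zero mult_minus_left neg_equal_iff_equal mult.assoc)
qed

text \<open>Subtracting the polynomial on the unit interval leaves a function that is smaller than every power
  at both ends; its Mellin transform is entire. The polynomial itself contributes the simple
  fractions.\<close>

lemma mellin_split:
  fixes D :: "real \<Rightarrow> real" and b :: "nat \<Rightarrow> real"
  assumes [measurable]: "D \<in> borel_measurable borel"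
    and small: "\<And>M. \<exists>K. \<forall>w. 0 < w \<longrightarrow> w \<le> 1 \<longrightarrow> \<bar>D w - (\<Sum>m\<le>n. b m * w ^ m)\<bar> \<le> K * w ^ M"
    and large: "\<And>M. \<exists>K. \<forall>w\<ge>1. \<bar>D w\<bar> * w ^ M \<le> K"
  obtains W :: "complex \<Rightarrow> complex" where "W holomorphic_on UNIV"
    "\<And>z. Re z > 0 \<Longrightarrow> (LINT w|lborel. indicator {0<..} w *\<^sub>R (cpow w (z - 1) * of_real (D w)))
      = W z + (\<Sum>m\<le>n. of_real (b m) / (z + of_nat m))"
proof -
  define Q where "Q w = (\<Sum>m\<le>n. b m * w ^ m)" for w
  define H where "H w = D w - indicator {..1} w * Q w" for w
  define G where "G w = indicator {0<..} w *\<^sub>R (complex_of_real (H w) / of_real w)" for w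
  define l where "l w = complex_of_real (ln w)" for w
  have [measurable]: "H \<in> borel_measurable borel" unfolding H_def Q_def by measurable
  have [measurable]: "G \<in> borel_measurable borel" unfolding G_def by measurable
  have [measurable]: "l \<in> borel_measurable borel" unfolding l_def by measurable
  have int: "integrable lborel (\<lambda>w. exp (r * norm (l w)) * norm (G w))" if "r \<ge> 0" for r
  proof -
    obtain R :: nat where R: "r \<le> real R" using real_arch_simple by blast
    obtain K1 where K1: "\<And>w. 0 < w \<Longrightarrow> w \<le> 1 \<Longrightarrow> \<bar>D w - Q w\<bar> \<le> K1 * w ^ (R + 1)"
      using small[of "R + 1"] unfolding Q_def by blast
    obtain K2 where K2: "\<And>w. w \<ge> 1 \<Longrightarrow> \<bar>D w\<bar> * w ^ (R + 1) \<le> K2"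
      using large[of "R + 1"] by blast
    define K where "K = 2 * (\<bar>K1\<bar> + \<bar>K2\<bar>)"
    have bound: "norm (exp (r * norm (l w)) * norm (G w)) \<le> K * inverse (1 + w\<^sup>2)" for w
    proof -
      consider "w \<le> 0" | "0 < w" "w \<le> 1" | "w > 1" by linarith
      then show ?thesis
      proof cases
        case 1
        then show ?thesis by (simp add: G_def K_def)
      next
        case 2
        have l: "norm (l w) = - ln w" using 2 by (simp add: l_def)
        have "exp (r * norm (l w)) \<le> exp (R * norm (l w))" using R by (simp add: mult_right_mono)
        also have "\<dots> = inverse (w ^ R)"
          unfolding l using 2 by (simp add: exp_minus exp_of_nat_mult)
        finally have E: "exp (r * norm (l w)) \<le> inverse (w ^ R)" .
        have N: "norm (G w) = \<bar>D w - Q w\<bar> / w"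
          using 2 by (simp add: G_def H_def norm_divide flip: of_real_diff)
        have "exp (r * norm (l w)) * norm (G w) \<le> inverse (w ^ R) * (K1 * w ^ (R + 1) / w)"
          unfolding N using 2 by (intro mult_mono E divide_right_mono K1) auto
        also have "\<dots> = K1" using 2 by simp
        also have "\<dots> \<le> K * (1/2)" by (simp add: K_def)
        also have "\<dots> \<le> K * inverse (1 + w\<^sup>2)"
        proof (intro mult_left_mono)
          have "1 + w\<^sup>2 \<le> 2" using 2 power_le_one[of w 2] by simp
          then show "1/2 \<le> inverse (1 + w\<^sup>2)" by (simp add: field_simps add_pos_nonneg)
        qed (simp add: K_def)
        finally show ?thesis by simp
      next
        case 3
        have "exp (r * norm (l w)) \<le> exp (R * norm (l w))" using R by (simp add: mult_right_mono)
        also have "\<dots> = w ^ R" using 3 by (simp add: l_def exp_of_nat_mult)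
        finally have "exp (r * norm (l w)) * norm (G w) \<le> w ^ R * (\<bar>D w\<bar> / w)"
          using 3 by (intro mult_mono) (auto simp: G_def H_def norm_divide)
        also have "\<dots> = (\<bar>D w\<bar> * w ^ (R + 1)) / w\<^sup>2" using 3 by (simp add: power2_eq_square field_simps)
        also have "\<dots> \<le> K2 / w\<^sup>2" using K2[of w] 3 by (intro divide_right_mono) auto
        also have "\<dots> \<le> \<bar>K2\<bar> * (2 * inverse (1 + w\<^sup>2))"
        proof -
          have "1 / w\<^sup>2 \<le> 2 * inverse (1 + w\<^sup>2)"
            using 3 one_le_power[of w 2] by (simp add: field_simps add_pos_nonneg)
          then have "\<bar>K2\<bar> * (1 / w\<^sup>2) \<le> \<bar>K2\<bar> * (2 * inverse (1 + w\<^sup>2))" by (rule mult_left_mono) simp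
          moreover have "K2 / w\<^sup>2 \<le> \<bar>K2\<bar> / w\<^sup>2" by (intro divide_right_mono) auto
          ultimately show ?thesis by simp
        qed
        also have "\<dots> \<le> K * inverse (1 + w\<^sup>2)" by (simp add: K_def distrib_right)
        finally show ?thesis by simp
      qed
    qed
    show ?thesis
      by (rule Bochner_Integration.integrable_bound[OF integrable_mult_right[OF integrable_inverse_1_plus_square_UNIV, of K]])
         (measurable, use bound in \<open>auto intro: order_trans[OF _ abs_ge_self]\<close>)
  qed
  define W where "W z = (LINT w|lborel. exp (z * l w) * G w)" for z
  have "W holomorphic_on UNIV"
    unfolding W_def by (rule entire_exp_integral[OF _ _ int]) measurable
  moreover have "(LINT w|lborel. indicator {0<..} w *\<^sub>R (cpow w (z - 1) * of_real (D w)))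
      = W z + (\<Sum>m\<le>n. of_real (b m) / (z + of_nat m))" if z: "Re z > 0" for z
  proof -
    have Wi: "integrable lborel (\<lambda>w. exp (z * l w) * G w)"
    proof (rule Bochner_Integration.integrable_bound[OF int[of "norm z"]])
      have "norm (exp (z * l w)) \<le> exp (norm z * norm (l w))" for w
        by (metis norm_exp norm_mult)
      then show "AE w in lborel. norm (exp (z * l w) * G w) \<le> norm (exp (norm z * norm (l w)) * norm (G w))"
        by (auto simp: norm_mult intro!: mult_right_mono)
    qed auto
    have P: "has_bochner_integral lborel (\<lambda>w. indicator {0<..1} w *\<^sub>R cpow w (y - 1)) (1 / y)" if y: "Re y > 0" for y
    proof -
      have y0: "y \<noteq> 0" using y by auto
      have i: "set_integrable lborel (einterval 0 1) (\<lambda>w. cpow w (y - 1))"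
      proof -
        have "integrable lebesgue (\<lambda>w. indicator {0<..1} w * w powr (Re y - 1))"
        proof -
          have "(\<lambda>w. w powr (Re y - 1)) integrable_on {0<..1}"
            using y by (intro integrable_on_powr_from_0') auto
          then have "(\<lambda>w. w powr (Re y - 1)) absolutely_integrable_on {0<..1}"
            by (intro nonnegative_absolutely_integrable_1) auto
          then show ?thesis by (simp add: set_integrable_def)
        qed
        then have "integrable lborel (\<lambda>w. indicator {0<..1} w * w powr (Re y - 1))"
          by (subst (asm) integrable_completion) auto
        then show ?thesis
          unfolding set_integrable_def
          by (rule Bochner_Integration.integrable_bound)
             (auto simp: indicator_def norm_cpow einterval_iff zero_ereal_def one_ereal_def intro!: AE_I2)
      qed
      have "(LBINT w=0..1. cpow w (y - 1)) = 1 / y - 0"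
      proof (rule interval_integral_FTC_integrable[OF _ _ _ i])
        show "((\<lambda>w. cpow w y / y) has_vector_derivative cpow x (y - 1)) (at x)" if "0 < ereal x" for x
        proof -
          have "x > 0" using that by (simp add: zero_ereal_def)
          from has_vector_derivative_divide[OF cpow_has_vector_derivative[OF this, of y], of y]
          show ?thesis using y0 by simp
        qed
        show "isCont (\<lambda>w. cpow w (y - 1)) x" if "0 < ereal x" for x
        proof -
          have "x > 0" using that by (simp add: zero_ereal_def)
          then show ?thesis
            using has_vector_derivative_continuous[OF cpow_has_vector_derivative] by blast
        qed
        have "((\<lambda>w. w powr Re y) \<longlongrightarrow> 0) (at_right 0)"
          using y by (auto intro!: tendsto_eq_intros tendsto_zero_powrI simp: eventually_at_filter)
        then have "((\<lambda>w. norm (cpow w y)) \<longlongrightarrow> 0) (at_right 0)"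
          by (rule Lim_transform_eventually)
             (use eventually_at_right_less[of "0::real"] in \<open>auto elim!: eventually_mono simp: norm_cpow\<close>)
        from tendsto_divide[OF tendsto_norm_zero_cancel[OF this] tendsto_const y0]
        have "((\<lambda>w. cpow w y / y) \<longlongrightarrow> 0 / y) (at_right 0)" .
        then show "(((\<lambda>w. cpow w y / y) \<circ> real_of_ereal) \<longlongrightarrow> 0) (at_right 0)"
          by (simp add: zero_ereal_def ereal_tendsto_simps)
        have "continuous (at 1) (\<lambda>w. cpow w y)"
          by (rule has_vector_derivative_continuous[OF cpow_has_vector_derivative]) simp
        then have "((\<lambda>w. cpow w y) \<longlongrightarrow> cpow 1 y) (at_left 1)"
          using continuous_at_imp_continuous_at_within continuous_within by blast
        then have "((\<lambda>w. cpow w y / y) \<longlongrightarrow> 1 / y) (at_left 1)"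
          using tendsto_divide[OF _ tendsto_const y0, of _ "cpow 1 y"] by (simp add: cpow_def)
        then show "(((\<lambda>w. cpow w y / y) \<circ> real_of_ereal) \<longlongrightarrow> 1 / y) (at_left 1)"
          by (simp add: one_ereal_def ereal_tendsto_simps)
      qed auto
      then have "has_bochner_integral lborel (\<lambda>w. indicator (einterval 0 1) w *\<^sub>R cpow w (y - 1)) (1 / y)"
        using i by (simp add: has_bochner_integral_iff set_integrable_def interval_lebesgue_integral_def set_lebesgue_integral_def)
      then show ?thesis
      proof (rule has_bochner_integral_cong_AE[THEN iffD1, rotated -1])
        have "AE w in lborel. w \<noteq> (1::real)" by (rule AE_lborel_singleton)
        then show "AE w in lborel. indicator (einterval 0 1) w *\<^sub>R cpow w (y - 1) = indicator {0<..1} w *\<^sub>R cpow w (y - 1)"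
          by eventually_elim (auto simp: indicator_def einterval_iff zero_ereal_def one_ereal_def)
      qed auto
    qed
    have S: "has_bochner_integral lborel (\<lambda>w. \<Sum>m\<le>n. of_real (b m) * (indicator {0<..1} w *\<^sub>R cpow w ((z + of_nat m) - 1)))
        (\<Sum>m\<le>n. of_real (b m) * (1 / (z + of_nat m)))"
      using z by (intro has_bochner_integral_sum has_bochner_integral_mult_right P) auto
    have "indicator {0<..} w *\<^sub>R (cpow w (z - 1) * of_real (D w)) = exp (z * l w) * G w +
      (\<Sum>m\<le>n. of_real (b m) * (indicator {0<..1} w *\<^sub>R cpow w ((z + of_nat m) - 1)))" for w
    proof (cases "w > 0")
      case True
      have e: "exp (z * l w) / of_real w = cpow w (z - 1)"
        using cpow_add[of w z "-1"] cpow_minus[of w 1] cpow_1[OF True] by (simp add: l_def cpow_def[symmetric] divide_inverse)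
      have "(\<Sum>m\<le>n. of_real (b m) * (indicator {0<..1} w *\<^sub>R cpow w ((z + of_nat m) - 1)))
         = cpow w (z - 1) * of_real (indicator {..1} w * Q w)"
      proof -
        have "cpow w ((z + of_nat m) - 1) = cpow w (z - 1) * of_real w ^ m" for m
          using cpow_add[of w "z - 1" "of_nat m"] cpow_of_nat[OF True, of m] by (simp add: algebra_simps)
        then show ?thesis using True
          by (auto simp: Q_def indicator_def sum_distrib_left mult_ac intro!: sum.cong)
      qed
      moreover have "exp (z * l w) * G w = cpow w (z - 1) * of_real (H w)"
        using True unfolding e[symmetric] by (simp add: G_def)
      ultimately show ?thesis using True by (simp add: H_def algebra_simps)
    qed (simp add: G_def indicator_def)
    then show ?thesis
      using S Wi by (simp add: has_bochner_integral_iff W_def)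
  qed
  ultimately show ?thesis by (rule that)
qed

text \<open>The simple pole of \<open>1 / (z + m)\<close> meets a simple zero of \<open>rGamma\<close>. Writing the quotient as
  \<open>pochhammer z m * rGamma (z + m + 1)\<close> shows that it is entire and gives its values at the
  nonpositive integers.\<close>

lemma rGamma_continuation:
  fixes W :: "complex \<Rightarrow> complex" and b :: "nat \<Rightarrow> real"
  assumes W: "W holomorphic_on UNIV"
  obtains B where "B holomorphic_on UNIV"
    "\<And>z. Re z > 0 \<Longrightarrow> B z = rGamma z * (W z + (\<Sum>m\<le>n. of_real (b m) / (z + of_nat m)))"
    "\<And>k. k \<le> n \<Longrightarrow> B (- of_nat k) = of_real ((-1) ^ k * fact k * b k)"
proof -
  define B where "B z = rGamma z * W z + (\<Sum>m\<le>n. of_real (b m) * (pochhammer z m * rGamma (z + of_nat m + 1)))" for z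
  have "(\<lambda>z. pochhammer z m) holomorphic_on UNIV" for m :: nat
    unfolding pochhammer_prod by (intro holomorphic_intros)
  then have "B holomorphic_on UNIV"
    unfolding B_def by (intro holomorphic_intros W)
  moreover have "B z = rGamma z * (W z + (\<Sum>m\<le>n. of_real (b m) / (z + of_nat m)))" if "Re z > 0" for z
  proof -
    have "rGamma z * (of_real (b m) / (z + of_nat m)) = of_real (b m) * (pochhammer z m * rGamma (z + of_nat m + 1))" for m
    proof -
      have "z + of_nat m \<noteq> 0" using that by (auto simp: complex_eq_iff)
      moreover have "rGamma z = pochhammer z m * (z + of_nat m) * rGamma (z + of_nat m + 1)"
        using pochhammer_rGamma[of z "Suc m"] by (simp add: pochhammer_Suc add_ac)
      ultimately show ?thesis by simp
    qed
    then show ?thesis by (simp add: B_def distrib_left sum_distrib_left)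
  qed
  moreover have "B (- of_nat k) = of_real ((-1) ^ k * fact k * b k)" if "k \<le> n" for k
  proof -
    have "pochhammer (- of_nat k :: complex) m * rGamma (- of_nat k + of_nat m + 1) = (if m = k then (-1) ^ k * fact k else 0)" for m
    proof -
      consider "m = k" | "m < k" | "k < m" by linarith
      then show ?thesis
      proof cases
        case 1
        then show ?thesis by (simp add: pochhammer_same[of k])
      next
        case 2
        then have "- of_nat k + of_nat m + 1 = - (of_nat (k - m - 1) :: complex)"
          by (simp add: of_nat_diff)
        then have "rGamma (- of_nat k + of_nat m + 1 :: complex) = 0"
          by (simp only: rGamma_nonpos_Int minus_of_nat_in_nonpos_Ints)
        then show ?thesis using 2 by simp
      next
        case 3
        then show ?thesis using pochhammer_of_nat_eq_0_lemma[of k m, where ?'a = complex] by simp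
      qed
    qed
    then have "(\<Sum>m\<le>n. of_real (b m) * (pochhammer (- of_nat k :: complex) m * rGamma (- of_nat k + of_nat m + 1)))
       = (\<Sum>m\<le>n. if m = k then of_real (b k) * ((-1) ^ k * fact k) else 0)"
      by (intro sum.cong) auto
    also have "\<dots> = of_real (b k) * ((-1) ^ k * fact k)" using that by simp
    finally show ?thesis
      unfolding B_def by (simp add: rGamma_nonpos_Int minus_of_nat_in_nonpos_Ints)
  qed
  ultimately show ?thesis by (rule that)
qed


section \<open>Behaviour of the theta function at infinity and at zero\<close>

lemma theta_large:
  fixes A :: "real \<Rightarrow> real" and c :: real
  assumes e: "e = 0 \<or> e = 1"
    and A [measurable]: "A \<in> borel_measurable borel" and A01: "\<And>x. 0 \<le> A x \<and> A x \<le> 1" and A0: "\<And>x. x < c \<Longrightarrow> A x = 0"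
    and c: "c > 0"
  shows "\<exists>K. \<forall>w\<ge>1. \<bar>LINT x|lborel. A x * theta_kernel e w x\<bar> * w ^ M \<le> K"
proof -
  define B where "B = 1 + 1 / c"
  define B2 where "B2 = 1 + 1 / c\<^sup>2"
  define n where "n = Suc M"
  define K where "K = (fact n + 2 * B * fact (Suc n)) * B2 ^ n"
  have B: "B \<ge> 0" "B2 \<ge> 0" using c by (auto simp: B_def B2_def)
  have ex: "y ^ k * exp (- y) \<le> fact k" if "y \<ge> 0" for y :: real and k
  proof -
    have "y ^ k / fact k \<le> exp y"
      using sum_le_suminf[of "\<lambda>n. y ^ n / fact n" "{k}"] exp_converges[of y] that
      by (auto simp: sums_iff field_simps)
    then show ?thesis by (simp add: exp_minus field_simps)
  qed
  have bound: "norm (complex_of_real (A x * theta_kernel e w x)) \<le> (K / w ^ n) * inverse (1 + x\<^sup>2)" if w: "w \<ge> 1" for w x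
  proof (cases "c \<le> x")
    case False
    have "K \<ge> 0" using B by (simp add: K_def)
    then show ?thesis using False A0[of x] w by simp
  next
    case True
    define y where "y = w * x\<^sup>2"
    have x: "x > 0" using True c by simp
    have y: "y > 0" using x w by (simp add: y_def)
    have xB: "x ^ (2 - e) \<le> B * x\<^sup>2"
    proof -
      have "x * 1 \<le> x * (x / c)" using True c x by (intro mult_left_mono) auto
      then have "x \<le> x\<^sup>2 / c" by (simp add: power2_eq_square)
      moreover have "B * x\<^sup>2 = x\<^sup>2 + x\<^sup>2 / c" by (simp add: B_def algebra_simps)
      moreover have "0 \<le> x\<^sup>2" "0 \<le> x\<^sup>2 / c" using c by simp_all
      ultimately have "x \<le> B * x\<^sup>2" "x\<^sup>2 \<le> B * x\<^sup>2" by linarith+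
      then show ?thesis using e by auto
    qed
    have "\<bar>theta_kernel e w x\<bar> \<le> (1 + 2 * w * x ^ (2 - e)) * exp (- y)"
      unfolding theta_kernel_def abs_mult y_def using x w
      by (intro mult_mono order_trans[OF abs_triangle_ineq4] add_mono) auto
    also have "\<dots> \<le> (1 + 2 * B * y) * exp (- y)"
    proof (intro mult_right_mono add_left_mono)
      have "w * x ^ (2 - e) \<le> w * (B * x\<^sup>2)" using w by (intro mult_left_mono xB) auto
      then show "2 * w * x ^ (2 - e) \<le> 2 * B * y" by (simp add: y_def mult_ac)
    qed simp
    finally have "y ^ n * \<bar>theta_kernel e w x\<bar> \<le> y ^ n * ((1 + 2 * B * y) * exp (- y))"
      using y by (intro mult_left_mono) auto
    also have "\<dots> = y ^ n * exp (- y) + 2 * B * (y ^ Suc n * exp (- y))" by (simp add: algebra_simps)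
    also have "\<dots> \<le> fact n + 2 * B * fact (Suc n)"
      using y B by (intro add_mono mult_left_mono ex) auto
    finally have "\<bar>theta_kernel e w x\<bar> \<le> (fact n + 2 * B * fact (Suc n)) / y ^ n"
      using y by (simp add: field_simps)
    also have "\<dots> = (fact n + 2 * B * fact (Suc n)) / w ^ n * (1 / x\<^sup>2) ^ n"
      by (simp add: y_def power_mult_distrib power_divide)
    also have "\<dots> \<le> (fact n + 2 * B * fact (Suc n)) / w ^ n * (B2 ^ n * inverse (1 + x\<^sup>2))"
    proof (intro mult_left_mono)
      have "1 + x\<^sup>2 \<le> B2 * x\<^sup>2"
      proof -
        have "c\<^sup>2 \<le> x\<^sup>2" using True c by (intro power_mono) auto
        then have "1 \<le> x\<^sup>2 / c\<^sup>2" using c by simp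
        then show ?thesis by (simp add: B2_def algebra_simps)
      qed
      then have "1 / x\<^sup>2 \<le> B2 * inverse (1 + x\<^sup>2)"
        using x by (simp add: field_simps add_pos_pos)
      then have "(1 / x\<^sup>2) ^ n \<le> (B2 * inverse (1 + x\<^sup>2)) ^ n"
        by (intro power_mono) auto
      also have "\<dots> = B2 ^ n * inverse (1 + x\<^sup>2) ^ n" by (rule power_mult_distrib)
      also have "\<dots> \<le> B2 ^ n * inverse (1 + x\<^sup>2) ^ 1"
        using B by (intro mult_left_mono power_decreasing) (auto simp: n_def intro!: le_imp_inverse_le[of 1, simplified])
      finally show "(1 / x\<^sup>2) ^ n \<le> B2 ^ n * inverse (1 + x\<^sup>2)" by simp
    qed (use w B in simp)
    also have "\<dots> = (K / w ^ n) * inverse (1 + x\<^sup>2)" by (simp add: K_def)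
    finally have "\<bar>theta_kernel e w x\<bar> \<le> (K / w ^ n) * inverse (1 + x\<^sup>2)" .
    moreover have "\<bar>A x * theta_kernel e w x\<bar> \<le> \<bar>theta_kernel e w x\<bar>"
      using A01[of x] by (simp add: abs_mult mult_left_le_one_le)
    ultimately show ?thesis by (simp only: norm_of_real)
  qed
  show ?thesis
  proof (intro exI[of _ "K * pi"] allI impI)
    fix w :: real assume w: "w \<ge> 1"
    have "\<bar>LINT x|lborel. A x * theta_kernel e w x\<bar> = norm (LINT x|lborel. complex_of_real (A x * theta_kernel e w x))"
      by (simp only: integral_complex_of_real norm_of_real)
    also have "\<dots> \<le> (LINT x|lborel. norm (complex_of_real (A x * theta_kernel e w x)))"
      by (rule integral_norm_bound)
    also have "\<dots> \<le> (K / w ^ n) * pi"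
      by (rule integral_norm_bound_inverse_square[OF _ bound[OF w]]) measurable
    finally have "\<bar>LINT x|lborel. A x * theta_kernel e w x\<bar> * w ^ n \<le> K * pi"
      using w by (simp add: field_simps)
    moreover have "w ^ M \<le> w ^ n" using w by (intro power_increasing) (auto simp: n_def)
    ultimately show "\<bar>LINT x|lborel. A x * theta_kernel e w x\<bar> * w ^ M \<le> K * pi"
      by (meson abs_ge_zero mult_left_mono order_trans)
  qed
qed

lemma integral_even:
  fixes f :: "real \<Rightarrow> real"
  assumes "integrable lborel f" "\<And>x. f (- x) = f x"
  shows "(LINT x|lborel. f x) = 2 * (LINT x|lborel. indicator {0<..} x * f x)"
proof -
  have i: "integrable lborel (\<lambda>x. indicator {0<..} x * f x)" "integrable lborel (\<lambda>x. indicator {..<0} x * f x)"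
    using integrable_mult_indicator[OF _ assms(1), of "{0<..}"] integrable_mult_indicator[OF _ assms(1), of "{..<0}"]
    by simp_all
  have "(LINT x|lborel. indicator {..<0} x * f x) = (LINT x|lborel. indicator {..<0} (0 + - 1 * x) * f (0 + - 1 * x))"
    by (subst lborel_integral_real_affine[of "-1" _ 0]) auto
  also have "\<dots> = (LINT x|lborel. indicator {0<..} x * f x)"
    by (intro Bochner_Integration.integral_cong) (auto simp: indicator_def assms(2))
  finally have eq: "(LINT x|lborel. indicator {..<0} x * f x) = (LINT x|lborel. indicator {0<..} x * f x)" .
  have "(LINT x|lborel. f x) = (LINT x|lborel. indicator {0<..} x * f x + indicator {..<0} x * f x)"
  proof (rule integral_cong_AE)
    show "f \<in> borel_measurable lborel" using assms(1) by auto
    have "AE x in lborel. x \<noteq> (0::real)" by (rule AE_lborel_singleton)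
    then show "AE x in lborel. f x = indicator {0<..} x * f x + indicator {..<0} x * f x"
      by eventually_elim (auto simp: indicator_def)
  qed (use i in auto)
  then show ?thesis using Bochner_Integration.integral_add[OF i] eq by simp
qed

text \<open>This is why \<open>t ^ (2 - e)\<close> times the Gaussian is the right density to test the signature with; \<open>u\<close> is
  the width, and \<open>w = u\<^sup>2 / 2\<close> the parameter of the theta function.\<close>

lemma theta_kernel_fourier:
  assumes e: "e = 0 \<or> e = 1" and u: "u > 0"
  shows "fourier (\<lambda>t. complex_of_real (gaussian_poly (monom 1 (2 - e)) t)) (u * x) =
    (\<i> / of_real u) ^ e * complex_of_real (theta_kernel e (u\<^sup>2 / 2) x)"
proof (cases "e = 0")
  case True
  have "monom 1 (2 - e) = [:0, 0, 1:: real:]" using True by (simp add: monom_altdef numeral_2_eq_2)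
  then show ?thesis
    using True by (simp add: fourier_gaussian_2 theta_kernel_def power_mult_distrib exp_of_real[symmetric])
next
  case False
  then have e1: "e = 1" using e by simp
  have "monom 1 (2 - e) = [:0, 1:: real:]" using e1 by (simp add: monom_altdef)
  then show ?thesis
    using e1 u by (simp add: fourier_gaussian_1 theta_kernel_def power_mult_distrib exp_of_real[symmetric] power2_eq_square mult_ac)
qed

lemma theta_kernel_bound:
  assumes e: "e = 0 \<or> e = 1" and w: "w > 0"
  shows "\<exists>C. \<forall>x. \<bar>theta_kernel e w x\<bar> \<le> C * inverse (1 + x\<^sup>2)"
proof -
  define u where "u = sqrt (2 * w)"
  have u: "u > 0" "u\<^sup>2 = 2 * w" using w by (auto simp: u_def)
  obtain C where C: "\<And>x. norm (fourier (\<lambda>t. complex_of_real (gaussian_poly (monom 1 (2 - e)) t)) x) \<le> C * inverse (1 + x\<^sup>2)"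
    using gaussian_poly_fourier_decay by blast
  have C0: "C \<ge> 0" using order_trans[OF norm_ge_zero C[of 0]] by simp
  show ?thesis
  proof (intro exI[of _ "u ^ e * (C * (1 + 1 / u\<^sup>2))"] allI)
    fix x
    have "norm (fourier (\<lambda>t. complex_of_real (gaussian_poly (monom 1 (2 - e)) t)) (u * x)) = \<bar>theta_kernel e w x\<bar> / u ^ e"
      unfolding theta_kernel_fourier[OF e u(1)] using u by (simp add: norm_mult norm_power norm_divide power_divide)
    then have "\<bar>theta_kernel e w x\<bar> / u ^ e \<le> C * inverse (1 + (u * x)\<^sup>2)"
      using C[of "u * x"] by simp
    then have "\<bar>theta_kernel e w x\<bar> \<le> u ^ e * (C * inverse (1 + (u * x)\<^sup>2))"
      using u(1) by (simp add: pos_divide_le_eq mult.commute)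
    also have "\<dots> \<le> u ^ e * (C * ((1 + 1 / u\<^sup>2) * inverse (1 + x\<^sup>2)))"
    proof (intro mult_left_mono C0)
      have "1 + x\<^sup>2 \<le> (1 + 1 / u\<^sup>2) * (1 + (u * x)\<^sup>2)"
        using u(1) by (simp add: algebra_simps power_mult_distrib)
      then show "inverse (1 + (u * x)\<^sup>2) \<le> (1 + 1 / u\<^sup>2) * inverse (1 + x\<^sup>2)"
        by (simp add: divide_inverse[symmetric] divide_le_eq pos_le_divide_eq add_pos_nonneg inverse_eq_divide mult.commute)
    qed (use u in auto)
    finally show "\<bar>theta_kernel e w x\<bar> \<le> u ^ e * (C * (1 + 1 / u\<^sup>2)) * inverse (1 + x\<^sup>2)" by (simp add: mult_ac)
  qed
qed

lemma integrable_bounded_mult_theta_kernel: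
  assumes e: "e = 0 \<or> e = 1" and w: "w > 0"
    and f: "f \<in> borel_measurable borel" "\<And>x. \<bar>f x\<bar> \<le> 1"
  shows "integrable lborel (\<lambda>x. f x * theta_kernel e w x)"
proof -
  note [measurable] = f(1)
  obtain C where C: "\<And>x. \<bar>theta_kernel e w x\<bar> \<le> C * inverse (1 + x\<^sup>2)"
    using theta_kernel_bound[OF e w] by blast
  show ?thesis
  proof (rule Bochner_Integration.integrable_bound[OF integrable_mult_right[OF integrable_inverse_1_plus_square_UNIV, of C]])
    show "AE x in lborel. norm (f x * theta_kernel e w x) \<le> norm (C * inverse (1 + x\<^sup>2))"
    proof (intro AE_I2)
      fix x
      have "\<bar>f x * theta_kernel e w x\<bar> \<le> 1 * \<bar>theta_kernel e w x\<bar>"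
        unfolding abs_mult by (intro mult_right_mono f) auto
      then show "norm (f x * theta_kernel e w x) \<le> norm (C * inverse (1 + x\<^sup>2))"
        using C[of x] by simp
    qed
  qed measurable
qed

lemma theta_kernel_integral:
  assumes e: "e = 0 \<or> e = 1" and w: "w > 0"
  shows "(LINT x|lborel. indicator {0<..} x * theta_kernel e w x) = - real e"
proof -
  let ?F = "\<lambda>x. x ^ (1 - e) * exp (- (w * x\<^sup>2))"
  have "(LBINT x=0..\<infinity>. theta_kernel e w x) = 0 - real e"
  proof (rule interval_integral_FTC_integrable)
    show "(?F has_vector_derivative theta_kernel e w x) (at x)" for x
      using theta_kernel_deriv[OF e] by (simp add: has_real_derivative_iff_has_vector_derivative)
    show "isCont (theta_kernel e w) x" for x
      unfolding theta_kernel_def[abs_def] by (intro continuous_intros)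
    show "set_integrable lborel (einterval 0 \<infinity>) (theta_kernel e w)"
      using integrable_bounded_mult_theta_kernel[OF e w, of "indicator (einterval 0 \<infinity>)"]
      by (simp add: set_integrable_def)
    have "isCont ?F 0" by (intro continuous_intros)
    then have "(?F \<longlongrightarrow> ?F 0) (at_right 0)"
      using continuous_at_imp_continuous_at_within continuous_within by blast
    moreover have "?F 0 = real e" using e by auto
    ultimately show "((?F \<circ> real_of_ereal) \<longlongrightarrow> real e) (at_right 0)"
      by (simp add: zero_ereal_def ereal_tendsto_simps)
    have "(?F \<longlongrightarrow> 0) at_top"
      using e
    proof
      assume "e = 0"
      moreover have "((\<lambda>x. x * exp (- (w * x\<^sup>2))) \<longlongrightarrow> 0) at_top" using w by real_asymp
      ultimately show ?thesis by simp
    next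
      assume "e = 1"
      moreover have "((\<lambda>x. exp (- (w * x\<^sup>2))) \<longlongrightarrow> 0) at_top" using w by real_asymp
      ultimately show ?thesis by simp
    qed
    then show "((?F \<circ> real_of_ereal) \<longlongrightarrow> 0) (at_left \<infinity>)"
      by (simp add: ereal_tendsto_simps)
  qed auto
  moreover have "einterval 0 \<infinity> = {0::real<..}" by (auto simp: einterval_iff zero_ereal_def)
  ultimately show ?thesis
    by (simp add: interval_lebesgue_integral_def set_lebesgue_integral_def zero_ereal_def)
qed

text \<open>The signature is \<open>1 - 2 * A\<close> on the positive axis, and the constant \<open>1\<close> integrates to minus the boundary
  value of \<open>x ^ (1 - e)\<close> at the origin. For even dimension this boundary term becomes the
  constant term \<open>1/2\<close> of the expansion of the theta function, and in the end the monomial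
  \<open>par d / 2\<close> of \<open>R_poly\<close>.\<close>

lemma theta_signature:
  fixes \<sigma> A :: "real \<Rightarrow> real"
  assumes e: "e = 0 \<or> e = 1" and w: "w > 0" and c: "c > 0"
    and A [measurable]: "A \<in> borel_measurable borel" and A01: "\<And>x. 0 \<le> A x \<and> A x \<le> 1" and A0: "\<And>x. x < c \<Longrightarrow> A x = 0"
    and \<sigma> [measurable]: "\<sigma> \<in> borel_measurable borel" and \<sigma>1: "\<And>x. \<bar>\<sigma> x\<bar> \<le> 1"
    and parity: "\<And>x. \<sigma> (- x) = (- 1) ^ e * \<sigma> x" and \<sigma>A: "\<And>x. x > 0 \<Longrightarrow> \<sigma> x = 1 - 2 * A x"
  shows "(LINT x|lborel. \<sigma> x * theta_kernel e w x) = - 2 * real e - 4 * (LINT x|lborel. A x * theta_kernel e w x)"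
proof -
  have i1: "integrable lborel (\<lambda>x. indicator {0<..} x * theta_kernel e w x)"
    by (rule integrable_bounded_mult_theta_kernel[OF e w]) auto
  have i2: "integrable lborel (\<lambda>x. A x * theta_kernel e w x)"
    by (rule integrable_bounded_mult_theta_kernel[OF e w]) (use A01 in auto)
  have "(LINT x|lborel. \<sigma> x * theta_kernel e w x) = 2 * (LINT x|lborel. indicator {0<..} x * (\<sigma> x * theta_kernel e w x))"
  proof (rule integral_even)
    show "integrable lborel (\<lambda>x. \<sigma> x * theta_kernel e w x)"
      by (rule integrable_bounded_mult_theta_kernel[OF e w \<sigma> \<sigma>1])
    show "\<sigma> (- x) * theta_kernel e w (- x) = \<sigma> x * theta_kernel e w x" for x
      using e by (auto simp: parity theta_kernel_def)
  qed
  also have "(\<lambda>x. indicator {0<..} x * (\<sigma> x * theta_kernel e w x)) =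
      (\<lambda>x. indicator {0<..} x * theta_kernel e w x - 2 * (A x * theta_kernel e w x))"
    using A0 c by (auto simp: fun_eq_iff indicator_def \<sigma>A algebra_simps)
  also have "(LINT x|lborel. indicator {0<..} x * theta_kernel e w x - 2 * (A x * theta_kernel e w x))
      = - real e - 2 * (LINT x|lborel. A x * theta_kernel e w x)"
    using Bochner_Integration.integral_diff[OF i1 integrable_mult_right[OF i2, of 2]] theta_kernel_integral[OF e w]
    by simp
  finally show ?thesis by simp
qed


lemma gaussian_moment:
  assumes e: "e = 0 \<or> e = 1" and u: "u > 0"
  shows "has_bochner_integral lborel
    (\<lambda>t. complex_of_real (t ^ (2 * n + e)) * (complex_of_real (gaussian_poly (monom 1 (2 - e)) (t / u)) / of_real u))
    (complex_of_real (u ^ (2 * n + e) * (fact (2 * (n + 1)) / (2 ^ (n + 1) * fact (n + 1)))))"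
    (is "has_bochner_integral lborel ?f _")
proof -
  let ?\<mu> = "fact (2 * (n + 1)) / (2 ^ (n + 1) * fact (n + 1)) :: real"
  have "has_bochner_integral lborel (\<lambda>y. (u ^ (2 * n + e) / u) * (std_normal_density y * y ^ (2 * (n + 1))))
     ((u ^ (2 * n + e) / u) * ?\<mu>)"
    by (rule has_bochner_integral_mult_right[OF std_normal_moment_even])
  then have 1: "has_bochner_integral lborel
     (\<lambda>y. complex_of_real ((u ^ (2 * n + e) / u) * (std_normal_density y * y ^ (2 * (n + 1)))))
     (complex_of_real ((u ^ (2 * n + e) / u) * ?\<mu>))"
    by (rule has_bochner_integral_of_real)
  have 2: "complex_of_real ((u ^ (2 * n + e) / u) * (std_normal_density y * y ^ (2 * (n + 1)))) = ?f (0 + u * y)" for y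
  proof -
    have "2 * n + e + (2 - e) = 2 * (n + 1)" using e by auto
    then have "y ^ (2 * n + e) * y ^ (2 - e) = y ^ (2 * (n + 1))"
      by (simp only: power_add[symmetric])
    then have "(u ^ (2 * n + e) / u) * (std_normal_density y * y ^ (2 * (n + 1))) =
       (u * y) ^ (2 * n + e) * (y ^ (2 - e) * std_normal_density y / u)"
      by (simp only: power_mult_distrib) (simp add: mult_ac)
    also have "y ^ (2 - e) * std_normal_density y = gaussian_poly (monom 1 (2 - e)) (u * y / u)"
      using u by (simp add: gaussian_poly_def poly_monom)
    finally show ?thesis by (simp only: of_real_mult of_real_divide add_0)
  qed
  have 3: "complex_of_real ((a / u) * b) = complex_of_real (a * b) /\<^sub>R \<bar>u\<bar>" for a b
    using u by (simp add: scaleR_conv_of_real divide_inverse mult_ac)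
  have "u \<noteq> 0" using u by simp
  from lborel_has_bochner_integral_real_affine_iff[OF this, of ?f _ 0] show ?thesis
    using 1[unfolded 2, unfolded 3] by (rule iffD2)
qed

text \<open>The expansion of the theta function at zero. The quotient of factorials is the Gaussian moment of
  \<open>t ^ (2 * (n + 1))\<close> for \<open>n = m - e\<close>; the power \<open>2 ^ m\<close> comes from \<open>u\<^sup>2 = 2 * w\<close>.\<close>

definition theta_coeff :: "nat \<Rightarrow> (nat \<Rightarrow> real) \<Rightarrow> nat \<Rightarrow> real" where
  "theta_coeff e p m = (if m < e then 1 / 2 else
     2 ^ e / 8 * (- 1) ^ e * p (m - e) * (fact (2 * (m - e + 1)) / (2 ^ (m - e + 1) * fact (m - e + 1))) * 2 ^ m)"

lemma theta_coeff_sum: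
  assumes e: "e = 0 \<or> e = 1"
  shows "(\<Sum>m\<le>N + e. theta_coeff e p m * w ^ m) = real e / 2 + 2 ^ e / 8 * (- 1) ^ e *
     (\<Sum>n\<le>N. p n * (fact (2 * (n + 1)) / (2 ^ (n + 1) * fact (n + 1))) * (2 * w) ^ (n + e))"
proof -
  have "(\<Sum>m\<le>N + e. (if m < e then 1 / 2 else c * p (m - e) * \<mu> (m - e) * 2 ^ m) * w ^ m)
     = real e / 2 + c * (\<Sum>n\<le>N. p n * \<mu> n * (2 * w) ^ (n + e))" for c and \<mu> :: "nat \<Rightarrow> real"
    using e
  proof
    assume "e = 0"
    then show ?thesis by (simp add: sum_distrib_left power_mult_distrib mult_ac)
  next
    assume e: "e = 1"
    then show ?thesis
      by (simp only: add_Suc_right add_0_right One_nat_def sum.atMost_Suc_shift)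
         (simp add: sum_distrib_left power_mult_distrib mult_ac)
  qed
  from this[of "2 ^ e / 8 * (- 1) ^ e" "\<lambda>n. fact (2 * (n + 1)) / (2 ^ (n + 1) * fact (n + 1))"]
  show ?thesis unfolding theta_coeff_def .
qed

text \<open>Hypothesis \<open>T\<close> evaluates the integral in \<open>theta_signature\<close> up to every power of \<open>w\<close>, by
  \<open>signature_gaussian_asymptotics\<close> for the density of \<open>theta_kernel_fourier\<close>.\<close>

lemma theta_small:
  fixes \<sigma> A :: "real \<Rightarrow> real" and p :: "nat \<Rightarrow> real"
  assumes e: "e = 0 \<or> e = 1" and c: "c > 0"
    and A [measurable]: "A \<in> borel_measurable borel" and A01: "\<And>x. 0 \<le> A x \<and> A x \<le> 1" and A0: "\<And>x. x < c \<Longrightarrow> A x = 0"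
    and \<sigma> [measurable]: "\<sigma> \<in> borel_measurable borel" and \<sigma>1: "\<And>x. \<bar>\<sigma> x\<bar> \<le> 1"
    and parity: "\<And>x. \<sigma> (- x) = (- 1) ^ e * \<sigma> x" and \<sigma>A: "\<And>x. x > 0 \<Longrightarrow> \<sigma> x = 1 - 2 * A x"
    and T: "\<And>\<psi>. \<psi> \<in> test_functions {-1<..<1} \<Longrightarrow>
      2 ^ (1 - e) * \<i> ^ e * (LINT x|lborel. complex_of_real (\<sigma> x) * fourier \<psi> x)
        = (LINT t|lborel. complex_of_real (poly (\<Sum>n\<le>N. monom (p n) (2 * n + e)) t) * \<psi> t)"
  shows "\<exists>K. \<forall>w. 0 < w \<longrightarrow> w \<le> 1 \<longrightarrow>
    \<bar>- (LINT x|lborel. A x * theta_kernel e w x) - (\<Sum>m\<le>N + e. theta_coeff e p m * w ^ m)\<bar> \<le> K * w ^ M"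
proof -
  let ?\<mu> = "\<lambda>n. fact (2 * (n + 1)) / (2 ^ (n + 1) * fact (n + 1)) :: real"
  let ?P = "\<Sum>n\<le>N. monom (p n) (2 * n + e)"
  let ?q = "monom 1 (2 - e) :: real poly"
  obtain K where K: "\<And>u. 0 < u \<Longrightarrow> u \<le> 2 \<Longrightarrow>
    norm (2 ^ (1 - e) * \<i> ^ e * (LINT x|lborel. complex_of_real (\<sigma> x) * fourier (\<lambda>t. complex_of_real (gaussian_poly ?q t)) (u * x))
      - (LINT t|lborel. complex_of_real (poly ?P t) * (complex_of_real (gaussian_poly ?q (t / u)) / of_real u))) \<le> K * u ^ (2 * M)"
    using signature_gaussian_asymptotics[OF \<sigma> \<sigma>1 T, of ?q "2 * M"] by blast
  show ?thesis
  proof (intro exI[of _ "K * 2 ^ M"] allI impI)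
    fix w :: real assume w: "0 < w" "w \<le> 1"
    define u where "u = sqrt (2 * w)"
    define D where "D = - (LINT x|lborel. A x * theta_kernel e w x)"
    define Z where "Z = (\<Sum>n\<le>N. p n * ?\<mu> n * u ^ (2 * n + e))"
    \<comment> \<open>\<open>\<rho>\<close> collects the constant in \<open>T\<close> and the factor in \<open>theta_kernel_fourier\<close>; it is real
      because \<open>\<i> ^ e\<close> occurs twice.\<close>
    define \<rho> where "\<rho> = 2 ^ (1 - e) * (- 1) ^ e / u ^ e"
    have u: "u > 0" "u\<^sup>2 = 2 * w" "u \<le> 2" "u\<^sup>2 / 2 = w"
      using w by (auto simp: u_def real_le_lsqrt)
    have ts: "(LINT x|lborel. \<sigma> x * theta_kernel e w x) = - 2 * real e + 4 * D"
      using theta_signature[OF e w(1) c A A01 A0 \<sigma> \<sigma>1 parity \<sigma>A] by (simp add: D_def)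
    have "(LINT x|lborel. complex_of_real (\<sigma> x) * fourier (\<lambda>t. complex_of_real (gaussian_poly ?q t)) (u * x))
       = (LINT x|lborel. (\<i> / of_real u) ^ e * complex_of_real (\<sigma> x * theta_kernel e w x))"
      unfolding theta_kernel_fourier[OF e u(1)] u(4) by (intro Bochner_Integration.integral_cong) (auto simp: mult_ac)
    also have "\<dots> = (\<i> / of_real u) ^ e * complex_of_real (- 2 * real e + 4 * D)"
      by (simp only: integral_mult_right_zero integral_complex_of_real ts)
    finally have 1: "2 ^ (1 - e) * \<i> ^ e * (LINT x|lborel. complex_of_real (\<sigma> x) * fourier (\<lambda>t. complex_of_real (gaussian_poly ?q t)) (u * x))
       = complex_of_real (\<rho> * (- 2 * real e + 4 * D))"
      using e by (auto simp: \<rho>_def)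
    have "has_bochner_integral lborel
      (\<lambda>t. \<Sum>n\<le>N. complex_of_real (p n) * (complex_of_real (t ^ (2 * n + e)) * (complex_of_real (gaussian_poly ?q (t / u)) / of_real u)))
      (\<Sum>n\<le>N. complex_of_real (p n) * complex_of_real (u ^ (2 * n + e) * ?\<mu> n))"
      by (intro has_bochner_integral_sum has_bochner_integral_mult_right gaussian_moment e u)
    then have m1: "(LINT t|lborel. (\<Sum>n\<le>N. complex_of_real (p n) * (complex_of_real (t ^ (2 * n + e)) * (complex_of_real (gaussian_poly ?q (t / u)) / of_real u))))
      = (\<Sum>n\<le>N. complex_of_real (p n) * complex_of_real (u ^ (2 * n + e) * ?\<mu> n))"
      by (rule has_bochner_integral_integral_eq)
    have m2: "(\<Sum>n\<le>N. complex_of_real (p n) * complex_of_real (u ^ (2 * n + e) * ?\<mu> n)) = of_real Z"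
      unfolding Z_def of_real_sum by (intro sum.cong) (simp_all add: mult_ac)
    have m3: "(\<Sum>n\<le>N. complex_of_real (p n) * (complex_of_real (t ^ (2 * n + e)) * (complex_of_real (gaussian_poly ?q (t / u)) / of_real u)))
      = complex_of_real (poly ?P t) * (complex_of_real (gaussian_poly ?q (t / u)) / of_real u)" for t
      by (simp only: poly_sum poly_monom of_real_sum of_real_mult of_real_power sum_distrib_right mult.assoc)
    have 2: "(LINT t|lborel. complex_of_real (poly ?P t) * (complex_of_real (gaussian_poly ?q (t / u)) / of_real u)) = of_real Z"
      using m1 unfolding m2 m3 .
    have "\<bar>\<rho> * (- 2 * real e + 4 * D) - Z\<bar> \<le> K * u ^ (2 * M)"
      using K[OF u(1,3)] unfolding 1 2 by (simp only: of_real_diff[symmetric] norm_of_real)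
    also have "u ^ (2 * M) = (2 * w) ^ M" by (simp add: power_mult u)
    finally have main: "\<bar>\<rho> * (- 2 * real e + 4 * D) - Z\<bar> \<le> K * (2 * w) ^ M" .
    have \<rho>: "\<rho> \<noteq> 0" "\<bar>1 / (4 * \<rho>)\<bar> \<le> 1" using e u by (auto simp: \<rho>_def)
    have "D - (\<Sum>m\<le>N + e. theta_coeff e p m * w ^ m) = 1 / (4 * \<rho>) * (\<rho> * (- 2 * real e + 4 * D) - Z)"
    proof -
      have "2 ^ e / 8 * (- 1) ^ e * (p n * ?\<mu> n * (2 * w) ^ (n + e)) = 1 / (4 * \<rho>) * (p n * ?\<mu> n * u ^ (2 * n + e))" for n
      proof -
        have "2 * n + e + e = 2 * (n + e)" by simp
        then have "u ^ (2 * n + e) * u ^ e = (2 * w) ^ (n + e)"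
          unfolding power_add[symmetric] by (simp only: power_mult u(2))
        moreover have "1 / (4 * \<rho>) = 2 ^ e / 8 * (- 1) ^ e * u ^ e" using e u by (auto simp: \<rho>_def)
        moreover have "a * (q * X) = v * (q * Y)" if "Y * U = X" "v = a * U" for a q v X Y U :: real
          using that by (simp add: mult_ac)
        ultimately show ?thesis by blast
      qed
      then have E: "2 ^ e / 8 * (- 1) ^ e * (\<Sum>n\<le>N. p n * ?\<mu> n * (2 * w) ^ (n + e)) = 1 / (4 * \<rho>) * Z"
        unfolding Z_def sum_distrib_left by (intro sum.cong) auto
      then show ?thesis
        unfolding theta_coeff_sum[OF e] E using \<rho>(1) by (simp add: field_simps)
    qed
    then have "\<bar>D - (\<Sum>m\<le>N + e. theta_coeff e p m * w ^ m)\<bar> = \<bar>1 / (4 * \<rho>)\<bar> * \<bar>\<rho> * (- 2 * real e + 4 * D) - Z\<bar>"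
      by (simp only: abs_mult)
    also have "\<dots> \<le> 1 * \<bar>\<rho> * (- 2 * real e + 4 * D) - Z\<bar>"
      by (intro mult_right_mono \<rho>) auto
    also have "\<dots> \<le> K * 2 ^ M * w ^ M" using main by (simp add: power_mult_distrib)
    finally show "\<bar>- (LINT x|lborel. A x * theta_kernel e w x) - (\<Sum>m\<le>N + e. theta_coeff e p m * w ^ m)\<bar> \<le> K * 2 ^ M * w ^ M"
      unfolding D_def .
  qed
qed

lemma par_cases: "par d = 0 \<or> par d = 1"
  by (simp add: par_def)

text \<open>For \<open>d = 0\<close> the truncated subtractions in \<open>NN\<close> would break this.\<close>

lemma dim_eq:
  assumes "d \<ge> 1"
  shows "d = 2 * NN d + 1 + par d"
proof (cases "odd d")
  case True
  then obtain k where "d = 2 * k + 1" by (rule oddE)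
  then show ?thesis by (simp add: NN_def par_def)
next
  case False
  then have "even d" by simp
  then obtain k where k: "d = 2 * k" by (rule evenE)
  then obtain l where "k = Suc l" using assms by (cases k) auto
  then show ?thesis using k by (simp add: NN_def par_def)
qed

text \<open>The Gaussian moments and \<open>k!\<close> combine to the factorials in \<open>R_poly\<close>, since
  \<open>2\<^sup>n n! (2n + 1)!! = (2n + 1)!\<close> and \<open>2\<^sup>n\<^sup>+\<^sup>1 (n + 1)! (2n + 1)!! = (2n + 2)!\<close>.\<close>

lemma r_coeff_theta_coeff:
  assumes d: "d \<ge> 1" and k: "k \<le> NN d + par d"
  shows "r_coeff d p (NN d + par d - k) = (-1) ^ k * fact k * theta_coeff (par d) p k"
proof -
  define e where "e = par d"
  have e: "e = 0 \<or> e = 1" unfolding e_def by (rule par_cases)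
  have pw: "(2::real) powi (int e - 3) = 2 ^ e / 8"
    using e by (auto simp: power_int_def power_divide)
  have r: "r_coeff d p j = (if NN d + e = j then real e / 2 else 0) +
      2 ^ e / 8 * (\<Sum>n\<le>NN d. if NN d - n = j then (-1) ^ n * fact (2 * n + e + 1) * p n else 0)" for j
    unfolding r_coeff_def R_poly_def e_def[symmetric] pw
    by (simp add: coeff_sum del: fact_Suc cong: if_cong)
  show ?thesis
  proof (cases "k < e")
    case True
    then have "e = 1" "k = 0" using e by auto
    then have "(\<Sum>n\<le>NN d. if NN d - n = NN d + e - k then (-1) ^ n * fact (2 * n + e + 1) * p n else 0) = 0"
      by (intro sum.neutral) auto
    then show ?thesis using \<open>e = 1\<close> \<open>k = 0\<close> unfolding e_def[symmetric] r
      by (simp add: theta_coeff_def)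
  next
    case False
    define n where "n = k - e"
    have n: "k = n + e" "n \<le> NN d" using False k by (auto simp: n_def e_def)
    have "(\<Sum>i\<le>NN d. if NN d - i = NN d + e - k then (-1) ^ i * fact (2 * i + e + 1) * p i else 0)
       = (\<Sum>i\<le>NN d. if i = n then (-1) ^ n * fact (2 * n + e + 1) * p n else 0)"
      using n by (intro sum.cong) auto
    then have "r_coeff d p (NN d + e - k) = (if NN d + e = NN d + e - k then real e / 2 else 0) + 2 ^ e / 8 * ((-1) ^ n * fact (2 * n + e + 1) * p n)"
      unfolding r using n by simp
    also have "(if NN d + e = NN d + e - k then real e / 2 else 0) = 0"
      using e n by auto
    also have "0 + 2 ^ e / 8 * ((-1) ^ n * fact (2 * n + e + 1) * p n) = (-1) ^ k * fact k * theta_coeff e p k"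
    proof -
      define \<mu> :: real where "\<mu> = fact (2 * (n + 1)) / (2 ^ (n + 1) * fact (n + 1))"
      define F :: real where "F = fact (2 * n + e + 1)"
      have F: "2 ^ k * fact k * \<mu> = F"
      proof -
        have f1: "(fact (2 * (n + 1)) :: real) = 2 * (real n + 1) * fact (2 * n + 1)"
          using fact_Suc[of "2 * n + 1", where ?'a = real] by simp
        have f2: "(fact (n + 1) :: real) = (real n + 1) * fact n" by simp
        show ?thesis
        proof (cases "e = 0")
          case True
          have "a * b * (2 * m * g / (2 * a * (m * b))) = g" if "a \<noteq> 0" "b \<noteq> 0" "m \<noteq> 0" for a b m g :: real
            using that by simp
          from this[of "2 ^ n" "fact n" "real n + 1" "fact (2 * n + 1)"] show ?thesis
            unfolding n(1) \<mu>_def F_def f1 f2 using True by (simp del: fact_Suc)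
        next
          case False
          then have "e = 1" using e by simp
          then show ?thesis unfolding n(1) \<mu>_def F_def by (simp del: fact_Suc)
        qed
      qed
      have t: "theta_coeff e p k = 2 ^ e / 8 * (- 1) ^ e * p n * \<mu> * 2 ^ k"
        using False unfolding theta_coeff_def n_def \<mu>_def by (simp del: fact_Suc)
      have "(-1) ^ k * fact k * theta_coeff e p k = ((-1) ^ k * (- 1) ^ e) * (2 ^ e / 8 * p n) * (2 ^ k * fact k * \<mu>)"
        unfolding t by (simp add: mult_ac del: fact_Suc)
      also have "(-1) ^ k * (- 1) ^ e = (-1 :: real) ^ n" using e n(1) by auto
      finally show ?thesis unfolding F F_def[symmetric] by simp
    qed
    finally show ?thesis unfolding e_def .
  qed
qed


section \<open>The leading coefficient and the theorem\<close>

text \<open>The Fourier transform of a cutoff is an admissible competitor in the extremality condition.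
  Its type is at most \<open>1\<close> because the cutoff is supported in \<open>{-1<..<1}\<close>.\<close>

lemma fourier_entire_extension:
  fixes \<kappa> :: "real \<Rightarrow> real"
  assumes \<kappa>: "(\<lambda>x. complex_of_real (\<kappa> x)) \<in> test_functions {-1<..<1}"
    and even: "\<And>x. \<kappa> (- x) = \<kappa> x"
  obtains g where "g holomorphic_on UNIV" "\<And>z. g (- z) = g z" "exp_type_le g 1"
    "\<And>x. g (complex_of_real x) = fourier (\<lambda>x. complex_of_real (\<kappa> x)) x"
    "g 0 = (LINT t|lborel. complex_of_real (\<kappa> t))"
proof -
  define k where "k = (\<lambda>x. complex_of_real (\<kappa> x))"
  note \<kappa>' = \<kappa>[folded k_def]
  define l where "l t = - \<i> * complex_of_real t" for t
  define g where "g z = (LINT t|lborel. exp (z * l t) * k t)" for z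
  have kc: "continuous_on UNIV k" by (rule test_functions_continuous[OF \<kappa>'])
  have kz: "k t = 0" if "\<bar>t\<bar> \<ge> 1" for t by (rule test_functions_zero[OF \<kappa>' that])
  have lc: "continuous_on UNIV l" unfolding l_def by (intro continuous_intros)
  have [measurable]: "k \<in> borel_measurable borel" "l \<in> borel_measurable borel"
    by (intro borel_measurable_continuous_onI kc lc)+
  have int: "integrable lborel (\<lambda>x. exp (r * norm (l x)) * norm (k x))" for r
  proof -
    have "integrable lborel (\<lambda>x. complex_of_real (exp (r * norm (l x)) * norm (k x)))"
    proof (rule integrable_compact_support)
      show "continuous_on UNIV (\<lambda>x. complex_of_real (exp (r * norm (l x)) * norm (k x)))"
        by (intro continuous_intros kc lc)
    qed (use kz in simp)
    then show ?thesis by (simp only: complex_of_real_integrable_eq)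
  qed
  show ?thesis
  proof
    show "g holomorphic_on UNIV"
      unfolding g_def by (rule entire_exp_integral[OF _ _ int]) measurable
    show "g (- z) = g z" for z
    proof -
      have "g z = \<bar>- 1\<bar> *\<^sub>R (LINT t|lborel. exp (z * l (0 + - 1 * t)) * k (0 + - 1 * t))"
        unfolding g_def by (rule lborel_integral_real_affine) simp
      also have "\<dots> = g (- z)"
        unfolding g_def by (simp add: even l_def k_def)
      finally show ?thesis ..
    qed
    show "g (complex_of_real x) = fourier (\<lambda>x. complex_of_real (\<kappa> x)) x" for x
      unfolding g_def fourier_def l_def k_def
      by (intro Bochner_Integration.integral_cong) (auto simp: mult_ac)
    show "g 0 = (LINT t|lborel. complex_of_real (\<kappa> t))" by (simp add: g_def k_def)
    have ki: "integrable lborel k" by (rule test_functions_integrable[OF \<kappa>'])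
    have bound: "norm (g z) \<le> (LINT t|lborel. norm (k t)) * exp (norm z)" for z
    proof -
      have p: "norm (exp (z * l t) * k t) \<le> norm (k t) * exp (norm z)" for t
      proof (cases "\<bar>t\<bar> \<ge> 1")
        case False
        have "norm (exp (z * l t)) \<le> exp (norm (z * l t))" by (rule norm_exp)
        also have "norm (z * l t) \<le> norm z * 1"
          unfolding norm_mult using False by (intro mult_left_mono) (auto simp: l_def norm_mult)
        finally have "norm (exp (z * l t)) \<le> exp (norm z)" by simp
        then have "norm (exp (z * l t)) * norm (k t) \<le> exp (norm z) * norm (k t)"
          by (rule mult_right_mono) simp
        then show ?thesis by (simp add: norm_mult mult.commute)
      qed (use kz in simp)
      have "norm (g z) \<le> (LINT t|lborel. norm (exp (z * l t) * k t))"
        unfolding g_def by (rule integral_norm_bound)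
      also have "\<dots> \<le> (LINT t|lborel. norm (k t) * exp (norm z))"
      proof (rule integral_mono)
        show i: "integrable lborel (\<lambda>t. norm (k t) * exp (norm z))"
          by (intro integrable_mult_left integrable_norm ki)
        show "integrable lborel (\<lambda>t. norm (exp (z * l t) * k t))"
          by (rule Bochner_Integration.integrable_bound[OF i]) (measurable, use p in auto)
      qed (rule p)
      finally show ?thesis by simp
    qed
    show "exp_type_le g 1"
      unfolding exp_type_le_def
    proof (intro allI impI exI)
      fix e :: real and z :: complex assume e: "e > 0"
      have "exp (norm z) \<le> exp ((1 + e) * norm z)" using e by (simp add: distrib_right)
      then show "norm (g z) \<le> (LINT t|lborel. norm (k t)) * exp ((1 + e) * norm z)"
        using bound[of z] by (meson Bochner_Integration.integral_nonneg norm_ge_zero mult_left_mono order_trans)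
    qed
  qed
qed

lemma poly_P_poly_higher_deriv:
  assumes d: "d \<ge> 1"
  shows "(pderiv ^^ (d - 1)) (P_poly d p) = [:fact (d - 1) * p (NN d):]"
proof (rule poly_eqI)
  fix n
  have dd: "d - 1 = 2 * NN d + par d" using dim_eq[OF d] by simp
  have c: "coeff (P_poly d p) (n + (d - 1)) = (if n = 0 then p (NN d) else 0)"
  proof -
    have "coeff (P_poly d p) (n + (d - 1)) = (\<Sum>k\<le>NN d. if k = NN d then (if n = 0 then p (NN d) else 0) else 0)"
      unfolding P_poly_def coeff_sum dd by (intro sum.cong) auto
    then show ?thesis by simp
  qed
  show "coeff ((pderiv ^^ (d - 1)) (P_poly d p)) n = coeff [:fact (d - 1) * p (NN d):] n"
    unfolding coeff_higher_pderiv c by (cases n) (auto simp: pochhammer_fact)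
qed

text \<open>The extremality condition for the transform of a cutoff \<open>\<kappa>\<close> involves the signature times
  \<open>x ^ (d - 1)\<close>, hence \<open>d - 1\<close> derivatives of \<open>\<kappa>\<close> and, after partial integration, \<open>d - 1\<close> derivatives of
  \<open>P_poly\<close>. Only its leading coefficient survives, and the integral of \<open>\<kappa>\<close> cancels. In particular \<open>C * v\<close>
  cannot vanish, so the division in the conclusion is a genuine one.\<close>

lemma leading_coefficient:
  fixes \<phi> :: "complex \<Rightarrow> complex" and p :: "nat \<Rightarrow> real" and C v :: real
  assumes d: "d \<ge> 1"
    and \<sigma> [measurable]: "signature_tilde d \<phi> \<in> borel_measurable borel"
    and \<sigma>1: "\<And>x. \<bar>signature_tilde d \<phi> x\<bar> \<le> 1"
    and T: "\<And>\<psi>. \<psi> \<in> test_functions {-1<..<1} \<Longrightarrow>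
      2 ^ (1 - par d) * \<i> ^ par d * (LINT x|lborel. complex_of_real (signature_tilde d \<phi> x) * fourier \<psi> x)
        = (LINT t|lborel. complex_of_real (poly (P_poly d p) t) * \<psi> t)"
    and extremality: "\<And>g. g holomorphic_on UNIV \<Longrightarrow> (\<And>z. g (- z) = g z) \<Longrightarrow> exp_type_le g 1 \<Longrightarrow>
        integrable lborel (\<lambda>x. complex_of_real (\<bar>x\<bar> ^ (d - 1)) * g (complex_of_real x)) \<Longrightarrow>
        g 0 = complex_of_real (C * (real d * v) / 2) *
          (LINT x|lborel. complex_of_real (signature \<phi> x) * g (complex_of_real x) *
             complex_of_real (\<bar>x\<bar> ^ (d - 1)))"
  shows "r_coeff d p 0 = 1 / (2 * v * C)"
proof -
  define e where "e = par d"
  define N where "N = NN d"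
  have e: "e = 0 \<or> e = 1" unfolding e_def by (rule par_cases)
  have dd: "d = 2 * N + 1 + e" "d - 1 = 2 * N + e" using dim_eq[OF d] by (auto simp: e_def N_def)
  obtain \<kappa> :: "real \<Rightarrow> real" where \<kappa>: "smooth_fun (\<lambda>x. complex_of_real (\<kappa> x))" "\<And>x. \<kappa> (- x) = \<kappa> x"
    "\<And>x. 0 \<le> \<kappa> x" "\<And>x. \<bar>x\<bar> \<le> 1/2 \<Longrightarrow> \<kappa> x = 1" "\<And>x. 3/4 \<le> \<bar>x\<bar> \<Longrightarrow> \<kappa> x = 0"
    by (rule smooth_cutoff) metis
  let ?k = "\<lambda>x. complex_of_real (\<kappa> x)"
  have k: "?k \<in> test_functions {-1<..<1}"
    unfolding test_functions_def
    by (intro CollectI conjI \<kappa>(1) exI[of _ "{-3/4..3/4}"]) (use \<kappa>(5) in \<open>auto simp: abs_le_iff not_le\<close>)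
  have ki: "integrable lborel \<kappa>"
    using test_functions_integrable[OF k] by (simp add: complex_of_real_integrable_eq)
  define I where "I = (LINT t|lborel. \<kappa> t)"
  have "1 \<le> I"
  proof -
    have ind: "integrable lborel (indicator {-1/2..1/2::real} :: real \<Rightarrow> real)"
      by (rule integrable_real_indicator) auto
    have "(LINT t|lborel. indicator {-1/2..1/2::real} t) \<le> I"
      unfolding I_def
      by (rule integral_mono[OF ind ki]) (use \<kappa>(3,4) in \<open>auto simp: indicator_def abs_le_iff\<close>)
    then show ?thesis by simp
  qed
  obtain g where g: "g holomorphic_on UNIV" "\<And>z. g (- z) = g z" "exp_type_le g 1"
    "\<And>x. g (complex_of_real x) = fourier ?k x" "g 0 = (LINT t|lborel. ?k t)"
    using fourier_entire_extension[OF k \<kappa>(2)] by blast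
  have g0: "g 0 = of_real I" unfolding g(5) I_def by simp
  obtain \<theta> where \<theta>: "\<theta> \<in> test_functions {-1<..<1}"
    "\<And>t. fourier \<theta> t = (\<i> * of_real t) ^ (d - 1) * fourier ?k t"
    "\<And>q. (LINT t|lborel. complex_of_real (poly q t) * \<theta> t)
        = (- 1) ^ (d - 1) * (LINT t|lborel. complex_of_real (poly ((pderiv ^^ (d - 1)) q) t) * ?k t)"
    using test_functions_higher_deriv[OF k, of "d - 1"] by blast
  have fk [measurable]: "fourier ?k \<in> borel_measurable borel"
    using borel_measurable_integrable[OF test_functions_integrable[OF k]] by (intro fourier_measurable) simp
  have gi: "integrable lborel (\<lambda>x. complex_of_real (\<bar>x\<bar> ^ (d - 1)) * g (complex_of_real x))"
  proof (rule Bochner_Integration.integrable_bound[OF test_functions_fourier_integrable[OF \<theta>(1)]])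
    show "(\<lambda>x. complex_of_real (\<bar>x\<bar> ^ (d - 1)) * g (complex_of_real x)) \<in> borel_measurable lborel"
      unfolding g(4) by measurable
  qed (simp add: \<theta>(2) g(4) norm_mult norm_power)
  have sg: "complex_of_real (signature \<phi> x) * g (complex_of_real x) * complex_of_real (\<bar>x\<bar> ^ (d - 1))
     = (- \<i>) ^ (d - 1) * (complex_of_real (signature_tilde d \<phi> x) * fourier \<theta> x)" for x
  proof -
    have "signature \<phi> x * \<bar>x\<bar> ^ (d - 1) = signature_tilde d \<phi> x * x ^ (d - 1)"
    proof (cases "odd d")
      case True
      then show ?thesis by (simp add: signature_tilde_def power_even_abs)
    next
      case False
      then have "\<bar>x\<bar> ^ (d - 1) = sgn x * x ^ (d - 1)"
        using d by (cases "x \<ge> 0") (auto simp: sgn_if power_minus_odd)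
      then show ?thesis using False by (simp add: signature_tilde_def)
    qed
    then have "complex_of_real (signature \<phi> x) * complex_of_real (\<bar>x\<bar> ^ (d - 1)) = complex_of_real (signature_tilde d \<phi> x) * of_real x ^ (d - 1)"
      by (simp only: of_real_mult[symmetric] of_real_power[symmetric])
    moreover have "(- \<i>) ^ (d - 1) * (\<i> * complex_of_real x) ^ (d - 1) = of_real x ^ (d - 1)"
      by (simp flip: power_mult_distrib)
    ultimately show ?thesis unfolding \<theta>(2) g(4) by (metis mult.assoc mult.commute)
  qed
  have i1: "of_real I = complex_of_real (C * (real d * v) / 2) *
     ((- \<i>) ^ (d - 1) * (LINT x|lborel. complex_of_real (signature_tilde d \<phi> x) * fourier \<theta> x))"
    using extremality[OF g(1,2,3) gi] unfolding sg g0 by simp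
  have i2: "2 ^ (1 - e) * \<i> ^ e * (LINT x|lborel. complex_of_real (signature_tilde d \<phi> x) * fourier \<theta> x)
     = (- 1) ^ (d - 1) * of_real (fact (d - 1) * p N * I)"
    unfolding e_def T[OF \<theta>(1)] \<theta>(3) poly_P_poly_higher_deriv[OF d] N_def I_def by simp
  have "2 ^ (1 - e) * \<i> ^ e * of_real I = complex_of_real (C * (real d * v) / 2) *
     ((- \<i>) ^ (d - 1) * ((- 1) ^ (d - 1) * of_real (fact (d - 1) * p N * I)))"
  proof -
    have alg: "c * i = K * (m * R)" if "i = K * (m * J)" "c * J = R" for c i K m J R :: complex
      unfolding that(1) that(2)[symmetric] by (simp only: mult_ac)
    show ?thesis by (rule alg[OF i1 i2])
  qed
  also have "(- \<i>) ^ (d - 1) * ((- 1) ^ (d - 1) * complex_of_real (fact (d - 1) * p N * I)) = \<i> ^ (d - 1) * of_real (fact (d - 1) * p N * I)"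
    by (simp flip: power_mult_distrib mult.assoc)
  also have "\<i> ^ (d - 1) = (- 1) ^ N * \<i> ^ e"
    unfolding dd(2) by (simp add: power_add power_mult)
  finally have "complex_of_real (2 ^ (1 - e) * I) = of_real (C * (real d * v) / 2 * ((- 1) ^ N * (fact (d - 1) * p N * I)))"
    using e by auto
  then have "2 ^ (1 - e) * I = C * (real d * v) / 2 * ((- 1) ^ N * (fact (d - 1) * p N)) * I"
    by (simp only: of_real_eq_iff mult.assoc)
  then have main: "2 ^ (1 - e) = C * (real d * v) / 2 * ((- 1) ^ N * (fact (d - 1) * p N))"
    using \<open>1 \<le> I\<close> by simp
  have fd: "real d * fact (d - 1) = (fact d :: real)" using d by (simp add: fact_reduce[of d])
  have m2: "2 * 2 ^ (1 - e) = C * v * ((- 1) ^ N * fact d * p N)"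
    unfolding main fd[symmetric] by simp
  then have nz: "C * v \<noteq> 0" using e by auto
  have r0: "r_coeff d p 0 = 2 ^ e / 8 * ((- 1) ^ N * fact d * p N)"
  proof -
    have pw: "(2::real) powi (int e - 3) = 2 ^ e / 8"
      using e by (auto simp: power_int_def power_divide)
    have "(\<Sum>n\<le>N. if N - n = 0 then (-1) ^ n * fact (2 * n + e + 1) * p n else 0) =
        (\<Sum>n\<le>N. if n = N then (-1) ^ N * fact d * p N else 0)"
      unfolding dd(1) by (intro sum.cong) auto
    moreover have "r_coeff d p 0 = (if N + e = 0 then real e / 2 else 0) + 2 ^ e / 8 * (\<Sum>n\<le>N. if N - n = 0 then (-1) ^ n * fact (2 * n + e + 1) * p n else 0)"
      unfolding r_coeff_def R_poly_def e_def[symmetric] N_def[symmetric] pw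
      by (simp add: coeff_sum del: fact_Suc cong: if_cong)
    ultimately show ?thesis using e by auto
  qed
  show ?thesis
    using m2 nz e unfolding r0 by (auto simp: field_simps)
qed

theorem mainTheorem5:
  fixes d :: nat and \<phi> :: "complex \<Rightarrow> complex" and \<tau> :: "nat \<Rightarrow> real" and p :: "nat \<Rightarrow> real"
  assumes dim: "d = CARD('n::finite)"
    and extremal: "nikolskii_extremal (\<lambda>x :: real ^ 'n. \<phi> (complex_of_real (norm x)))"
    and entire: "\<phi> holomorphic_on UNIV"
    and even: "\<And>z. \<phi> (- z) = \<phi> z"
    and type_one: "exact_exp_type \<phi> 1"
    and bounded_by_one: "\<And>x::real. norm (\<phi> (complex_of_real x)) \<le> 1"
    and zeros_increasing: "strict_mono_on {1..} \<tau>"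
    and zeros: "\<tau> ` {1..} = {x. x > 0 \<and> \<phi> (complex_of_real x) = 0}"
    and zeros_asymp: "\<tau> \<sim>[at_top] (\<lambda>k. pi * real k)"
    and product: "\<And>z. (\<lambda>k. 1 - z ^ 2 / complex_of_real (\<tau> (Suc k)) ^ 2) has_prod \<phi> z"
    and extremality: "\<And>g. g holomorphic_on UNIV \<Longrightarrow> (\<And>z. g (- z) = g z) \<Longrightarrow> exp_type_le g 1 \<Longrightarrow>
        integrable lborel (\<lambda>x. complex_of_real (\<bar>x\<bar> ^ (d - 1)) * g (complex_of_real x)) \<Longrightarrow>
        g 0 = complex_of_real (nikolskii_const TYPE('n) * (real d * vball TYPE('n)) / 2) *
          (LINT x|lborel. complex_of_real (signature \<phi> x) * g (complex_of_real x) *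
             complex_of_real (\<bar>x\<bar> ^ (d - 1)))"
    and P_d: "restricts_to
        (scale_dist (2 ^ (1 - par d) * \<i> ^ par d)
          (fourier_dist (regular_dist (\<lambda>x. complex_of_real (signature_tilde d \<phi> x)))))
        {-1<..<1}
        (\<lambda>t. complex_of_real (poly (P_poly d p) t))"
  shows "\<exists>\<eta> :: complex \<Rightarrow> complex.
      \<eta> holomorphic_on UNIV \<and>
      (\<forall>s. Re s > 0 \<longrightarrow> (\<lambda>k. (-1) ^ k / complex_of_real (\<tau> (Suc k)) powr s) sums \<eta> s) \<and>
      (\<forall>j \<le> NN d + par d. \<eta> (- of_nat d + 2 * of_nat j) = complex_of_real (r_coeff d p j)) \<and>
      \<eta> (- of_nat d) = complex_of_real (r_coeff d p 0) \<and>
      r_coeff d p 0 = nikolskii_a TYPE('n)"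
proof -
  define e where "e = par d"
  define n where "n = NN d + par d"
  define \<sigma> where "\<sigma> = signature_tilde d \<phi>"
  define A where "A x = indicator {\<tau> 1..} x * ((1 - signature \<phi> x) / 2)" for x
  \<comment> \<open>The theta function of the zeros, as an integral over the gaps on which \<open>\<phi>\<close> is negative.\<close>
  define D where "D w = - (LINT x|lborel. A x * theta_kernel e w x)" for w
  have d: "d \<ge> 1" using dim by simp
  have e: "e = 0 \<or> e = 1" unfolding e_def by (rule par_cases)
  have dn: "real d = 2 * real n + 1 - real e"
  proof -
    have "real d = real (2 * NN d + 1 + par d)" using dim_eq[OF d] by simp
    then show ?thesis by (simp add: n_def e_def)
  qed
  have \<tau>pos: "\<tau> (Suc k) > 0" for k using zeros by force
  have incr: "\<tau> (Suc k) < \<tau> (Suc (Suc k))" for k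
    using strict_mono_onD[OF zeros_increasing, of "Suc k" "Suc (Suc k)"] by simp
  have \<tau>lim: "filterlim \<tau> at_top sequentially"
  proof -
    have "filterlim (\<lambda>k. pi * real k) at_top sequentially" by real_asymp
    then show ?thesis using asymp_equiv_at_top_transfer[OF asymp_equiv_symI[OF zeros_asymp]] by blast
  qed
  have sig1: "\<bar>signature \<phi> x\<bar> \<le> 1" for x by (simp add: signature_def sgn_if)
  have [measurable]: "signature \<phi> \<in> borel_measurable borel"
  proof -
    have "continuous_on UNIV (\<lambda>x. \<phi> (complex_of_real x))"
      by (rule continuous_on_compose2[OF holomorphic_on_imp_continuous_on[OF entire]])
         (auto intro!: continuous_intros)
    then have "continuous_on UNIV (\<lambda>x. Re (\<phi> (complex_of_real x)))" by (rule continuous_on_Re)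
    from borel_measurable_continuous_onI[OF this] show ?thesis
      unfolding signature_def[abs_def] sgn_if by measurable
  qed
  have [measurable]: "\<sigma> \<in> borel_measurable borel"
    unfolding \<sigma>_def signature_tilde_def[abs_def] sgn_if by (cases "odd d") (simp, measurable)+
  have \<sigma>1: "\<bar>\<sigma> x\<bar> \<le> 1" for x
    using sig1[of x] by (auto simp: \<sigma>_def signature_tilde_def sgn_if abs_mult)
  have parity: "\<sigma> (- x) = (- 1) ^ e * \<sigma> x" for x
    using even[of "of_real x"] by (auto simp: \<sigma>_def signature_tilde_def signature_def e_def par_def sgn_minus)
  have A_meas [measurable]: "A \<in> borel_measurable borel" unfolding A_def by measurable
  have A01: "0 \<le> A x \<and> A x \<le> 1" for x
    using sig1[of x] by (auto simp: A_def indicator_def abs_le_iff)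
  have A0: "A x = 0" if "x < \<tau> 1" for x using that by (simp add: A_def)
  have \<sigma>A: "\<sigma> x = 1 - 2 * A x" if "x > 0" for x
  proof -
    have "\<sigma> x = signature \<phi> x" using that by (simp add: \<sigma>_def signature_tilde_def)
    then show ?thesis
      using signature_between_zeros(1)[OF product zeros_increasing zeros, of x] that
      by (cases "x < \<tau> 1") (auto simp: A_def field_simps)
  qed
  have A_sgn: "A x = (1 + (-1) ^ k) / 2" if "\<tau> (Suc k) < x" "x < \<tau> (Suc (Suc k))" for k x
  proof -
    have "\<tau> 1 \<le> \<tau> (Suc k)"
      using strict_mono_onD[OF zeros_increasing, of 1 "Suc k"] by (cases "k = 0") auto
    then have "\<tau> 1 \<le> x" using that by simp
    then show ?thesis
      using signature_between_zeros(2)[OF product zeros_increasing zeros that] by (simp add: A_def)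
  qed
  have T: "2 ^ (1 - e) * \<i> ^ e * (LINT x|lborel. complex_of_real (\<sigma> x) * fourier \<psi> x)
        = (LINT t|lborel. complex_of_real (poly (P_poly d p) t) * \<psi> t)"
    if "\<psi> \<in> test_functions {-1<..<1}" for \<psi>
    using P_d that
    by (simp add: restricts_to_def scale_dist_def fourier_dist_def regular_dist_def \<sigma>_def e_def)
  have c: "\<tau> 1 > 0" using \<tau>pos[of 0] by simp
  have D_meas: "D \<in> borel_measurable borel"
    unfolding D_def theta_kernel_def by measurable
  have small: "\<exists>K. \<forall>w. 0 < w \<longrightarrow> w \<le> 1 \<longrightarrow> \<bar>D w - (\<Sum>m\<le>n. theta_coeff e p m * w ^ m)\<bar> \<le> K * w ^ M" for M
    using theta_small[OF e c A_meas A01 A0 _ \<sigma>1 parity \<sigma>A T[unfolded P_poly_def, folded e_def]]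
    unfolding D_def n_def e_def[symmetric] by measurable
  have large: "\<exists>K. \<forall>w\<ge>1. \<bar>D w\<bar> * w ^ M \<le> K" for M
    using theta_large[OF e A_meas A01 A0 c, of M] unfolding D_def by simp
  obtain W where W: "W holomorphic_on UNIV"
    "\<And>z. Re z > 0 \<Longrightarrow> (LINT w|lborel. indicator {0<..} w *\<^sub>R (cpow w (z - 1) * of_real (D w)))
      = W z + (\<Sum>m\<le>n. of_real (theta_coeff e p m) / (z + of_nat m))"
    using mellin_split[OF D_meas small large] by blast
  obtain B where B: "B holomorphic_on UNIV"
    "\<And>z. Re z > 0 \<Longrightarrow> B z = rGamma z * (W z + (\<Sum>m\<le>n. of_real (theta_coeff e p m) / (z + of_nat m)))"
    "\<And>k. k \<le> n \<Longrightarrow> B (- of_nat k) = of_real ((-1) ^ k * fact k * theta_coeff e p k)"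
    using rGamma_continuation[OF W(1)] by blast
  \<comment> \<open>The points \<open>s = - d + 2 * j\<close> correspond to the nonpositive integers \<open>z = j - n\<close>.\<close>
  define \<eta> where "\<eta> s = B ((s + 1 - of_nat e) / 2)" for s
  have hol: "\<eta> holomorphic_on UNIV"
    unfolding \<eta>_def
    by (rule holomorphic_on_compose_gen[OF _ B(1), unfolded o_def]) (auto intro!: holomorphic_intros)
  have sums: "(\<lambda>k. (-1) ^ k / complex_of_real (\<tau> (Suc k)) powr s) sums \<eta> s" if s: "Re s > 0" for s
  proof -
    define z where "z = (s + 1 - of_nat e) / 2"
    have sz: "s = 2 * z - 1 + of_nat e" by (simp add: z_def field_simps)
    have z: "Re z > 0" using s e by (auto simp: z_def)
    have G: "rGamma z * Gamma z = 1"
      using z Gamma_eq_zero_iff[of z] by (auto simp: rGamma_inverse_Gamma elim!: nonpos_Ints_cases)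
    have "\<eta> s = rGamma z * (LINT w|lborel. indicator {0<..} w *\<^sub>R (cpow w (z - 1) * of_real (D w)))"
      unfolding \<eta>_def z_def[symmetric] B(2)[OF z] W(2)[OF z] ..
    also have "\<dots> = rGamma z * (Gamma z * (s * (LINT x|lborel. indicator {\<tau> 1..} x *\<^sub>R (complex_of_real (A x) * cpow x (- s - 1)))))"
      unfolding D_def by (rule arg_cong[OF theta_mellin[OF e A_meas A01 A0 c s sz]])
    also have "\<dots> = s * (LINT x|lborel. indicator {\<tau> 1..} x *\<^sub>R (complex_of_real (A x) * cpow x (- s - 1)))"
      using G by (simp flip: mult.assoc)
    finally have "(\<lambda>k. (-1) ^ k * cpow (\<tau> (Suc k)) (- s)) sums \<eta> s"
      using eta_sums(2)[OF A_sgn A_meas A01 incr c \<tau>lim s] by simp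
    then show ?thesis
      using \<tau>pos by (simp add: powr_eq_cpow cpow_minus divide_inverse)
  qed
  have vals: "\<eta> (- of_nat d + 2 * of_nat j) = complex_of_real (r_coeff d p j)" if j: "j \<le> n" for j
  proof -
    have "complex_of_real (real d) = complex_of_real (2 * real n + 1 - real e)" using dn by simp
    then have "(- of_nat d + 2 * of_nat j + 1 - of_nat e) / 2 = - (of_nat (n - j) :: complex)"
      using j by (simp add: of_nat_diff field_simps)
    then have "\<eta> (- of_nat d + 2 * of_nat j) = of_real ((-1) ^ (n - j) * fact (n - j) * theta_coeff e p (n - j))"
      unfolding \<eta>_def using B(3)[of "n - j"] by simp
    also have "(-1) ^ (n - j) * fact (n - j) * theta_coeff e p (n - j) = r_coeff d p j"
      using r_coeff_theta_coeff[OF d, of "n - j" p] j unfolding n_def e_def by simp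
    finally show ?thesis .
  qed
  have "r_coeff d p 0 = 1 / (2 * vball TYPE('n) * nikolskii_const TYPE('n))"
    by (rule leading_coefficient[OF d _ _ _ extremality]) (use \<sigma>1 T in \<open>auto simp: \<sigma>_def[symmetric] e_def\<close>)
  then have "r_coeff d p 0 = nikolskii_a TYPE('n)" by (simp add: nikolskii_a_def)
  then show ?thesis
    using hol sums vals vals[of 0] unfolding n_def by (intro exI[of _ \<eta>]) auto
qed


end
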